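(* Let $k \geq 3$ be an integer. Then, as $|n| \to \infty$ over non-zero integers $n$: (1) for every $L \geq 3$, $M_k(n, L) = O(1)$, where the implied constant depends on $k$ and $L$ but is independent of $n$; (2) $M_k(n) = O(\log |n|)$, where the implied constant depends on $k$.
   Context: Fix an integer $k\geq 2$ and a non-zero integer $n$. A set of natural numbers $S=\{a_1,\ldots,a_m\}$ is said to satisfy property $D_k(n)$ (a generalized Diophantine $m$-tuple) if $a_ia_j+n$ is a perfect $k$-th power for all $1\le i<j\le m$. Define $M_k(n):=\sup\{|S| : S \text{ satisfies property } D_k(n)\}$ and, for $L>0$, $M_k(n;L):=\sup\{|S\cap[|n|^L,\infty)| : S \text{ satisfies property } D_k(n)\}$ (written $M_k(n,L)$). *)

theory Defs
  imports
    "HOL-Library.Extended_Real"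
    "HOL-Computational_Algebra.Nth_Powers"
    Complex_Main
begin

text \<open>
  Generalized Diophantine tuples: finite sets of positive integers.  The perfect powers are taken
  in the integers, so for odd exponent a negative value of \<open>a * b + n\<close> may also be a power.
\<close>

definition property_D :: "nat \<Rightarrow> int \<Rightarrow> nat set \<Rightarrow> bool" where
  "property_D k n S \<longleftrightarrow>
     finite S \<and> (\<forall>a\<in>S. 0 < a) \<and>
     (\<forall>a\<in>S. \<forall>b\<in>S. a \<noteq> b \<longrightarrow> is_nth_power k (int a * int b + n))"

text \<open>The suprema live in \<^typ>\<open>enat\<close>, so that unboundedness is the value \<open>\<infinity>\<close>.\<close>

definition M :: "nat \<Rightarrow> int \<Rightarrow> enat" where
  "M k n = (SUP S\<in>{S. property_D k n S}. enat (card S))"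

definition M_above :: "nat \<Rightarrow> int \<Rightarrow> real \<Rightarrow> enat" where
  "M_above k n L =
     (SUP S\<in>{S. property_D k n S}. enat (card {a\<in>S. real_of_int \<bar>n\<bar> powr L \<le> real a}))"

end

theory Submission
  imports
    Defs
    "HOL-Number_Theory.Number_Theory"
    "HOL-Computational_Algebra.Squarefree"
    "HOL-Analysis.Analysis"
    "HOL-Real_Asymp.Real_Asymp"
begin

text \<open>
  Put \<open>N = \<bar>n\<bar>\<close>. Elements below \<open>N\<^sup>3\<close> are counted by Gallagher's larger sieve: let \<open>q\<close> be a prime
  divisor of \<open>k\<close> and \<open>p\<close> a prime with \<open>p \<equiv> 1 (mod q)\<close> and \<open>p\<close> not dividing \<open>n\<close>. Then the tuple meets
  only \<open>O(\<surd>p)\<close> classes modulo \<open>p\<close>, because \<open>x \<mapsto> (x b + n) / (x c + n)\<close> is injective modulo \<open>p\<close> when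
  \<open>b \<noteq> c\<close>, so for few \<open>x\<close> both terms lie in the same coset of the \<open>q\<close>-th powers. Taking all such
  primes up to a constant times \<open>(ln N)\<^sup>2\<close> gives \<open>O(ln N)\<close>. That there are enough of them is
  a Chebyshev-type form of Dirichlet's theorem, proved along Mertens' and Shapiro's lines.

  From \<open>N\<^sup>3\<close> on, at most 99 elements occur. Comparing the products of \<open>k\<close>-th roots belonging to
  \<open>(ac+n)(bd+n)\<close> and \<open>(ad+n)(bc+n)\<close>, whose difference is \<open>n(b-a)(d-c)\<close>, shows that the elements grow
  quickly. If \<open>c\<close> is much larger than \<open>b\<close>, the pair of roots of \<open>ac+n\<close>, \<open>bc+n\<close> yields through Pade
  approximation of \<open>w\<close> to the power \<open>1/k\<close> close to 1 such good rational approximations to \<open>(a/b)\<close> to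
  the power \<open>1/k\<close> that no \<open>d \<ge> c\<^sup>9\<close> can satisfy the condition with \<open>a\<close> and \<open>b\<close>.
\<close>

section \<open>Chebyshev and Mertens estimates\<close>

text \<open>The size (ln N)^2 of the sieving primes is forced: with O(sqrt Y) classes modulo each
  prime up to Y and total weight of order Y, the sieve works only once sqrt Y is a large multiple of
  ln N, and it then leaves O(Y / ln N) elements. The primes dividing n weigh at most ln N and do not
  disturb this. Of Dirichlet's theorem only a positive proportion of the weight is required, so
  Mertens-type sums with error O(1) are enough, once no L(1) vanishes. For large elements, k >= 3
  enters as 2k <= 3(k - 1) and as z^3 <= z^k, which lets cubes replace k-th roots; the cutoff N^3
  pays for the cube of N that the gap argument produces. The integer linear form built from a Pade
  approximation may vanish, so two consecutive orders must be available. The exponents 9 and 40 are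
  what the final comparison of logarithms requires. Reaching an exponent h takes 2 h elements, so
  the indices 0, 1, 1 + 2 * 40 = 81 and 81 + 2 * 9 = 99 among 100 elements give a
  contradiction.\<close>

lemma sum_divisors_swap:
  fixes f :: "nat \<Rightarrow> nat \<Rightarrow> 'a::comm_monoid_add"
  shows "(\<Sum>n=1..x. \<Sum>d | d dvd n. f d (n div d)) = (\<Sum>d=1..x. \<Sum>m=1..x div d. f d m)"
proof -
  have "(\<Sum>n=1..x. \<Sum>d | d dvd n. f d (n div d)) =
        (\<Sum>(n,d)\<in>Sigma {1..x} (\<lambda>n. {d. d dvd n}). f d (n div d))"
    by (subst sum.Sigma) auto
  also have "\<dots> = (\<Sum>(d,m)\<in>Sigma {1..x} (\<lambda>d. {1..x div d}). f d m)"
    by (rule sum.reindex_bij_witness[where i = "\<lambda>(d,m). (d * m, d)" and j = "\<lambda>(n,d). (d, n div d)"])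
       (auto simp: div_le_mono dvd_div_eq_0_iff Suc_le_eq dvd_pos_nat less_eq_div_iff_mult_less_eq mult.commute
             dest: dvd_imp_le intro: Nat.gr0I order.trans[OF dvd_imp_le])
  also have "\<dots> = (\<Sum>d=1..x. \<Sum>m=1..x div d. f d m)"
    by (subst sum.Sigma) auto
  finally show ?thesis .
qed

lemma ln_fact_eq_sum_ln: "ln (fact n :: real) = (\<Sum>k=1..n. ln (real k))"
  by (induction n) (auto simp: ln_mult)

definition psi :: "nat \<Rightarrow> real" where
  "psi x = (\<Sum>n=1..x. mangoldt n)"

text \<open>Legendre's formula: \<open>ln\<close> is the divisor sum of \<open>mangoldt\<close>, and
  \<open>d\<close> has \<open>x div d\<close> multiples up to \<open>x\<close>.\<close>

lemma ln_fact_eq_sum_mangoldt: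
  "ln (fact x :: real) = (\<Sum>d=1..x. mangoldt d * real (x div d))"
proof -
  have "ln (fact x :: real) = (\<Sum>n=1..x. \<Sum>d | d dvd n. mangoldt d)"
    unfolding ln_fact_eq_sum_ln using mangoldt_sum[where ?'a = real]
    by (intro sum.cong) auto
  also have "\<dots> = (\<Sum>d=1..x. \<Sum>m=1..x div d. mangoldt d)"
    by (rule sum_divisors_swap)
  finally show ?thesis by (simp add: mult.commute)
qed

text \<open>Chebyshev's argument. In \<open>ln ((2 * m) choose m)\<close> the weight of
  \<open>mangoldt d\<close> is \<open>2 * m div d - 2 * (m div d)\<close>, never negative and at
  least 1 for \<open>m < d \<le> 2 * m\<close>; the binomial coefficient is at most
  \<open>2 ^ (2 * m)\<close>.\<close>

lemma psi_double: "psi (2 * m) - psi m \<le> 2 * real m * ln 2"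
proof -
  have "psi (2 * m) - psi m = (\<Sum>d\<in>{m<..2*m}. mangoldt d)"
  proof -
    have "{1..2*m} = {1..m} \<union> {m<..2*m}" by auto
    thus ?thesis unfolding psi_def by (simp add: sum.union_disjoint disjoint_iff)
  qed
  also have "\<dots> \<le> (\<Sum>d\<in>{m<..2*m}. mangoldt d * (real (2 * m div d) - 2 * real (m div d)))"
  proof (intro sum_mono)
    fix d assume d: "d \<in> {m<..2*m}"
    hence "m div d = 0" "2 * m div d \<ge> 1" by (auto simp: less_eq_div_iff_mult_less_eq)
    thus "mangoldt d \<le> mangoldt d * (real (2 * m div d) - 2 * real (m div d))"
      using mangoldt_nonneg[of d] by (simp add: mult_le_cancel_left1)
  qed
  also have "\<dots> \<le> (\<Sum>d=1..2*m. mangoldt d * (real (2 * m div d) - 2 * real (m div d)))"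
  proof (intro sum_mono2)
    fix d assume "d \<in> {1..2*m} - {m<..2*m}"
    have "2 * (m div d) \<le> 2 * m div d"
      by (cases "d = 0") (auto simp: less_eq_div_iff_mult_less_eq mult.assoc)
    hence "2 * real (m div d) \<le> real (2 * m div d)" by linarith
    thus "0 \<le> mangoldt d * (real (2 * m div d) - 2 * real (m div d))"
      using mangoldt_nonneg[of d] by simp
  qed auto
  also have "\<dots> = ln (fact (2 * m)) - 2 * (\<Sum>d=1..2*m. mangoldt d * real (m div d))"
    unfolding ln_fact_eq_sum_mangoldt by (simp add: right_diff_distrib sum_subtractf sum_distrib_left algebra_simps)
  also have "(\<Sum>d=1..2*m. mangoldt d * real (m div d)) = ln (fact m)"
    unfolding ln_fact_eq_sum_mangoldt by (intro sum.mono_neutral_right) auto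
  also have "ln (fact (2 * m)) - 2 * ln (fact m) = ln (real ((2 * m) choose m))"
    by (subst binomial_fact) (auto simp: ln_div ln_mult)
  also have "\<dots> \<le> ln (2 ^ (2 * m))"
  proof -
    have "real (2 * m choose m) \<le> real (2 ^ (2 * m))"
      unfolding of_nat_le_iff by (rule binomial_le_pow2)
    moreover have "2 * m choose m > 0" by simp
    ultimately show ?thesis by (subst ln_le_cancel_iff) auto
  qed
  also have "\<dots> = 2 * real m * ln 2" by (simp add: ln_realpow)
  finally show ?thesis .
qed

text \<open>Halving: \<open>4 * m\<close> from the induction and \<open>2 * m\<close> from doubling
  leave enough room below \<open>8 * m\<close> for the last term of an odd \<open>x\<close>.\<close>

lemma psi_le: "psi x \<le> 4 * real x"
proof (induction x rule: less_induct)
  case (less x)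
  show ?case
  proof (cases "x = 0")
    case False
    define m where "m = x div 2"
    have ln2: "ln 2 \<le> (1::real)" using ln_le_minus_one[of 2] by simp
    have IH: "psi m \<le> 4 * real m" using False by (intro less.IH) (auto simp: m_def)
    have "psi (2 * m) \<le> psi m + 2 * real m * ln 2" using psi_double[of m] by simp
    also have "\<dots> \<le> 4 * real m + 2 * real m"
      using IH mult_left_mono[OF ln2, of "2 * real m"] by simp
    finally have even: "psi (2 * m) \<le> 6 * real m" by simp
    show ?thesis
    proof (cases "even x")
      case True
      thus ?thesis using even by (auto simp: m_def)
    next
      case odd: False
      hence x: "x = Suc (2 * m)" by (auto simp: m_def)
      have "psi x = psi (2 * m) + mangoldt x" unfolding x psi_def by simp
      moreover have "mangoldt x \<le> ln (real x)" using False by (intro mangoldt_le) auto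
      moreover have "ln (real x) \<le> real x - 1" using False by (intro ln_le_minus_one) auto
      ultimately show ?thesis using even by (simp add: x)
    qed
  qed (simp add: psi_def)
qed

lemma ln_Suc_le:
  assumes "n \<ge> 1"
  shows "ln (real (Suc n)) \<le> ln (real n) + 1 / real n"
proof -
  have "real (Suc n) = real n * (1 + 1 / real n)" using assms by (simp add: field_simps)
  hence "ln (real (Suc n)) = ln (real n) + ln (1 + 1 / real n)"
    using assms by (simp only: ln_mult_pos add_pos_nonneg zero_less_one divide_nonneg_nonneg of_nat_0_le_iff zero_le_one of_nat_0_less_iff Suc_le_eq)
  also have "\<dots> \<le> ln (real n) + 1 / real n" by (intro add_left_mono ln_add_one_self_le_self) auto
  finally show ?thesis .
qed

lemma ln_fact_bounds:
  assumes "x \<ge> 1"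
  shows "real x * ln (real x) - real x \<le> ln (fact x)" "ln (fact x) \<le> real x * ln (real x)"
proof -
  show "ln (fact x) \<le> real x * ln (real x)"
  proof -
    have "ln (fact x :: real) \<le> (\<Sum>k=1..x. ln (real x))"
      unfolding ln_fact_eq_sum_ln by (intro sum_mono) auto
    thus ?thesis by simp
  qed
  show "real x * ln (real x) - real x \<le> ln (fact x)"
    using assms
  proof (induction x rule: dec_induct)
    case (step n)
    have "real (Suc n) * ln (real (Suc n)) = real n * ln (real (Suc n)) + ln (real (Suc n))"
      by (simp add: algebra_simps)
    also have "real n * ln (real (Suc n)) \<le> real n * (ln (real n) + 1 / real n)"
      using step by (intro mult_left_mono ln_Suc_le) auto
    also have "\<dots> = real n * ln (real n) + 1" using step by (simp add: field_simps)
    finally have "real (Suc n) * ln (real (Suc n)) \<le> real n * ln (real n) + 1 + ln (real (Suc n))"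
      by simp
    thus ?case using step by (simp add: ln_mult)
  qed auto
qed

lemma mertens_lower:
  assumes "x \<ge> 1"
  shows "ln (real x) - 1 \<le> (\<Sum>d=1..x. mangoldt d / real d)"
proof -
  have "real x * (ln (real x) - 1) \<le> ln (fact x)"
    using ln_fact_bounds(1)[OF assms] by (simp add: algebra_simps)
  also have "\<dots> \<le> (\<Sum>d=1..x. mangoldt d * (real x / real d))"
    unfolding ln_fact_eq_sum_mangoldt
    by (intro sum_mono mult_left_mono of_nat_div_le_of_nat mangoldt_nonneg)
  also have "\<dots> = real x * (\<Sum>d=1..x. mangoldt d / real d)"
    by (simp add: sum_distrib_left mult_ac)
  finally show ?thesis using assms by simp
qed

text \<open>Each floor in Legendre's formula loses less than 1, so the total loss is at most
  \<open>psi x\<close>, which Chebyshev's bound keeps linear in \<open>x\<close>.\<close>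

lemma mertens_upper:
  assumes "x \<ge> 1"
  shows "(\<Sum>d=1..x. mangoldt d / real d) \<le> ln (real x) + 4"
proof -
  have "real x * (\<Sum>d=1..x. mangoldt d / real d) = (\<Sum>d=1..x. mangoldt d * (real x / real d))"
    by (simp add: sum_distrib_left mult_ac)
  also have "\<dots> \<le> (\<Sum>d=1..x. mangoldt d * (real (x div d) + 1))"
  proof (intro sum_mono mult_left_mono mangoldt_nonneg)
    fix d assume "d \<in> {1..x}"
    hence "real x < real d * (real (x div d) + 1)"
      using dividend_less_times_div[of d x] by (simp flip: of_nat_mult of_nat_Suc add: algebra_simps)
    thus "real x / real d \<le> real (x div d) + 1"
      using \<open>d \<in> {1..x}\<close> by (simp add: divide_le_eq mult.commute)
  qed
  also have "\<dots> = ln (fact x) + psi x"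
    unfolding ln_fact_eq_sum_mangoldt psi_def by (simp add: algebra_simps sum.distrib)
  also have "\<dots> \<le> real x * ln (real x) + 4 * real x"
    using ln_fact_bounds(2)[OF assms] psi_le[of x] by simp
  also have "\<dots> = real x * (ln (real x) + 4)" by (simp add: algebra_simps)
  finally show ?thesis using assms by simp
qed

text \<open>Passing from \<open>n\<close> to \<open>Suc n\<close> multiplies the lcm by at most
  \<open>p\<close> if \<open>Suc n\<close> is a power of \<open>p\<close>, and does not change it
  otherwise. This later bounds the common denominator of the Pade coefficients.\<close>

lemma Lcm_atLeastAtMost_le: "ln (real (Lcm {1..n})) \<le> psi n"
proof (induction n)
  case 0 thus ?case by (simp add: psi_def)
next
  case (Suc n)
  define L where "L = Lcm {1..n}"
  have L0: "L > 0" unfolding L_def by (subst bot_nat_0.not_eq_extremum[symmetric], subst Lcm_0_iff) auto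
  have S: "Lcm {1..Suc n} = lcm (Suc n) L"
    by (simp add: atLeastAtMostSuc_conv L_def)
  have dvd: "i dvd L" if "i \<ge> 1" "i \<le> n" for i
    unfolding L_def using that by (intro dvd_Lcm) auto
  show ?case
  proof (cases "primepow (Suc n)")
    case True
    then obtain p e where pe: "prime p" "e > 0" "Suc n = p ^ e"
      by (auto simp: primepow_def)
    hence p2: "p \<ge> 2" using prime_ge_2_nat by auto
    have e: "Suc n = p * p ^ (e - 1)" using pe by (metis Suc_diff_1 power_Suc)
    moreover have "p ^ (e - 1) < p * p ^ (e - 1)" using p2 by simp
    ultimately have "p ^ (e - 1) \<le> n" by linarith
    hence "p ^ (e - 1) dvd L" using pe prime_gt_0_nat[of p] by (intro dvd) auto
    hence "Suc n dvd p * L" unfolding e by simp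
    hence "lcm (Suc n) L dvd p * L" by (intro lcm_least) auto
    hence "lcm (Suc n) L \<le> p * L" using L0 p2 by (intro dvd_imp_le) auto
    hence "ln (real (Lcm {1..Suc n})) \<le> ln (real (p * L))"
      unfolding S using L0 p2 by (subst ln_le_cancel_iff) (auto simp: lcm_pos_nat simp del: of_nat_mult)
    also have "\<dots> = ln (real p) + ln (real L)" using L0 p2 by (simp add: ln_mult)
    also have "ln (real p) = mangoldt (Suc n)" using pe by simp
    finally show ?thesis using Suc.IH by (simp add: psi_def L_def)
  next
    case False
    have "Suc n dvd L"
    proof (cases "n = 0")
      case n: False
      \<comment> \<open>A number that is no prime power splits into two coprime factors, both
        smaller than itself and hence both already dividing \<open>L\<close>.\<close>
      define p where "p = aprimedivisor (Suc n)"
      define m where "m = multiplicity p (Suc n)"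
      have p: "prime p" "p dvd Suc n"
        using n unfolding p_def by (auto intro!: prime_aprimedivisor' aprimedivisor_dvd')
      obtain c where c: "Suc n = p ^ m * c" "\<not> p dvd c"
        unfolding m_def
        by (rule multiplicity_decompose'[of "Suc n" p]) (use p in auto)
      have m: "m > 0" using p unfolding m_def by (simp add: prime_multiplicity_gt_zero_iff)
      have "c \<noteq> 1" using False c p m by (auto)
      have "p ^ m > 1" using p m one_less_power[of p m] prime_gt_1_nat[of p] by simp
      have "c \<noteq> 0" "p ^ m \<noteq> 0" using c prime_gt_0_nat[OF p(1)] by (auto intro!: Nat.gr0I)
      have "c < Suc n" "p ^ m < Suc n"
        using c \<open>c \<noteq> 1\<close> \<open>p ^ m > 1\<close> \<open>c \<noteq> 0\<close> prime_gt_0_nat[OF p(1)] by auto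
      hence "c dvd L" "p ^ m dvd L" using \<open>c \<noteq> 0\<close> \<open>p ^ m \<noteq> 0\<close> by (auto intro!: dvd)
      moreover have "coprime (p ^ m) c" using p c by (simp add: prime_imp_coprime)
      ultimately show ?thesis unfolding c(1) by (simp add: divides_mult)
    qed auto
    hence "Lcm {1..Suc n} = L" unfolding S by (simp add: lcm_proj2_if_dvd)
    thus ?thesis using Suc.IH mangoldt_nonneg[of "Suc n"] by (simp add: L_def psi_def)
  qed
qed

section \<open>Dirichlet characters and their values L(1)\<close>

text \<open>A proper prime power up to \<open>x\<close> has base at most \<open>sqrt x\<close> and
  exponent at most \<open>log 2 x\<close>. Needed to pass from prime powers to primes in the
  progression.\<close>

lemma sum_mangoldt_nonprime_le:
  assumes x: "x \<ge> 1"
  shows "(\<Sum>n | n \<in> {1..x} \<and> \<not> prime n. mangoldt n) \<le> sqrt (real x) * log 2 (real x) * ln (real x)"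
proof -
  define s where "s = nat \<lfloor>sqrt (real x)\<rfloor>"
  define l where "l = nat \<lfloor>log 2 (real x)\<rfloor>"
  have s: "real s \<le> sqrt (real x)" and l: "real l \<le> log 2 (real x)"
    unfolding s_def l_def using x by auto
  define B where "B = {n \<in> {1..x}. \<not> prime n \<and> primepow n}"
  have sub: "B \<subseteq> (\<lambda>(p,i). p ^ i) ` ({1..s} \<times> {1..l})"
  proof
    fix n assume n: "n \<in> B"
    then obtain p i where pi: "prime p" "i > 0" "n = p ^ i"
      by (auto simp: B_def primepow_def)
    have i: "i \<ge> 2" using n pi by (cases "i = 1") (auto simp: B_def)
    have p2: "p \<ge> 2" using pi prime_ge_2_nat by auto
    have "p ^ 2 \<le> p ^ i" using i p2 by (intro power_increasing) auto
    hence "p ^ 2 \<le> x" using n pi by (auto simp: B_def)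
    hence "real p \<le> sqrt (real x)"
      by (intro real_le_rsqrt) (simp flip: of_nat_power)
    hence ps: "p \<le> s" unfolding s_def by linarith
    have "p ^ i \<le> x" using n pi by (auto simp: B_def)
    moreover have "2 ^ i \<le> p ^ i" using p2 by (intro power_mono) auto
    ultimately have "2 ^ i \<le> x" by (rule order.trans[rotated])
    hence "real i \<le> log 2 (real x)" using x
      by (intro le_log_of_power) (auto simp flip: of_nat_power)
    hence "i \<le> l" unfolding l_def by linarith
    thus "n \<in> (\<lambda>(p,i). p ^ i) ` ({1..s} \<times> {1..l})" using ps pi p2
      by (intro image_eqI[of _ _ "(p,i)"]) auto
  qed
  have "card B \<le> card ((\<lambda>(p,i). p ^ i :: nat) ` ({1..s} \<times> {1..l}))"
    using sub by (intro card_mono) auto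
  also have "\<dots> \<le> card ({1..s} \<times> {1..l})" by (intro card_image_le) auto
  finally have "card B \<le> s * l" by simp
  hence card: "real (card B) \<le> sqrt (real x) * log 2 (real x)"
    using s l by (intro order.trans[OF _ mult_mono[OF s l]]) (auto simp flip: of_nat_mult)
  have "(\<Sum>n | n \<in> {1..x} \<and> \<not> prime n. mangoldt n) = (\<Sum>n\<in>B. mangoldt n :: real)"
    by (intro sum.mono_neutral_right) (auto simp: B_def mangoldt_def)
  also have "\<dots> \<le> (\<Sum>n\<in>B. ln (real x))"
  proof (intro sum_mono)
    fix n assume n: "n \<in> B"
    hence "mangoldt n \<le> ln (real n)" by (intro mangoldt_le) (auto simp: B_def)
    also have "\<dots> \<le> ln (real x)" using n by (auto simp: B_def)
    finally show "mangoldt n \<le> ln (real x)" .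
  qed
  also have "\<dots> = real (card B) * ln (real x)" by simp
  also have "\<dots> \<le> sqrt (real x) * log 2 (real x) * ln (real x)"
    using card x by (intro mult_right_mono) auto
  finally show ?thesis .
qed

section \<open>Moebius function and summation by parts\<close>

definition mu :: "nat \<Rightarrow> int" where
  "mu n = (if squarefree n then (-1) ^ card (prime_factors n) else 0)"

lemma abs_mu_le: "\<bar>mu n\<bar> \<le> 1"
  by (simp add: mu_def)

lemma mu_prime_mult:
  assumes "prime p" "\<not> p dvd d" "d > 0"
  shows "mu (p * d) = - mu d"
proof -
  have cop: "coprime p d" using assms by (simp add: prime_imp_coprime)
  have "prime_factors (p * d) = insert p (prime_factors d)"
    using assms by (subst prime_factors_product) (auto simp: prime_prime_factors)
  moreover have "p \<notin> prime_factors d" using assms by auto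
  moreover have "squarefree (p * d) \<longleftrightarrow> squarefree d"
    using cop assms squarefree_mult_coprime[of p d] squarefree_multD(2)[of p d] squarefree_prime[of p]
    by auto
  ultimately show ?thesis by (simp add: mu_def)
qed

text \<open>For a fixed prime \<open>p\<close> dividing \<open>n\<close>, the squarefree divisors
  pair off as \<open>d\<close> and \<open>p * d\<close> with opposite signs.\<close>

lemma sum_mu_divisors:
  assumes "n > 0"
  shows "(\<Sum>d | d dvd n. mu d) = (if n = 1 then 1 else 0)"
proof (cases "n = 1")
  case False
  obtain p where p: "prime p" "p dvd n" using False prime_factor_nat by auto
  have fin: "finite {d. d dvd n}" using assms by simp
  define A where "A = {d. d dvd n \<and> \<not> p dvd d \<and> squarefree d}"
  define B where "B = {d. d dvd n \<and> p dvd d \<and> squarefree d}"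
  have "(\<Sum>d | d dvd n. mu d) = (\<Sum>d\<in>A \<union> B. mu d)"
    using fin by (intro sum.mono_neutral_right) (auto simp: A_def B_def mu_def)
  also have "\<dots> = (\<Sum>d\<in>A. mu d) + (\<Sum>d\<in>B. mu d)"
    using fin by (intro sum.union_disjoint) (auto simp: A_def B_def)
  also have "(\<Sum>d\<in>B. mu d) = (\<Sum>d\<in>A. mu (p * d))"
  proof (rule sum.reindex_bij_witness[where i = "\<lambda>d. p * d" and j = "\<lambda>d. d div p"])
    fix d assume d: "d \<in> B"
    then obtain e where e: "d = p * e" by (auto simp: B_def)
    have "\<not> p dvd e"
    proof
      assume "p dvd e"
      hence "p ^ 2 dvd d" by (auto simp: e power2_eq_square)
      hence "is_unit p" using d by (auto simp: B_def squarefree_def)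
      thus False using p by auto
    qed
    moreover have "squarefree e" using d e squarefree_multD(2) by (auto simp: B_def)
    moreover have "e dvd n" using d e by (auto simp: B_def dest: dvd_mult_right)
    ultimately show "d div p \<in> A" "p * (d div p) = d" "mu (p * (d div p)) = mu d"
      using p e by (auto simp: A_def prime_gt_0_nat)
  next
    fix d assume d: "d \<in> A"
    have "coprime p d" using d p by (auto simp: A_def prime_imp_coprime)
    hence "p * d dvd n" "squarefree (p * d)" using d p
      by (auto simp: A_def divides_mult intro: squarefree_mult_coprime squarefree_prime)
    thus "p * d \<in> B" "p * d div p = d" using p by (auto simp: B_def prime_gt_0_nat)
  qed
  also have "\<dots> = (\<Sum>d\<in>A. - mu d)"
    using p assms by (intro sum.cong refl mu_prime_mult) (auto simp: A_def intro: dvd_pos_nat)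
  finally show ?thesis using False by (simp add: sum_negf)
qed (auto simp: mu_def)

text \<open>Summation by parts: the differences of the decreasing weights telescope to
  \<open>w a - w b\<close>, and the boundary term contributes the remaining
  \<open>w b\<close>.\<close>

lemma abel_sum_bound:
  fixes f :: "nat \<Rightarrow> 'a::real_normed_vector" and w :: "nat \<Rightarrow> real"
  assumes bound: "\<And>m. norm (\<Sum>n=a..<m. f n) \<le> K"
    and dec: "\<And>n. n \<ge> a \<Longrightarrow> w (Suc n) \<le> w n"
    and nonneg: "\<And>n. n \<ge> a \<Longrightarrow> 0 \<le> w n"
  shows "norm (\<Sum>n=a..<b. w n *\<^sub>R f n) \<le> K * w a"
proof (cases "a \<le> b")
  case True
  define A where "A m = (\<Sum>n=a..<m. f n)" for m
  have eq: "(\<Sum>n=a..<b. w n *\<^sub>R f n) = w b *\<^sub>R A b + (\<Sum>n=a..<b. (w n - w (Suc n)) *\<^sub>R A (Suc n))"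
    using True
  proof (induction b rule: dec_induct)
    case (step n)
    have "A (Suc n) = A n + f n" using step by (simp add: A_def)
    thus ?case using step by (simp add: algebra_simps)
  qed (simp add: A_def)
  have "norm (w b *\<^sub>R A b + (\<Sum>n=a..<b. (w n - w (Suc n)) *\<^sub>R A (Suc n)))
        \<le> w b * K + (\<Sum>n=a..<b. (w n - w (Suc n)) * K)"
    using bound dec nonneg True
    by (intro norm_triangle_le add_mono order.trans[OF norm_sum] sum_mono)
       (auto simp: A_def simp del: sum.op_ivl_Suc intro!: mult_left_mono)
  also have "(\<Sum>n=a..<b. (w n - w (Suc n)) * K) = (w a - w b) * K"
    using True by (induction b rule: dec_induct) (auto simp: algebra_simps)
  finally show ?thesis using eq by (simp add: algebra_simps)
next
  case False
  have "0 \<le> K" using bound[of a] by simp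
  thus ?thesis using False nonneg[of a] by simp
qed

text \<open>That the character is not principal is expressed by its vanishing sum over a period, the
  form in which it bounds partial sums.\<close>

locale nonprincipal_char =
  fixes q :: nat and chi :: "nat \<Rightarrow> complex"
  assumes q_pos: "q > 0"
    and mult: "chi (m * n) = chi m * chi n"
    and one: "chi 1 = 1"
    and norm_le: "norm (chi n) \<le> 1"
    and periodic: "chi (n + q) = chi n"
    and sum_period: "(\<Sum>n<q. chi n) = 0"
begin

lemma sum_lessThan_bound: "norm (\<Sum>n<N. chi n) \<le> real q"
proof (induction N rule: less_induct)
  case (less N)
  show ?case
  proof (cases "N \<le> q")
    case True
    have "norm (\<Sum>n<N. chi n) \<le> (\<Sum>n<N. 1)"
      by (intro order.trans[OF norm_sum] sum_mono norm_le)
    thus ?thesis using True by simp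
  next
    case False
    define M where "M = N - q"
    have N: "N = q + M" using False by (simp add: M_def)
    have "(\<Sum>n<N. chi n) = (\<Sum>n<q. chi n) + (\<Sum>n<M. chi (n + q))"
      unfolding N by (induction M) (auto simp: add_ac)
    also have "\<dots> = (\<Sum>n<M. chi n)" by (simp add: sum_period periodic)
    finally show ?thesis using less.IH[of M] q_pos N by simp
  qed
qed

lemma sum_interval_bound: "norm (\<Sum>n=a..<b. chi n) \<le> 2 * real q"
proof (cases "a \<le> b")
  case True
  have "{..<b} = {..<a} \<union> {a..<b}" using True by auto
  hence "(\<Sum>n<b. chi n) = (\<Sum>n<a. chi n) + (\<Sum>n=a..<b. chi n)"
    by (simp add: sum.union_disjoint disjoint_iff)
  hence "(\<Sum>n=a..<b. chi n) = (\<Sum>n<b. chi n) - (\<Sum>n<a. chi n)" by simp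
  thus ?thesis using sum_lessThan_bound[of a] sum_lessThan_bound[of b]
    by (smt (verit) norm_triangle_ineq4)
qed auto

lemma weighted_bound:
  assumes "\<And>n. n \<ge> a \<Longrightarrow> w (Suc n) \<le> w n" and "\<And>n. n \<ge> a \<Longrightarrow> 0 \<le> w n"
  shows "norm (\<Sum>n=a..<b. of_real (w n) * chi n) \<le> 2 * real q * w a"
  using abel_sum_bound[OF sum_interval_bound, of a w b] assms by (simp add: scaleR_conv_of_real)

definition T :: "nat \<Rightarrow> complex" where "T x = (\<Sum>n=1..x. chi n / of_nat n)"

definition L :: complex where "L = lim T"

text \<open>Partial sums of the series for the negative logarithmic derivative of the L-function at
  1, just as \<open>T\<close> belongs to the L-function itself.\<close>

definition S :: "nat \<Rightarrow> complex" where "S x = (\<Sum>n=1..x. chi n * mangoldt n / of_nat n)"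

lemma T_diff:
  assumes "x \<le> y"
  shows "norm (T y - T x) \<le> 2 * real q / real (Suc x)"
proof -
  have "{1..y} = {1..x} \<union> {Suc x..<Suc y}" using assms by auto
  hence "T y = T x + (\<Sum>n=Suc x..<Suc y. chi n / of_nat n)"
    unfolding T_def by (simp add: sum.union_disjoint disjoint_iff)
  hence "T y - T x = (\<Sum>n=Suc x..<Suc y. of_real (1 / real n) * chi n)"
    by (simp add: mult.commute field_simps)
  moreover have "norm \<dots> \<le> 2 * real q * (1 / real (Suc x))"
    by (rule weighted_bound) (auto simp: field_simps)
  ultimately show ?thesis by simp
qed

lemma T_tendsto: "T \<longlonglongrightarrow> L"
proof -
  have "Cauchy T"
  proof (rule CauchyI')
    fix e :: real assume e: "e > 0"
    obtain M where M: "real M > 2 * real q / e" using reals_Archimedean2 by blast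
    show "\<exists>M. \<forall>m\<ge>M. \<forall>n>m. dist (T m) (T n) < e"
    proof (intro exI allI impI)
      fix m n assume mn: "M \<le> m" "m < n"
      have "dist (T m) (T n) \<le> 2 * real q / real (Suc m)"
        using T_diff[of m n] mn by (simp add: dist_norm norm_minus_commute)
      also have "\<dots> < e"
      proof -
        have "2 * real q < e * real M" using M e by (simp add: field_simps)
        also have "\<dots> \<le> e * real (Suc m)" using mn e by (intro mult_left_mono) auto
        finally show ?thesis by (simp add: field_simps)
      qed
      finally show "dist (T m) (T n) < e" .
    qed
  qed
  thus ?thesis unfolding L_def by (simp add: Cauchy_convergent_iff convergent_LIMSEQ_iff)
qed

lemma L_minus_T: "norm (L - T x) \<le> 2 * real q / real (Suc x)"
proof (rule tendsto_upperbound)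
  show "((\<lambda>y. norm (T y - T x)) \<longlongrightarrow> norm (L - T x)) sequentially"
    by (intro tendsto_intros T_tendsto)
  show "\<forall>\<^sub>F y in sequentially. norm (T y - T x) \<le> 2 * real q / real (Suc x)"
    using eventually_ge_at_top[of x] by eventually_elim (rule T_diff)
qed auto

text \<open>The weights \<open>ln n / n\<close> decrease only from \<open>n = 3\<close> on, where
  \<open>ln n \<ge> 1\<close>. The term at 1 vanishes, and the term at 2 is the additional 1 of the
  bound.\<close>

lemma ln_over_bound: "norm (\<Sum>n=1..x. chi n * of_real (ln (real n)) / of_nat n) \<le> 1 + 2 * real q"
proof -
  define w where "w n = ln (real n) / real n" for n
  have dec: "w (Suc n) \<le> w n" if "n \<ge> 3" for n
  proof -
    have "exp 1 \<le> (3::real)" by (rule exp_le)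
    hence "ln (exp 1) \<le> ln (real n)" using that by (subst ln_le_cancel_iff) auto
    hence l1: "ln (real n) \<ge> 1" by simp
    have "ln (real (Suc n)) \<le> ln (real n) + 1 / real n" using that by (intro ln_Suc_le) auto
    also have "\<dots> \<le> ln (real n) + ln (real n) / real n" using l1 by (intro add_left_mono divide_right_mono) auto
    finally show ?thesis using that by (simp add: w_def field_simps)
  qed
  have nn: "w n \<ge> 0" for n by (cases "n = 0") (auto simp: w_def)
  have w3: "w n \<le> 1 / 1" if "n > 0" for n
    unfolding w_def using ln_le_minus_one[of "real n"] that by (simp add: field_simps)
  have eq: "(\<Sum>n=1..x. chi n * of_real (ln (real n)) / of_nat n) = (\<Sum>n=1..x. of_real (w n) * chi n)"
    by (intro sum.cong) (auto simp: w_def)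
  show ?thesis
  proof (cases "x \<ge> 2")
    case True
    have "{1..x} = {1,2} \<union> {3..<Suc x}" using True by auto
    hence "(\<Sum>n=1..x. of_real (w n) * chi n) = of_real (w 2) * chi 2 + (\<Sum>n=3..<Suc x. of_real (w n) * chi n)"
      by (simp add: sum.union_disjoint disjoint_iff w_def)
    also have "norm \<dots> \<le> 1 * 1 + 2 * real q * w 3"
      using w3[of 2] norm_le[of 2] nn[of 2]
      by (intro norm_triangle_le add_mono weighted_bound dec nn) (auto simp: norm_mult intro!: mult_le_one)
    also have "\<dots> \<le> 1 + 2 * real q * 1" using w3[of 3] by (intro add_mono mult_left_mono) auto
    finally show ?thesis using eq by simp
  next
    case False
    hence "x = 0 \<or> x = 1" by auto
    thus ?thesis by auto
  qed
qed

text \<open>The identity \<open>ln = mangoldt * 1\<close> for Dirichlet convolution survives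
  twisting, because \<open>chi\<close> is completely multiplicative.\<close>

lemma sum_ln_conv: "(\<Sum>n=1..x. chi n * of_real (ln (real n)) / of_nat n) =
    (\<Sum>d=1..x. chi d * mangoldt d / of_nat d * T (x div d))"
proof -
  have "(\<Sum>n=1..x. chi n * of_real (ln (real n)) / of_nat n) =
        (\<Sum>n=1..x. \<Sum>d | d dvd n. chi d * mangoldt d / of_nat d * (chi (n div d) / of_nat (n div d)))"
  proof (intro sum.cong refl)
    fix n assume n: "n \<in> {1..x}"
    have "chi n * of_real (ln (real n)) / of_nat n = (\<Sum>d | d dvd n. chi n * mangoldt d / of_nat n)"
      using mangoldt_sum[of n, where ?'a = complex] n
      by (simp add: sum_distrib_left sum_divide_distrib[symmetric] flip: sum_distrib_left)
    also have "\<dots> = (\<Sum>d | d dvd n. chi d * mangoldt d / of_nat d * (chi (n div d) / of_nat (n div d)))"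
    proof (intro sum.cong refl)
      fix d assume "d \<in> {d. d dvd n}"
      then obtain e where e: "n = d * e" by auto
      have "d > 0" "e > 0" using n e by (auto intro!: Nat.gr0I)
      thus "chi n * mangoldt d / of_nat n = chi d * mangoldt d / of_nat d * (chi (n div d) / of_nat (n div d))"
        by (simp add: e mult)
    qed
    finally show "chi n * of_real (ln (real n)) / of_nat n =
      (\<Sum>d | d dvd n. chi d * mangoldt d / of_nat d * (chi (n div d) / of_nat (n div d)))" .
  qed
  also have "\<dots> = (\<Sum>d=1..x. \<Sum>m=1..x div d. chi d * mangoldt d / of_nat d * (chi m / of_nat m))"
    by (rule sum_divisors_swap)
  finally show ?thesis by (simp add: T_def sum_distrib_left)
qed

lemma inverse_Suc_div_le:
  assumes "d \<ge> 1" "x \<ge> 1"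
  shows "1 / real (Suc (x div d)) \<le> real d / real x"
proof -
  have "x < d * Suc (x div d)" using dividend_less_times_div[of d x] assms by simp
  hence "real x \<le> real d * real (Suc (x div d))"
    unfolding of_nat_mult[symmetric] of_nat_le_iff by simp
  thus ?thesis using assms by (simp add: field_simps)
qed

text \<open>Replacing each \<open>T (x div d)\<close> in \<open>sum_ln_conv\<close> by its limit
  costs at most \<open>2 * q / x * mangoldt d\<close>, in total
  \<open>2 * q / x * psi x \<le> 8 * q\<close>.\<close>

lemma L_S_bound: "norm (L * S x) \<le> 1 + 10 * real q"
proof (cases "x = 0")
  case False
  have "L * S x = (\<Sum>d=1..x. chi d * mangoldt d / of_nat d * (L - T (x div d))) +
                  (\<Sum>n=1..x. chi n * of_real (ln (real n)) / of_nat n)"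
    unfolding sum_ln_conv S_def sum_distrib_left sum.distrib[symmetric]
    by (intro sum.cong) (auto simp: field_simps)
  moreover have "norm (\<Sum>d=1..x. chi d * mangoldt d / of_nat d * (L - T (x div d)))
      \<le> (\<Sum>d=1..x. 2 * real q / real x * mangoldt d)"
  proof (intro order.trans[OF norm_sum] sum_mono)
    fix d assume d: "d \<in> {1..x}"
    have "norm (L - T (x div d)) \<le> 2 * real q * (1 / real (Suc (x div d)))" using L_minus_T[of "x div d"] by simp
    also have "\<dots> \<le> 2 * real q * (real d / real x)"
      using d False by (intro mult_left_mono inverse_Suc_div_le) auto
    finally have 1: "norm (L - T (x div d)) \<le> 2 * real q * (real d / real x)" .
    have "norm (chi d * mangoldt d / of_nat d * (L - T (x div d))) =
          norm (chi d) * (mangoldt d / real d) * norm (L - T (x div d))"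
      by (simp add: norm_mult norm_divide mangoldt_nonneg)
    also have "\<dots> \<le> 1 * (mangoldt d / real d) * (2 * real q * (real d / real x))"
      using mangoldt_nonneg[of d] by (intro mult_mono 1 norm_le) auto
    also have "\<dots> = 2 * real q / real x * mangoldt d" using d by simp
    finally show "norm (chi d * mangoldt d / of_nat d * (L - T (x div d))) \<le> 2 * real q / real x * mangoldt d" .
  qed
  moreover have "(\<Sum>d=1..x. 2 * real q / real x * mangoldt d) \<le> 8 * real q"
  proof -
    have "(\<Sum>d=1..x. 2 * real q / real x * mangoldt d) = 2 * real q / real x * psi x"
      by (simp add: psi_def sum_distrib_left)
    also have "\<dots> \<le> 2 * real q / real x * (4 * real x)" by (intro mult_left_mono psi_le) auto
    finally show ?thesis using False by simp
  qed
  ultimately show ?thesis using ln_over_bound[of x]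
    by (smt (verit) norm_triangle_ineq)
qed (simp add: S_def)

lemma S_bounded:
  assumes "L \<noteq> 0"
  shows "\<exists>K. \<forall>x. norm (S x) \<le> K"
  using L_S_bound assms by (intro exI[of _ "(1 + 10 * real q) / norm L"]) (auto simp: norm_mult field_simps)

text \<open>Moebius inversion of \<open>\<Sum>l\<le>y. chi l / l * (ln (y / l) + S (y / l)) = ln y * T y\<close>.\<close>

lemma S_vanishing:
  assumes "L = 0" "x \<ge> 1"
  shows "norm (of_real (ln (real x)) + S x) \<le> 2 * real q"
proof -
  \<comment> \<open>The bracket of the convolution identity at \<open>y = x / m\<close>, rounded in
    \<open>S\<close> only; since \<open>x div m div l = x div (m * l)\<close>, scaling by
    \<open>m\<close> and by \<open>l\<close> composes.\<close>
  define F where "F m = of_real (ln (real x / real m)) + S (x div m)" for m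
  have G: "(\<Sum>l=1..x div m. chi l / of_nat l * F (m * l)) = of_real (ln (real x / real m)) * T (x div m)"
    if m: "m \<in> {1..x}" for m
  proof -
    have "(\<Sum>l=1..x div m. chi l / of_nat l * S (x div (m * l))) =
          (\<Sum>l=1..x div m. \<Sum>d=1..x div m div l. chi l / of_nat l * (chi d * mangoldt d / of_nat d))"
      by (simp add: S_def sum_distrib_left div_mult2_eq)
    also have "\<dots> = (\<Sum>n=1..x div m. \<Sum>l | l dvd n. chi l / of_nat l * (chi (n div l) * mangoldt (n div l) / of_nat (n div l)))"
      by (rule sum_divisors_swap[symmetric])
    also have "\<dots> = (\<Sum>n=1..x div m. \<Sum>d | d dvd n. chi (n div d) / of_nat (n div d) * (chi d * mangoldt d / of_nat d))"
    proof (rule sum.cong[OF refl])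
      fix n assume n: "n \<in> {1..x div m}"
      show "(\<Sum>l | l dvd n. chi l / of_nat l * (chi (n div l) * mangoldt (n div l) / of_nat (n div l))) =
            (\<Sum>d | d dvd n. chi (n div d) / of_nat (n div d) * (chi d * mangoldt d / of_nat d))"
        by (rule sum.reindex_bij_witness[where i = "\<lambda>d. n div d" and j = "\<lambda>d. n div d"]) (use n in auto)
    qed
    also have "\<dots> = (\<Sum>n=1..x div m. chi n * of_real (ln (real n)) / of_nat n)"
    proof (intro sum.cong refl)
      fix n assume n: "n \<in> {1..x div m}"
      have "(\<Sum>d | d dvd n. chi (n div d) / of_nat (n div d) * (chi d * mangoldt d / of_nat d)) =
            (\<Sum>d | d dvd n. chi n / of_nat n * mangoldt d)"
      proof (intro sum.cong refl)
        fix d assume "d \<in> {d. d dvd n}"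
        then obtain e where e: "n = d * e" by auto
        have "d > 0" "e > 0" using n e by (auto intro!: Nat.gr0I)
        thus "chi (n div d) / of_nat (n div d) * (chi d * mangoldt d / of_nat d) = chi n / of_nat n * mangoldt d"
          by (simp add: e mult mult_ac)
      qed
      also have "\<dots> = chi n / of_nat n * of_real (ln (real n))"
        unfolding sum_distrib_left[symmetric]
        using mangoldt_sum[of n, where ?'a = complex] n by simp
      finally show "(\<Sum>d | d dvd n. chi (n div d) / of_nat (n div d) * (chi d * mangoldt d / of_nat d)) =
            chi n * of_real (ln (real n)) / of_nat n" by simp
    qed
    also have "\<dots> + (\<Sum>l=1..x div m. chi l / of_nat l * of_real (ln (real x / real (m * l)))) =
       (\<Sum>l=1..x div m. chi l / of_nat l * of_real (ln (real x / real m)))"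
      unfolding sum.distrib[symmetric]
    proof (intro sum.cong refl)
      fix l assume l: "l \<in> {1..x div m}"
      have "ln (real x / real m) = ln (real l) + ln (real x / real (m * l))"
        using l m assms by (subst ln_mult_pos[symmetric]) auto
      thus "chi l * of_real (ln (real l)) / of_nat l + chi l / of_nat l * of_real (ln (real x / real (m * l))) =
            chi l / of_nat l * of_real (ln (real x / real m))"
        by (simp add: algebra_simps add_divide_distrib)
    qed
    finally show ?thesis
      by (simp add: F_def T_def sum.distrib algebra_simps sum_distrib_left sum_distrib_right)
  qed
  have "(\<Sum>m=1..x. of_int (mu m) * (chi m / of_nat m) * (of_real (ln (real x / real m)) * T (x div m))) =
        (\<Sum>m=1..x. \<Sum>l=1..x div m. of_int (mu m) * (chi m / of_nat m) * (chi l / of_nat l * F (m * l)))"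
    by (intro sum.cong refl) (simp add: G[symmetric] sum_distrib_left)
  also have "\<dots> = (\<Sum>n=1..x. \<Sum>m | m dvd n. of_int (mu m) * (chi m / of_nat m) * (chi (n div m) / of_nat (n div m) * F (m * (n div m))))"
    by (rule sum_divisors_swap[symmetric])
  also have "\<dots> = (\<Sum>n=1..x. chi n / of_nat n * F n * of_int (\<Sum>m | m dvd n. mu m))"
    unfolding of_int_sum sum_distrib_left
  proof (intro sum.cong refl)
    fix n m assume n: "n \<in> {1..x}" and "m \<in> {m. m dvd n}"
    then obtain e where e: "n = m * e" by auto
    have "m > 0" "e > 0" using n e by (auto intro!: Nat.gr0I)
    thus "of_int (mu m) * (chi m / of_nat m) * (chi (n div m) / of_nat (n div m) * F (m * (n div m))) =
       chi n / of_nat n * F n * of_int (mu m)" by (simp add: e mult)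
  qed
  also have "\<dots> = (\<Sum>n=1..x. if n = 1 then F 1 else 0)"
    using one by (intro sum.cong refl) (simp add: sum_mu_divisors)
  also have "\<dots> = of_real (ln (real x)) + S x" using assms by (simp add: F_def)
  finally have eq: "of_real (ln (real x)) + S x =
    (\<Sum>m=1..x. of_int (mu m) * (chi m / of_nat m) * (of_real (ln (real x / real m)) * T (x div m)))" ..
  have "norm (of_real (ln (real x)) + S x) \<le> (\<Sum>m=1..x. 2 * real q / real x * (ln (real x) - ln (real m)))"
    unfolding eq
  proof (intro order.trans[OF norm_sum] sum_mono)
    fix m assume m: "m \<in> {1..x}"
    \<comment> \<open>With \<open>L = 0\<close>, the partial sum \<open>T\<close> is minus its own
      tail, and so of size \<open>m / x\<close>.\<close>
    have T: "norm (T (x div m)) \<le> 2 * real q * (real m / real x)"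
    proof -
      have "norm (T (x div m)) \<le> 2 * real q * (1 / real (Suc (x div m)))"
        using L_minus_T[of "x div m"] assms by simp
      also have "\<dots> \<le> 2 * real q * (real m / real x)"
        using m assms by (intro mult_left_mono inverse_Suc_div_le) auto
      finally show ?thesis .
    qed
    have lnn: "ln (real x / real m) \<ge> 0" using m by simp
    have "norm (of_int (mu m) * (chi m / of_nat m) * (of_real (ln (real x / real m)) * T (x div m)))
      = \<bar>real_of_int (mu m)\<bar> * (norm (chi m) / real m) * (ln (real x / real m) * norm (T (x div m)))"
      using lnn by (simp add: norm_mult norm_divide)
    also have "\<dots> \<le> 1 * (1 / real m) * (ln (real x / real m) * (2 * real q * (real m / real x)))"
      using abs_mu_le[of m] lnn
      by (intro mult_mono divide_right_mono norm_le T) (auto simp flip: of_int_abs)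
    also have "\<dots> = 2 * real q / real x * (ln (real x) - ln (real m))"
      using m by (simp add: ln_div)
    finally show "norm (of_int (mu m) * (chi m / of_nat m) * (of_real (ln (real x / real m)) * T (x div m))) \<le>
      2 * real q / real x * (ln (real x) - ln (real m))" .
  qed
  \<comment> \<open>The sum of \<open>ln (x / m)\<close> equals
    \<open>x * ln x - ln (fact x)\<close>, which is at most \<open>x\<close>; a trivial bound of
    each term by \<open>ln x\<close> would lose a logarithm.\<close>
  also have "\<dots> = 2 * real q / real x * (real x * ln (real x) - ln (fact x))"
    unfolding sum_distrib_left[symmetric] by (simp add: sum_subtractf ln_fact_eq_sum_ln)
  also have "\<dots> \<le> 2 * real q / real x * real x"
    using ln_fact_bounds(1)[of x] assms by (intro mult_left_mono) auto
  finally show ?thesis using assms by simp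
qed

end

section \<open>Non-vanishing of L(1) for real characters\<close>

lemma sum_dvd_prime_power_mult:
  fixes g :: "nat \<Rightarrow> 'a::comm_monoid_add"
  assumes "prime p" "\<not> p dvd m" "m > 0"
  shows "(\<Sum>d | d dvd p ^ a * m. g d) = (\<Sum>i\<le>a. \<Sum>d | d dvd m. g (p ^ i * d))"
proof -
  have p0: "p > 0" using assms prime_gt_0_nat by auto
  have "(\<Sum>i\<le>a. \<Sum>d | d dvd m. g (p ^ i * d)) = (\<Sum>(i,d)\<in>{..a} \<times> {d. d dvd m}. g (p ^ i * d))"
    by (simp add: sum.cartesian_product)
  also have "\<dots> = (\<Sum>d | d dvd p ^ a * m. g d)"
  proof (rule sum.reindex_bij_witness[where
        j = "\<lambda>(i,d). p ^ i * d" and i = "\<lambda>n. (multiplicity p n, n div p ^ multiplicity p n)"])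
    fix x assume x: "x \<in> {..a} \<times> {d. d dvd m}"
    obtain i d where id: "x = (i, d)" "i \<le> a" "d dvd m" using x by auto
    have nd: "\<not> p dvd d" using id assms dvd_trans by blast
    have "d \<noteq> 0" using id assms by auto
    have "multiplicity p (p ^ i * d) = i"
      using nd assms \<open>d \<noteq> 0\<close> p0
      by (intro multiplicity_eqI) (auto simp: prime_elem_multiplicity_mult_distrib)
    thus "(multiplicity p (case x of (i, d) \<Rightarrow> p ^ i * d),
           (case x of (i, d) \<Rightarrow> p ^ i * d) div p ^ multiplicity p (case x of (i, d) \<Rightarrow> p ^ i * d)) = x"
      using p0 by (simp add: id)
    show "(case x of (i, d) \<Rightarrow> p ^ i * d) \<in> {d. d dvd p ^ a * m}"
      using id by (auto intro!: mult_dvd_mono le_imp_power_dvd)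
  next
    fix n assume "n \<in> {d. d dvd p ^ a * m}"
    hence n: "n dvd p ^ a * m" by simp
    have n0: "n > 0" using n p0 assms by (auto intro: dvd_pos_nat[OF _ n])
    define i where "i = multiplicity p n"
    define d where "d = n div p ^ i"
    have nn: "n = p ^ i * d" unfolding d_def i_def by (simp add: multiplicity_dvd)
    have nd: "\<not> p dvd d"
      unfolding d_def i_def using n0 assms
      by (intro multiplicity_decompose) auto
    have "p ^ i dvd p ^ a * m" using n nn by (metis dvd_mult_left)
    hence "p ^ i dvd p ^ a"
      using assms by (metis coprime_commute coprime_dvd_mult_left_iff coprime_power_left_iff prime_imp_coprime)
    hence ia: "i \<le> a" using assms by (meson power_dvd_imp_le prime_gt_1_nat)
    have "coprime d (p ^ a)" using nd assms
      by (metis coprime_commute coprime_power_left_iff prime_imp_coprime)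
    moreover have "d dvd p ^ a * m" using n nn by (metis dvd_mult_right)
    ultimately have "d dvd m" by (simp add: coprime_dvd_mult_right_iff)
    thus "(multiplicity p n, n div p ^ multiplicity p n) \<in> {..a} \<times> {d. d dvd m}"
      using ia by (simp add: i_def d_def)
    show "(case (multiplicity p n, n div p ^ multiplicity p n) of (i, d) \<Rightarrow> p ^ i * d) = n"
      using nn by (simp add: i_def d_def)
  qed auto
  finally show ?thesis ..
qed

lemma sum_power_real_char:
  fixes c :: real
  assumes "c \<in> {-1, 0, 1}"
  shows "(\<Sum>i\<le>a. c ^ i) \<ge> 0" and "even a \<Longrightarrow> (\<Sum>i\<le>a. c ^ i) \<ge> 1"
proof -
  have 1: "(\<Sum>i\<le>a. (-1::real) ^ i) = (if even a then 1 else 0)" by (induction a) auto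
  have 2: "(\<Sum>i\<le>a. (0::real) ^ i) = 1" by (induction a) auto
  show "(\<Sum>i\<le>a. c ^ i) \<ge> 0" using assms 1 2 by auto
  show "even a \<Longrightarrow> (\<Sum>i\<le>a. c ^ i) \<ge> 1" using assms 1 2 by auto
qed

context
  fixes c :: "nat \<Rightarrow> real"
  assumes cmult: "\<And>m n. c (m * n) = c m * c n" and cval: "\<And>n. c n \<in> {-1, 0, 1}" and c1: "c 1 = 1"
begin

lemma real_char_power: "c (p ^ i) = c p ^ i"
  using c1 by (induction i) (auto simp: cmult)

lemma real_char_divisor_sum_split:
  assumes "prime p" "\<not> p dvd m" "m > 0"
  shows "(\<Sum>d | d dvd p ^ a * m. c d) = (\<Sum>i\<le>a. c p ^ i) * (\<Sum>d | d dvd m. c d)"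
  unfolding sum_dvd_prime_power_mult[OF assms] cmult real_char_power sum_product ..

text \<open>The divisor sum is multiplicative with factor \<open>1 + c p + ... + c p ^ a\<close> at
  \<open>p ^ a\<close>; for values -1, 0, 1 this is nonnegative, and at least 1 when
  \<open>a\<close> is even. The induction removes one prime at a time.\<close>

lemma real_char_divisor_sum:
  assumes "n > 0"
  shows "(\<Sum>d | d dvd n. c d) \<ge> 0" and "(\<Sum>d | d dvd n\<^sup>2. c d) \<ge> 1"
proof -
  have "(\<Sum>d | d dvd n. c d) \<ge> 0 \<and> (\<Sum>d | d dvd n\<^sup>2. c d) \<ge> 1"
    using assms
  proof (induction n rule: less_induct)
    case (less n)
    show ?case
    proof (cases "n = 1")
      case False
      obtain p where p: "prime p" "p dvd n" using False prime_factor_nat by auto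
      define a where "a = multiplicity p n"
      obtain m where m: "n = p ^ a * m" "\<not> p dvd m"
        unfolding a_def by (rule multiplicity_decompose'[of n p]) (use p less in auto)
      have a: "a > 0" using p less unfolding a_def by (simp add: prime_multiplicity_gt_zero_iff)
      have m0: "m > 0" using m less by (auto intro!: Nat.gr0I)
      have "p ^ a > 1" using p a one_less_power[of p a] prime_gt_1_nat[of p] by simp
      hence "m < n" using m m0 by simp
      hence IH: "(\<Sum>d | d dvd m. c d) \<ge> 0" "(\<Sum>d | d dvd m\<^sup>2. c d) \<ge> 1" using less.IH m0 by auto
      have n2: "n\<^sup>2 = p ^ (2 * a) * m\<^sup>2" by (simp add: m(1) power_mult_distrib power_mult power2_eq_square power_add mult_2)
      have nd2: "\<not> p dvd m\<^sup>2" using m p prime_dvd_power by blast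
      have "(\<Sum>i\<le>2 * a. c p ^ i) * (\<Sum>d | d dvd m\<^sup>2. c d) \<ge> 1 * 1"
        using IH sum_power_real_char(2)[OF cval[of p], of "2 * a"] by (intro mult_mono) auto
      moreover have "(\<Sum>i\<le>a. c p ^ i) * (\<Sum>d | d dvd m. c d) \<ge> 0"
        using IH sum_power_real_char(1)[OF cval] by (intro mult_nonneg_nonneg) auto
      ultimately show ?thesis
        using p m m0 nd2 unfolding n2 unfolding m(1)
        by (simp add: real_char_divisor_sum_split)
    qed (use c1 in auto)
  qed
  thus "(\<Sum>d | d dvd n. c d) \<ge> 0" and "(\<Sum>d | d dvd n\<^sup>2. c d) \<ge> 1" by auto
qed

end

lemma sqrt_Suc_diff_bounds:
  "1 / sqrt (real (Suc z)) \<le> 2 * (sqrt (real (Suc z)) - sqrt (real z))"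
  "z \<ge> 1 \<Longrightarrow> 2 * (sqrt (real (Suc z)) - sqrt (real z)) \<le> 1 / sqrt (real z)"
proof -
  define s t where "s = sqrt (real z)" and "t = sqrt (real (Suc z))"
  have st: "s \<ge> 0" "s < t" "t * t - s * s = 1" by (auto simp: s_def t_def)
  have ts: "(t - s) * (t + s) = 1" using st(3) by (simp add: algebra_simps)
  have "1 = (t - s) * (t + s)" using ts by simp
  also have "\<dots> \<le> (t - s) * (2 * t)" using st by (intro mult_left_mono) auto
  finally show "1 / sqrt (real (Suc z)) \<le> 2 * (sqrt (real (Suc z)) - sqrt (real z))"
    using st unfolding s_def[symmetric] t_def[symmetric] by (simp add: field_simps)
  assume "z \<ge> 1"
  hence "s > 0" by (simp add: s_def)
  have "(t - s) * (2 * s) \<le> (t - s) * (t + s)" using st by (intro mult_left_mono) auto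
  also have "\<dots> = 1" by (rule ts)
  finally show "2 * (sqrt (real (Suc z)) - sqrt (real z)) \<le> 1 / sqrt (real z)"
    using \<open>s > 0\<close> unfolding s_def[symmetric] t_def[symmetric] by (simp add: field_simps)
qed

lemma sum_inverse_sqrt_le: "(\<Sum>m=1..y. 1 / sqrt (real m)) \<le> 2 * sqrt (real y)"
proof (induction y)
  case (Suc y)
  thus ?case using sqrt_Suc_diff_bounds(1)[of y] by simp
qed auto

text \<open>The sequence \<open>a\<close> decreases, \<open>b\<close> increases, and they differ by
  \<open>1 / sqrt z\<close>, so they enclose a common constant. A real \<open>Z\<close> with integer
  part \<open>z\<close> is allowed so that the hyperbola method can use \<open>y^2 / d\<close>
  unrounded and its main terms factor exactly.\<close>

lemma sum_inverse_sqrt_asymp: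
  obtains C where "\<And>z Z. z \<ge> 1 \<Longrightarrow> real z \<le> Z \<Longrightarrow> Z < real z + 1 \<Longrightarrow>
    \<bar>(\<Sum>m=1..z. 1 / sqrt (real m)) - 2 * sqrt Z - C\<bar> \<le> 3 / sqrt Z"
proof -
  define a where "a z = (\<Sum>m=1..z. 1 / sqrt (real m)) - 2 * sqrt (real z)" for z
  define b where "b z = a z - 1 / sqrt (real z)" for z
  have step: "a (Suc z) \<le> a z" "b z \<le> b (Suc z)" if "z \<ge> 1" for z
    using sqrt_Suc_diff_bounds[of z] that by (auto simp: a_def b_def)
  have amono: "a y \<le> a x" if "1 \<le> x" "x \<le> y" for x y
    using that(2,1) by (induction y rule: dec_induct) (auto intro: order.trans[OF step(1)])
  have bmono: "b x \<le> b y" if "1 \<le> x" "x \<le> y" for x y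
    using that(2,1) by (induction y rule: dec_induct) (auto intro: order.trans[OF _ step(2)])
  have ba: "b x \<le> a y" if "1 \<le> x" "1 \<le> y" for x y
  proof -
    have "b x \<le> b (max x y)" using that by (intro bmono) auto
    also have "\<dots> \<le> a (max x y)" by (simp add: b_def)
    also have "\<dots> \<le> a y" using that by (intro amono) auto
    finally show ?thesis .
  qed
  define C where "C = (INF y\<in>{1..}. a y)"
  have bdd: "bdd_below (a ` {1..})" using ba[of 1] by (intro bdd_belowI[of _ "b 1"]) auto
  have C: "C \<le> a z" "b z \<le> C" if "z \<ge> 1" for z
    unfolding C_def using that ba[OF that] bdd by (auto intro!: cINF_lower cINF_greatest)
  show ?thesis
  proof (rule that[of C])
    fix z :: nat and Z :: real assume z: "z \<ge> 1" "real z \<le> Z" "Z < real z + 1"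
    define s t where "s = sqrt (real z)" and "t = sqrt Z"
    have st: "s > 0" "s \<le> t" "t * t - s * s \<le> 1" using z by (auto simp: s_def t_def)
    have s1: "s \<ge> 1" using z by (simp add: s_def)
    have "(t - s) * t \<le> (t - s) * (t + s)" using st by (intro mult_left_mono) auto
    also have "\<dots> \<le> 1" using st by (simp add: algebra_simps)
    finally have 1: "t - s \<le> 1 / t" using st by (simp add: field_simps)
    have "t * t \<le> (2 * s) * (2 * s)" using st s1 mult_mono[of 1 s 1 s] by simp
    hence "t \<le> 2 * s" using st by (metis abs_le_square_iff abs_of_nonneg less_imp_le power2_eq_square order.trans mult_nonneg_nonneg zero_le_numeral)
    hence 2: "1 / s \<le> 2 / t" using st by (simp add: field_simps)
    have "0 \<le> a z - C" "a z - C \<le> 1 / s" using C[OF z(1)] by (auto simp: b_def s_def)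
    thus "\<bar>(\<Sum>m=1..z. 1 / sqrt (real m)) - 2 * sqrt Z - C\<bar> \<le> 3 / sqrt Z"
    proof -
      have "1 / s \<le> 2 * (1 / t)" "3 / t = 3 * (1 / t)" "1 / t > 0" using 2 st by auto
      thus ?thesis using \<open>0 \<le> a z - C\<close> \<open>a z - C \<le> 1 / s\<close> 1 st(2)
        unfolding a_def s_def[symmetric] t_def[symmetric] abs_le_iff by (intro conjI; linarith)
    qed
  qed
qed

text \<open>
  If \<open>L = 0\<close>, Dirichlet's hyperbola method bounds the partial sums of \<open>(1 * c)(n) / \<surd>n\<close>, although the
  squares alone contribute a harmonic series.
\<close>

lemma (in nonprincipal_char) L_nonzero_if_real:
  fixes c :: "nat \<Rightarrow> real"
  assumes c: "\<And>n. chi n = of_real (c n)" and cval: "\<And>n. c n \<in> {-1, 0, 1}"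
  shows "L \<noteq> 0"
proof
  assume L: "L = 0"
  have cmult: "c (m * n) = c m * c n" for m n
    using mult[of m n] by (simp add: c flip: of_real_mult)
  have c1: "c 1 = 1" using one by (simp add: c)
  have weighted: "\<bar>\<Sum>n=a..<b. w n * c n\<bar> \<le> 2 * real q * w a"
    if "\<And>n. n \<ge> a \<Longrightarrow> w (Suc n) \<le> w n" "\<And>n. n \<ge> a \<Longrightarrow> 0 \<le> w n" for a b and w :: "nat \<Rightarrow> real"
  proof -
    have "(\<Sum>n=a..<b. of_real (w n) * chi n) = of_real (\<Sum>n=a..<b. w n * c n)"
      by (simp add: c)
    thus ?thesis using weighted_bound[of a w b] that by (simp only: norm_of_real)
  qed
  obtain C where H: "\<And>z Z. z \<ge> 1 \<Longrightarrow> real z \<le> Z \<Longrightarrow> Z < real z + 1 \<Longrightarrow>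
    \<bar>(\<Sum>m=1..z. 1 / sqrt (real m)) - 2 * sqrt Z - C\<bar> \<le> 3 / sqrt Z"
    using sum_inverse_sqrt_asymp by blast
  define f where "f n = (\<Sum>d | d dvd n. c d)" for n
  have bound: "(\<Sum>m=1..y. 1 / real m) \<le> 8 * real q + 2 * real q * \<bar>C\<bar> + 3" if y: "y \<ge> 1" for y
  proof -
    \<comment> \<open>The squares \<open>n = m^2\<close> alone carry a harmonic sum, since their
      divisor sums are at least 1; all other terms are nonnegative.\<close>
    have "(\<Sum>m=1..y. 1 / real m) \<le> (\<Sum>m=1..y. f (m\<^sup>2) / sqrt (real (m\<^sup>2)))"
      using real_char_divisor_sum(2)[OF cmult cval c1]
      by (intro sum_mono) (auto simp: f_def intro!: divide_right_mono)
    also have "\<dots> = (\<Sum>n\<in>(\<lambda>m. m\<^sup>2) ` {1..y}. f n / sqrt (real n))"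
      by (subst sum.reindex) (auto simp: inj_on_def)
    also have "\<dots> \<le> (\<Sum>n=1..y\<^sup>2. f n / sqrt (real n))"
    proof (intro sum_mono2)
      fix n assume "n \<in> {1..y\<^sup>2} - (\<lambda>m. m\<^sup>2) ` {1..y}"
      thus "0 \<le> f n / sqrt (real n)"
        using real_char_divisor_sum(1)[OF cmult cval c1, of n] by (simp add: f_def)
    qed (auto simp: power_mono)
    also have "\<dots> = (\<Sum>n=1..y\<^sup>2. \<Sum>d | d dvd n. c d / sqrt (real d) * (1 / sqrt (real (n div d))))"
    proof (rule sum.cong[OF refl])
      fix n assume n: "n \<in> {1..y\<^sup>2}"
      show "f n / sqrt (real n) = (\<Sum>d | d dvd n. c d / sqrt (real d) * (1 / sqrt (real (n div d))))"
        unfolding f_def sum_divide_distrib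
        by (intro sum.cong refl) (use n in \<open>auto simp: real_sqrt_mult elim!: dvdE\<close>)
    qed
    also have "\<dots> = (\<Sum>d=1..y\<^sup>2. \<Sum>m=1..y\<^sup>2 div d. c d / sqrt (real d) * (1 / sqrt (real m)))"
      by (rule sum_divisors_swap)
    \<comment> \<open>Cut at the square root of the range: a divisor \<open>d > y\<close> has
      cofactor at most \<open>y\<close>, and for those pairs the summation over \<open>d\<close> is
      made the inner one.\<close>
    also have "{1..y\<^sup>2} = {1..y} \<union> {Suc y..y\<^sup>2}" using y by (auto simp: power2_eq_square intro: le_trans[OF _ le_square])
    also have "(\<Sum>d\<in>\<dots>. \<Sum>m=1..y\<^sup>2 div d. c d / sqrt (real d) * (1 / sqrt (real m))) =
        (\<Sum>d=1..y. \<Sum>m=1..y\<^sup>2 div d. c d / sqrt (real d) * (1 / sqrt (real m))) +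
        (\<Sum>d=Suc y..y\<^sup>2. \<Sum>m=1..y\<^sup>2 div d. c d / sqrt (real d) * (1 / sqrt (real m)))"
      by (rule sum.union_disjoint) auto
    also have "(\<Sum>d=Suc y..y\<^sup>2. \<Sum>m=1..y\<^sup>2 div d. c d / sqrt (real d) * (1 / sqrt (real m)))
       = (\<Sum>m=1..y. \<Sum>d=Suc y..<Suc (y\<^sup>2 div m). c d / sqrt (real d) * (1 / sqrt (real m)))"
    proof -
      have le: "b \<le> y" if "Suc y \<le> d" "b * d \<le> y * y" for b d
      proof (rule ccontr)
        assume "\<not> b \<le> y"
        hence "y * y < b * d" using that(1) by (intro mult_strict_mono) auto
        thus False using that(2) by simp
      qed
      have le2: "d \<le> y * y" if "b * d \<le> y * y" "b \<ge> Suc 0" for b d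
        using that by (metis le_trans mult_le_mono1 nat_mult_1 One_nat_def)
      have div_le: "b \<le> y\<^sup>2 div d \<longleftrightarrow> b * d \<le> y * y" if "d > 0" for b d
        using less_eq_div_iff_mult_less_eq[OF that] by (simp only: power2_eq_square)
      have le': "b \<le> y" if "Suc y \<le> d" "d * b \<le> y * y" for b d
        by (rule le[of d]) (use that in \<open>simp_all add: mult.commute\<close>)
      have le2': "d \<le> y * y" if "d * b \<le> y * y" "b \<ge> Suc 0" for b d
        by (rule le2[of b]) (use that in \<open>simp_all add: mult.commute\<close>)
      show ?thesis
        unfolding sum.Sigma[OF finite_atLeastAtMost ballI[OF finite_atLeastAtMost]]
                  sum.Sigma[OF finite_atLeastAtMost ballI[OF finite_atLeastLessThan]]
      proof (rule sum.reindex_bij_witness[where i = "\<lambda>(m,d). (d,m)" and j = "\<lambda>(d,m). (m,d)"])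
        fix a assume "a \<in> (SIGMA d:{Suc y..y\<^sup>2}. {1..y\<^sup>2 div d})"
        then obtain d m where a: "a = (d, m)" and d: "Suc y \<le> d" and m: "1 \<le> m" "m \<le> y\<^sup>2 div d" by auto
        have d0: "0 < d" using d by linarith
        have "m * d \<le> y * y" using iffD1[OF div_le[OF d0] m(2)] .
        hence dm: "d * m \<le> y * y" by (simp only: mult.commute)
        have "m \<le> y" using d dm by (rule le')
        moreover have "d \<le> y\<^sup>2 div m" using dm div_le[of m d] m(1) by linarith
        ultimately show "(case a of (d, m) \<Rightarrow> (m, d)) \<in> (SIGMA m:{1..y}. {Suc y..<Suc (y\<^sup>2 div m)})"
          using d m(1) by (simp add: a less_Suc_eq_le)
      next
        fix a assume "a \<in> (SIGMA m:{1..y}. {Suc y..<Suc (y\<^sup>2 div m)})"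
        then obtain d m where a: "a = (m, d)" and d: "Suc y \<le> d" and m: "1 \<le> m" "m \<le> y" "d \<le> y\<^sup>2 div m" by auto
        have dm: "d * m \<le> y * y" using m(1,3) div_le[of m d] by linarith
        have d0: "0 < d" using d by linarith
        have md: "m * d \<le> y * y" using dm by (simp only: mult.commute)
        have "d \<le> y\<^sup>2" unfolding power2_eq_square by (rule le2'[OF dm]) (use m in simp)
        moreover have "m \<le> y\<^sup>2 div d" using iffD2[OF div_le[OF d0] md] .
        ultimately show "(case a of (m, d) \<Rightarrow> (d, m)) \<in> (SIGMA d:{Suc y..y\<^sup>2}. {1..y\<^sup>2 div d})"
          using d m(1) by (simp add: a)
      qed auto
    qed
    \<comment> \<open>The inner sums run over intervals beyond \<open>y\<close>, hence are at most
      \<open>2 * q / sqrt y\<close>; the outer weights sum to at most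
      \<open>2 * sqrt y\<close>.\<close>
    also have "\<dots> \<le> 4 * real q"
    proof -
      have "(\<Sum>m=1..y. \<Sum>d=Suc y..<Suc (y\<^sup>2 div m). c d / sqrt (real d) * (1 / sqrt (real m)))
         \<le> (\<Sum>m=1..y. 2 * real q / sqrt (real y) * (1 / sqrt (real m)))"
      proof (intro sum_mono)
        fix m
        have "(\<Sum>d=Suc y..<Suc (y\<^sup>2 div m). 1 / sqrt (real d) * c d) \<le> 2 * real q * (1 / sqrt (real (Suc y)))"
          by (rule order.trans[OF abs_ge_self weighted]) (auto simp: field_simps)
        also have "\<dots> \<le> 2 * real q * (1 / sqrt (real y))"
          using y by (intro mult_left_mono divide_left_mono) auto
        finally have "(\<Sum>d=Suc y..<Suc (y\<^sup>2 div m). c d / sqrt (real d)) \<le> 2 * real q / sqrt (real y)"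
          by simp
        thus "(\<Sum>d=Suc y..<Suc (y\<^sup>2 div m). c d / sqrt (real d) * (1 / sqrt (real m)))
          \<le> 2 * real q / sqrt (real y) * (1 / sqrt (real m))"
          unfolding sum_distrib_right[symmetric] by (rule mult_right_mono) auto
      qed
      also have "\<dots> = 2 * real q / sqrt (real y) * (\<Sum>m=1..y. 1 / sqrt (real m))"
        by (simp only: sum_distrib_left)
      also have "\<dots> \<le> 2 * real q / sqrt (real y) * (2 * sqrt (real y))"
        by (intro mult_left_mono sum_inverse_sqrt_le) auto
      finally show ?thesis using y by simp
    qed
    also have "(\<Sum>d=1..y. \<Sum>m=1..y\<^sup>2 div d. c d / sqrt (real d) * (1 / sqrt (real m))) \<le> 4 * real q + 2 * real q * \<bar>C\<bar> + 3"
    proof -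
      \<comment> \<open>Error of the asymptotic formula at \<open>Z = y^2 / d\<close>. After the
        factor \<open>c d / sqrt d\<close> it is at most \<open>3 / y\<close>, so the
        \<open>y\<close> errors together stay below 3.\<close>
      define E where "E d = (\<Sum>m=1..y\<^sup>2 div d. 1 / sqrt (real m)) - 2 * (real y / sqrt (real d)) - C" for d
      have E: "\<bar>E d\<bar> \<le> 3 * sqrt (real d) / real y" if d: "d \<in> {1..y}" for d
      proof -
        have "real (y\<^sup>2 div d) \<le> real (y\<^sup>2) / real d" by (rule of_nat_div_le_of_nat)
        moreover have "y\<^sup>2 < d * Suc (y\<^sup>2 div d)" using dividend_less_times_div[of d "y\<^sup>2"] d by simp
        hence "real (y\<^sup>2) < real d * real (Suc (y\<^sup>2 div d))" unfolding of_nat_mult[symmetric] of_nat_less_iff .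
        hence "real (y\<^sup>2) / real d < real (y\<^sup>2 div d) + 1" using d by (simp add: field_simps)
        moreover have "d \<le> y * y" using d y by (auto intro: le_trans[OF _ le_square])
        hence "y\<^sup>2 div d \<ge> 1" using d by (simp add: less_eq_div_iff_mult_less_eq power2_eq_square)
        ultimately have "\<bar>(\<Sum>m=1..y\<^sup>2 div d. 1 / sqrt (real m)) - 2 * sqrt (real (y\<^sup>2) / real d) - C\<bar> \<le> 3 / sqrt (real (y\<^sup>2) / real d)"
          by (intro H)
        thus ?thesis by (simp add: E_def real_sqrt_divide)
      qed
      have "(\<Sum>d=1..y. \<Sum>m=1..y\<^sup>2 div d. c d / sqrt (real d) * (1 / sqrt (real m))) =
            (\<Sum>d=1..y. c d / sqrt (real d) * (2 * (real y / sqrt (real d)) + C + E d))"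
        unfolding E_def sum_distrib_left[symmetric] by simp
      also have "\<dots> = 2 * real y * (\<Sum>d=1..y. c d / real d) + C * (\<Sum>d=1..y. c d / sqrt (real d)) +
                      (\<Sum>d=1..y. c d / sqrt (real d) * E d)"
        unfolding sum_distrib_left sum.distrib[symmetric]
      proof (intro sum.cong refl)
        fix d assume "d \<in> {1..y}"
        have "c d / sqrt (real d) * (real y / sqrt (real d)) = real y * (c d / real d)" by simp
        thus "c d / sqrt (real d) * (2 * (real y / sqrt (real d)) + C + E d) =
          2 * real y * (c d / real d) + C * (c d / sqrt (real d)) + c d / sqrt (real d) * E d"
          by (simp add: algebra_simps)
      qed
      also have "\<dots> \<le> 4 * real q + \<bar>C\<bar> * (2 * real q) + 3"
      proof (intro add_mono)
        \<comment> \<open>The only use of \<open>L = 0\<close>: the main term is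
          \<open>2 * y\<close> times a partial sum of the series for \<open>L\<close>, which would
          otherwise grow linearly.\<close>
        have "norm (T y) \<le> 2 * real q / real (Suc y)" using L_minus_T[of y] L by simp
        moreover have "T y = of_real (\<Sum>d=1..y. c d / real d)" by (simp add: T_def c)
        ultimately have "\<bar>\<Sum>d=1..y. c d / real d\<bar> \<le> 2 * real q / real (Suc y)"
          by (metis norm_of_real)
        hence "2 * real y * (\<Sum>d=1..y. c d / real d) \<le> 2 * real y * (2 * real q / real (Suc y))"
          by (intro mult_left_mono) auto
        also have "\<dots> \<le> 4 * real q" by (simp add: field_simps)
        finally show "2 * real y * (\<Sum>d=1..y. c d / real d) \<le> 4 * real q" .
        have "\<bar>\<Sum>d=1..<Suc y. 1 / sqrt (real d) * c d\<bar> \<le> 2 * real q * (1 / sqrt (real 1))"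
          by (rule weighted) (auto simp: field_simps)
        hence "\<bar>\<Sum>d=1..y. c d / sqrt (real d)\<bar> \<le> 2 * real q"
          unfolding atLeastLessThanSuc_atLeastAtMost by simp
        hence "\<bar>C\<bar> * \<bar>\<Sum>d=1..y. c d / sqrt (real d)\<bar> \<le> \<bar>C\<bar> * (2 * real q)"
          by (rule mult_left_mono) auto
        thus "C * (\<Sum>d=1..y. c d / sqrt (real d)) \<le> \<bar>C\<bar> * (2 * real q)"
          using abs_ge_self[of "C * (\<Sum>d=1..y. c d / sqrt (real d))"] unfolding abs_mult by linarith
        have "(\<Sum>d=1..y. c d / sqrt (real d) * E d) \<le> (\<Sum>d=1..y. 3 / real y)"
        proof (intro sum_mono)
          fix d assume d: "d \<in> {1..y}"
          have "c d / sqrt (real d) * E d \<le> \<bar>c d\<bar> / sqrt (real d) * \<bar>E d\<bar>"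
            by (rule order.trans[OF abs_ge_self]) (simp add: abs_mult)
          also have "\<dots> \<le> 1 / sqrt (real d) * (3 * sqrt (real d) / real y)"
            using cval[of d] d by (intro mult_mono divide_right_mono E) auto
          also have "\<dots> = 3 / real y" using d by simp
          finally show "c d / sqrt (real d) * E d \<le> 3 / real y" .
        qed
        thus "(\<Sum>d=1..y. c d / sqrt (real d) * E d) \<le> 3" using y by simp
      qed
      finally show ?thesis by (simp add: mult_ac)
    qed
    finally show ?thesis by simp
  qed
  show False
  proof -
    define K where "K = 8 * real q + 2 * real q * \<bar>C\<bar> + 3"
    obtain y :: nat where y: "real y > exp K" using reals_Archimedean2 by blast
    have y1: "y \<ge> 1" using y by (cases "y = 0") auto
    have "ln (exp K) < ln (real y)" using y y1 by (subst ln_less_cancel_iff) auto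
    hence "K < ln (real y)" by simp
    also have "\<dots> \<le> ln (real (Suc y))" using y1 by simp
    also have "\<dots> \<le> (\<Sum>m=1..y. 1 / real m)" 
    proof (induction y)
      case (Suc n)
      have "ln (real (Suc (Suc n))) \<le> ln (real (Suc n)) + 1 / real (Suc n)"
        by (rule ln_Suc_le) auto
      thus ?case using Suc by simp
    qed auto
    also have "\<dots> \<le> K" unfolding K_def by (rule bound[OF y1])
    finally show False by simp
  qed
qed

section \<open>Primes congruent to 1 modulo a prime\<close>

locale prime_modulus =
  fixes q g :: nat
  assumes prime_q: "prime q" and primroot: "residue_primroot q g"
begin

definition N :: nat where "N = q - 1"

lemma N_pos: "N > 0" and q_gt_1: "q > 1"
  using prime_gt_1_nat[OF prime_q] by (auto simp: N_def)

lemma ord_g: "ord q g = N" and coprime_g: "coprime q g"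
  using primroot prime_q by (auto simp: residue_primroot_def totient_prime N_def)

lemma g_power_cong_iff: "[g ^ a = g ^ b] (mod q) \<longleftrightarrow> [a = b] (mod N)"
  using order_divides_expdiff[OF coprime_g] by (simp add: ord_g)

lemma bij_g: "bij_betw (\<lambda>i. g ^ i mod q) {..<N} {0<..<q}"
  using residue_primroot_is_generator[OF q_gt_1 primroot] prime_q
  by (simp add: totatives_prime totient_prime N_def)

text \<open>Discrete logarithm to the base \<open>g\<close>. On multiples of \<open>q\<close> the
  value is arbitrary; \<open>char\<close> never reads it there.\<close>

definition ind :: "nat \<Rightarrow> nat" where
  "ind n = inv_into {..<N} (\<lambda>i. g ^ i mod q) (n mod q)"

lemma ind:
  assumes "\<not> q dvd n"
  shows "ind n < N" "[g ^ ind n = n] (mod q)"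
proof -
  have "n mod q \<in> {0<..<q}" using assms q_gt_1 by (auto simp: mod_greater_zero_iff_not_dvd)
  hence *: "n mod q \<in> (\<lambda>i. g ^ i mod q) ` {..<N}" using bij_g by (simp add: bij_betw_def)
  show "ind n < N" using inv_into_into[OF *] by (simp add: ind_def)
  show "[g ^ ind n = n] (mod q)" using f_inv_into_f[OF *] by (simp add: ind_def Cong.cong_def)
qed

definition e :: "nat \<Rightarrow> complex" where
  "e a = exp (2 * of_real pi * \<i> * of_nat a / of_nat N)"

lemma e_eq_iff: "e a = e b \<longleftrightarrow> [a = b] (mod N)"
  unfolding e_def Cong.cong_def using N_pos by (intro complex_root_unity_eq) auto

lemma e_eq_1_iff: "e a = 1 \<longleftrightarrow> N dvd a"
  unfolding e_def using N_pos by (intro complex_root_unity_eq_1) auto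

lemma e_add: "e (a + b) = e a * e b"
  unfolding e_def exp_add[symmetric] by (simp add: add_divide_distrib ring_distribs)

lemma e_mult: "e (a * b) = e a ^ b"
  using e_eq_1_iff[of 0] by (induction b) (auto simp: e_add)

lemma norm_e: "norm (e a) = 1"
  by (simp add: e_def)

lemma sum_e: "(\<Sum>j<N. e (a * j)) = (if N dvd a then of_nat N else 0)"
proof (cases "N dvd a")
  case True
  hence "e a = 1" by (simp add: e_eq_1_iff)
  thus ?thesis using True by (simp add: e_mult)
next
  case False
  hence "e a \<noteq> 1" by (simp add: e_eq_1_iff)
  hence "(\<Sum>j<N. e a ^ j) = (e a ^ N - 1) / (e a - 1)" by (rule geometric_sum)
  also have "e a ^ N = 1" by (simp flip: e_mult add: e_eq_1_iff)
  finally show ?thesis using False by (simp add: e_mult)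
qed

text \<open>The nonzero residues form a cyclic group, so \<open>j < N\<close> runs through all
  Dirichlet characters modulo \<open>q\<close>, with the principal one at
  \<open>j = 0\<close>.\<close>

definition char :: "nat \<Rightarrow> nat \<Rightarrow> complex" where
  "char j n = (if q dvd n then 0 else e (ind n * j))"

lemma ind_cong_iff:
  assumes "\<not> q dvd m" "\<not> q dvd n"
  shows "[ind m = ind n] (mod N) \<longleftrightarrow> [m = n] (mod q)"
  using ind(2)[OF assms(1)] ind(2)[OF assms(2)]
  by (metis g_power_cong_iff cong_trans cong_sym)

lemma ind_mult:
  assumes "\<not> q dvd m" "\<not> q dvd n"
  shows "[ind (m * n) = ind m + ind n] (mod N)"
proof -
  have "\<not> q dvd m * n" using assms prime_q by (simp add: prime_dvd_mult_iff)
  hence "[g ^ ind (m * n) = m * n] (mod q)" by (rule ind)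
  moreover have "[g ^ (ind m + ind n) = m * n] (mod q)"
    unfolding power_add by (intro cong_mult ind assms)
  ultimately show ?thesis using g_power_cong_iff cong_trans cong_sym by blast
qed

lemma char_mult: "char j (m * n) = char j m * char j n"
proof (cases "q dvd m \<or> q dvd n")
  case False
  hence "[ind (m * n) * j = (ind m + ind n) * j] (mod N)"
    by (intro cong_mult ind_mult) auto
  hence "e (ind (m * n) * j) = e (ind m * j + ind n * j)"
    unfolding e_eq_iff by (simp add: add_mult_distrib)
  thus ?thesis using False prime_q by (simp add: char_def prime_dvd_mult_iff e_add)
qed (auto simp: char_def)

lemma char_cong:
  assumes "[m = n] (mod q)"
  shows "char j m = char j n"
proof -
  have dvd: "q dvd m \<longleftrightarrow> q dvd n" using assms by (auto simp: Cong.cong_def dvd_eq_mod_eq_0)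
  show ?thesis
  proof (cases "q dvd m")
    case False
    hence "[ind m = ind n] (mod N)" using assms dvd by (simp add: ind_cong_iff)
    hence "[ind m * j = ind n * j] (mod N)" by (intro cong_mult) auto
    thus ?thesis using False dvd by (simp add: char_def e_eq_iff)
  qed (use dvd in \<open>simp add: char_def\<close>)
qed

lemma char_one: "char j 1 = 1"
proof -
  have "\<not> q dvd 1" using q_gt_1 by auto
  moreover have "[g ^ ind 1 = g ^ 0] (mod q)" using ind(2)[of 1] calculation by simp
  hence "N dvd ind 1" unfolding g_power_cong_iff by (simp add: cong_0_iff)
  hence "e (ind 1 * j) = 1" by (simp add: e_eq_1_iff)
  ultimately show ?thesis by (simp add: char_def)
qed

lemma norm_char_le: "norm (char j n) \<le> 1"
  by (simp add: char_def norm_e)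

lemma sum_char_index: "(\<Sum>j<N. char j n) = (if [n = 1] (mod q) then of_nat N else 0)"
proof (cases "q dvd n")
  case True
  hence "\<not> [n = 1] (mod q)" using q_gt_1 by (metis cong_dvd_iff nat_dvd_1_iff_1 nat_neq_iff)
  thus ?thesis using True by (simp add: char_def)
next
  case False
  have "(\<Sum>j<N. char j n) = (if N dvd ind n then of_nat N else 0)"
    using False sum_e[of "ind n"] by (simp add: char_def)
  moreover have "N dvd ind n \<longleftrightarrow> [g ^ ind n = g ^ 0] (mod q)"
    unfolding g_power_cong_iff by (simp add: cong_0_iff)
  moreover have "[g ^ ind n = g ^ 0] (mod q) \<longleftrightarrow> [n = 1] (mod q)"
    using ind(2)[OF False] by (metis power_0 cong_trans cong_sym)
  ultimately show ?thesis by simp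
qed

lemma sum_char_period:
  assumes "\<not> N dvd j"
  shows "(\<Sum>n<q. char j n) = 0"
proof -
  have "(\<Sum>n<q. char j n) = (\<Sum>n\<in>{0<..<q}. char j n)"
    using q_gt_1 by (intro sum.mono_neutral_right) (auto simp: char_def)
  also have "\<dots> = (\<Sum>i<N. char j (g ^ i mod q))"
    by (rule sum.reindex_bij_betw[OF bij_g, symmetric])
  also have "\<dots> = (\<Sum>i<N. e (j * i))"
  proof (intro sum.cong refl)
    fix i assume i: "i \<in> {..<N}"
    have "g ^ i mod q \<in> {0<..<q}" using bij_g i by (auto simp: bij_betw_def)
    hence nd: "\<not> q dvd g ^ i mod q" by (auto dest: dvd_imp_le)
    have "[g ^ ind (g ^ i mod q) = g ^ i] (mod q)" using ind(2)[OF nd] by (simp add: Cong.cong_def)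
    hence "[ind (g ^ i mod q) = i] (mod N)" by (simp add: g_power_cong_iff)
    hence "e (ind (g ^ i mod q) * j) = e (i * j)" unfolding e_eq_iff by (intro cong_mult) auto
    thus "char j (g ^ i mod q) = e (j * i)" using nd by (simp add: char_def mult.commute)
  qed
  also have "\<dots> = 0" using sum_e[of j] assms by simp
  finally show ?thesis .
qed

lemma nonprincipal:
  assumes "\<not> N dvd j"
  shows "nonprincipal_char q (char j)"
  using q_gt_1 assms
  by unfold_locales
     (auto simp: char_mult char_one[unfolded One_nat_def] norm_char_le sum_char_period intro!: char_cong, auto simp: Cong.cong_def)

abbreviation "Lf j \<equiv> nonprincipal_char.L (char j)"
abbreviation "Sf j \<equiv> nonprincipal_char.S (char j)"

lemma char_conj:
  assumes "j \<le> N"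
  shows "char (N - j) n = cnj (char j n)"
proof (cases "q dvd n")
  case False
  have "e (ind n * (N - j)) * e (ind n * j) = e (ind n * N)"
    using assms by (simp flip: e_add add_mult_distrib2)
  also have "\<dots> = 1" by (simp add: e_eq_1_iff)
  finally have 1: "e (ind n * (N - j)) * e (ind n * j) = 1" .
  have "cnj (e (ind n * j)) * e (ind n * j) = 1"
    using norm_e[of "ind n * j"] by (metis complex_norm_square mult.commute of_real_1 power_one)
  hence "e (ind n * (N - j)) = cnj (e (ind n * j))"
    using 1 by (metis mult_right_cancel norm_e norm_zero zero_neq_one)
  thus ?thesis using False by (simp add: char_def)
qed (simp add: char_def)

lemma L_conj:
  assumes "0 < j" "j < N"
  shows "Lf (N - j) = cnj (Lf j)"
proof -
  have nd: "\<not> N dvd j" "\<not> N dvd (N - j)" using assms by (auto dest: dvd_imp_le)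
  interpret A: nonprincipal_char q "char j" by (rule nonprincipal[OF nd(1)])
  interpret B: nonprincipal_char q "char (N - j)" by (rule nonprincipal[OF nd(2)])
  have "B.T x = cnj (A.T x)" for x
    using assms by (simp add: A.T_def B.T_def char_conj)
  hence "B.T = (\<lambda>x. cnj (A.T x))" by auto
  moreover have "(\<lambda>x. cnj (A.T x)) \<longlonglongrightarrow> cnj A.L" by (intro tendsto_cnj A.T_tendsto)
  ultimately show ?thesis using B.T_tendsto LIMSEQ_unique by metis
qed

text \<open>For \<open>2 * j = N\<close> the square of the character is principal, so its values are
  -1, 0, 1 and the hyperbola argument applies.\<close>

lemma L_real_nonzero:
  assumes "0 < j" "2 * j = N"
  shows "Lf j \<noteq> 0"
proof -
  have nd: "\<not> N dvd j" using assms by (auto dest: dvd_imp_le)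
  interpret A: nonprincipal_char q "char j" by (rule nonprincipal[OF nd])
  have val: "char j n \<in> {-1, 0, 1}" for n
  proof (cases "q dvd n")
    case False
    have "e (ind n * j) ^ 2 = e (ind n * N)" by (simp flip: e_mult assms(2) add: mult_ac)
    also have "\<dots> = 1" by (simp add: e_eq_1_iff)
    finally show ?thesis using False by (auto simp: char_def power2_eq_1_iff)
  qed (simp add: char_def)
  show ?thesis
  proof (rule A.L_nonzero_if_real[of "\<lambda>n. Re (char j n)"])
    show "char j n = complex_of_real (Re (char j n))" for n using val[of n] by auto
    show "Re (char j n) \<in> {-1, 0, 1}" for n using val[of n] by auto
  qed
qed

section \<open>Mertens' estimate in the progression 1 modulo \<open>q\<close>\<close>

definition A :: "nat \<Rightarrow> real" where
  "A x = (\<Sum>n | n \<in> {1..x} \<and> [n = 1] (mod q). mangoldt n / real n)"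

definition S0 :: "nat \<Rightarrow> real" where
  "S0 x = (\<Sum>n | n \<in> {1..x} \<and> \<not> q dvd n. mangoldt n / real n)"

lemma A_nonneg: "A x \<ge> 0"
  unfolding A_def by (intro sum_nonneg divide_nonneg_nonneg mangoldt_nonneg) auto

text \<open>The omitted terms that carry weight are the powers of \<open>q\<close>; as
  \<open>q \<ge> 2\<close>, a geometric series bounds them by \<open>ln q\<close>.\<close>

lemma S0_bounds:
  assumes "x \<ge> 1"
  shows "ln (real x) - 1 - ln (real q) \<le> S0 x" "S0 x \<le> ln (real x) + 4"
proof -
  have split: "(\<Sum>n=1..x. mangoldt n / real n) = S0 x + (\<Sum>n | n \<in> {1..x} \<and> q dvd n. mangoldt n / real n)"
    unfolding S0_def by (subst sum.union_disjoint[symmetric]) (auto intro!: sum.cong)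
  have nn: "0 \<le> (\<Sum>n | n \<in> {1..x} \<and> q dvd n. mangoldt n / real n)"
    by (intro sum_nonneg divide_nonneg_nonneg mangoldt_nonneg) auto
  show "S0 x \<le> ln (real x) + 4" using split nn mertens_upper[OF assms] by linarith
  define B where "B = {n \<in> {1..x}. q dvd n \<and> primepow n}"
  have B: "B \<subseteq> (\<lambda>i. q ^ i) ` {1..x}"
  proof
    fix n assume n: "n \<in> B"
    then obtain p i where pi: "prime p" "i > 0" "n = p ^ i" by (auto simp: B_def primepow_def)
    hence "q dvd p" using n prime_q prime_dvd_power by (auto simp: B_def)
    hence "q = p" using pi(1) prime_q by (simp add: primes_dvd_imp_eq)
    moreover have "i < q ^ i" using q_gt_1 power_gt_expt[of q i] by simp
    ultimately show "n \<in> (\<lambda>i. q ^ i) ` {1..x}" using n pi by (intro image_eqI[of _ _ i]) (auto simp: B_def)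
  qed
  have "(\<Sum>n | n \<in> {1..x} \<and> q dvd n. mangoldt n / real n) = (\<Sum>n\<in>B. mangoldt n / real n :: real)"
    by (intro sum.mono_neutral_right) (auto simp: B_def mangoldt_def)
  also have "\<dots> \<le> (\<Sum>n\<in>(\<lambda>i. q ^ i) ` {1..x}. mangoldt n / real n)"
    using B by (intro sum_mono2) (auto intro!: mangoldt_nonneg divide_nonneg_nonneg simp del: of_nat_power)
  also have "\<dots> = (\<Sum>i=1..x. mangoldt (q ^ i) / real (q ^ i))"
    using q_gt_1 by (subst sum.reindex) (auto simp: inj_on_def power_inject_exp)
  also have "\<dots> \<le> (\<Sum>i=1..x. ln (real q) * (1 / 2) ^ i)"
  proof (intro sum_mono)
    fix i assume i: "i \<in> {1..x}"
    have "(2::real) ^ i \<le> real q ^ i" using q_gt_1 by (intro power_mono) auto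
    hence "ln (real q) / real q ^ i \<le> ln (real q) / 2 ^ i" using q_gt_1 by (intro divide_left_mono) auto
    thus "mangoldt (q ^ i) / real (q ^ i) \<le> ln (real q) * (1 / 2) ^ i"
      using i prime_q by (simp add: power_divide)
  qed
  also have "\<dots> = ln (real q) * (1 - (1 / 2) ^ x)"
    unfolding sum_distrib_left[symmetric] by (induction x) (auto simp: algebra_simps)
  also have "\<dots> \<le> ln (real q) * 1" using q_gt_1 by (intro mult_left_mono) auto
  finally show "ln (real x) - 1 - ln (real q) \<le> S0 x" using split mertens_lower[OF assms] by linarith
qed

lemma char_0: "char 0 n = (if q dvd n then 0 else 1)"
  using e_eq_1_iff[of 0] by (simp add: char_def)

text \<open>Orthogonality of the characters at the class 1. The left side is real, so real parts may
  be taken on the right.\<close>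

lemma N_A_eq: "real N * A x = S0 x + (\<Sum>j\<in>{1..<N}. Re (Sf j x))"
proof -
  have S: "Sf j x = (\<Sum>n=1..x. char j n * mangoldt n / of_nat n)" if "j \<in> {1..<N}" for j
  proof -
    have nd: "\<not> N dvd j" using that by (auto dest: dvd_imp_le)
    interpret B: nonprincipal_char q "char j" by (rule nonprincipal[OF nd])
    show ?thesis by (rule B.S_def)
  qed
  have "complex_of_real (real N * A x) = (\<Sum>n=1..x. (if [n = 1] (mod q) then of_nat N else 0) * (mangoldt n / of_nat n))"
    unfolding A_def sum_distrib_left of_real_sum
    by (intro sum.mono_neutral_cong_left) auto
  also have "\<dots> = (\<Sum>n=1..x. \<Sum>j<N. char j n * mangoldt n / of_nat n)"
    unfolding sum_char_index[symmetric] sum_distrib_right by simp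
  also have "\<dots> = (\<Sum>j<N. \<Sum>n=1..x. char j n * mangoldt n / of_nat n)" by (rule sum.swap)
  also have "{..<N} = insert 0 {1..<N}" using N_pos by auto
  also have "(\<Sum>j\<in>insert 0 {1..<N}. \<Sum>n=1..x. char j n * mangoldt n / of_nat n) =
       (\<Sum>n=1..x. char 0 n * mangoldt n / of_nat n) + (\<Sum>j\<in>{1..<N}. Sf j x)"
    by (subst sum.insert) (auto simp: S)
  also have "(\<Sum>n=1..x. char 0 n * mangoldt n / of_nat n) = complex_of_real (S0 x)"
    unfolding S0_def of_real_sum by (intro sum.mono_neutral_cong_right) (auto simp: char_0)
  finally have "Re (complex_of_real (real N * A x)) = Re (complex_of_real (S0 x) + (\<Sum>j\<in>{1..<N}. Sf j x))"
    by (rule arg_cong)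
  thus ?thesis by simp
qed

text \<open>A character with \<open>Lf j = 0\<close> contributes \<open>- ln x\<close> up to a
  bounded error (\<open>S_vanishing\<close>), any other only a bounded amount
  (\<open>S_bounded\<close>).\<close>

lemma sum_S_bounds:
  defines "V \<equiv> {j \<in> {1..<N}. Lf j = 0}"
  obtains K where "\<And>x. x \<ge> 1 \<Longrightarrow> \<bar>(\<Sum>j\<in>{1..<N}. Re (Sf j x)) + real (card V) * ln (real x)\<bar> \<le> K"
proof -
  have "\<exists>K. \<forall>x\<ge>1. norm (Sf j x + of_real (if j \<in> V then ln (real x) else 0)) \<le> K" if j: "j \<in> {1..<N}" for j
  proof -
    have nd: "\<not> N dvd j" using j by (auto dest: dvd_imp_le)
    interpret B: nonprincipal_char q "char j" by (rule nonprincipal[OF nd])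
    show ?thesis
    proof (cases "j \<in> V")
      case True
      thus ?thesis using B.S_vanishing by (auto simp: V_def add.commute)
    next
      case False
      thus ?thesis using B.S_bounded j by (auto simp: V_def)
    qed
  qed
  then obtain K where K: "\<And>j x. j \<in> {1..<N} \<Longrightarrow> x \<ge> 1 \<Longrightarrow>
      norm (Sf j x + of_real (if j \<in> V then ln (real x) else 0)) \<le> K j" by metis
  show ?thesis
  proof (rule that[of "\<Sum>j\<in>{1..<N}. K j"])
    fix x :: nat assume x: "x \<ge> 1"
    have "real (card V) * ln (real x) = (\<Sum>j\<in>V. ln (real x))" by simp
    also have "\<dots> = (\<Sum>j\<in>{1..<N}. if j \<in> V then ln (real x) else 0)"
      by (intro sum.mono_neutral_cong_left) (auto simp: V_def)
    finally have "(\<Sum>j\<in>{1..<N}. Re (Sf j x)) + real (card V) * ln (real x) =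
      (\<Sum>j\<in>{1..<N}. Re (Sf j x + of_real (if j \<in> V then ln (real x) else 0)))"
      by (simp add: sum.distrib)
    moreover have "\<bar>\<dots>\<bar> \<le> (\<Sum>j\<in>{1..<N}. K j)"
      using x by (intro order.trans[OF sum_abs] sum_mono order.trans[OF abs_Re_le_cmod] K) auto
    ultimately show "\<bar>(\<Sum>j\<in>{1..<N}. Re (Sf j x)) + real (card V) * ln (real x)\<bar> \<le> (\<Sum>j\<in>{1..<N}. K j)" by simp
  qed
qed

text \<open>
  A complex character with vanishing \<open>L\<close> comes with its conjugate, and two vanishing values make
  \<open>N * A x\<close> behave like \<open>- ln x\<close>, which is absurd since \<open>A x \<ge> 0\<close>.
\<close>

lemma L_nonzero:
  assumes "j \<in> {1..<N}"
  shows "Lf j \<noteq> 0"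
proof
  assume L: "Lf j = 0"
  define V where "V = {j \<in> {1..<N}. Lf j = 0}"
  have fin: "finite V" by (simp add: V_def)
  have jV: "j \<in> V" "N - j \<in> V" using assms L L_conj[of j] by (auto simp: V_def)
  have "N - j \<noteq> j"
  proof
    assume "N - j = j"
    hence "2 * j = N" using assms by auto
    thus False using L_real_nonzero[of j] assms L by auto
  qed
  hence "card {j, N - j} = 2" by simp
  moreover have "card {j, N - j} \<le> card V" using jV fin by (intro card_mono) auto
  ultimately have card: "card V \<ge> 2" by simp
  obtain K where K: "\<And>x. x \<ge> 1 \<Longrightarrow> \<bar>(\<Sum>j\<in>{1..<N}. Re (Sf j x)) + real (card V) * ln (real x)\<bar> \<le> K"
    using sum_S_bounds unfolding V_def by blast
  obtain x :: nat where x: "real x > exp (K + 4)" using reals_Archimedean2 by blast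
  have x1: "x \<ge> 1" using x by (cases "x = 0") auto
  have "ln (exp (K + 4)) < ln (real x)" using x x1 by (subst ln_less_cancel_iff) auto
  moreover have "0 \<le> real N * A x" by (intro mult_nonneg_nonneg A_nonneg) auto
  moreover have "2 * ln (real x) \<le> real (card V) * ln (real x)" using card x1 by (intro mult_right_mono) auto
  ultimately show False using N_A_eq[of x] S0_bounds(2)[OF x1] K[OF x1] by (simp add: abs_le_iff)
qed

lemma A_asymp:
  obtains K where "\<And>x. x \<ge> 1 \<Longrightarrow> \<bar>real N * A x - ln (real x)\<bar> \<le> K"
proof -
  have V: "{j \<in> {1..<N}. Lf j = 0} = {}" using L_nonzero by auto
  obtain K where K: "\<And>x. x \<ge> 1 \<Longrightarrow> \<bar>\<Sum>j\<in>{1..<N}. Re (Sf j x)\<bar> \<le> K"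
    using sum_S_bounds unfolding V by auto
  show ?thesis
  proof (rule that[of "K + 5 + ln (real q)"])
    fix x :: nat assume x: "x \<ge> 1"
    have "ln (real q) \<ge> 0" using q_gt_1 by simp
    thus "\<bar>real N * A x - ln (real x)\<bar> \<le> K + 5 + ln (real q)"
      using N_A_eq[of x] S0_bounds[OF x] K[OF x] by (simp add: abs_le_iff)
  qed
qed

text \<open>If \<open>ln M > 2 * K + 1\<close>, the errors \<open>K\<close> at both ends cannot hide
  the growth of \<open>N * A\<close> between \<open>x div M\<close> and \<open>x\<close>, which is
  at least 1. On that stretch \<open>1 / n \<le> M / x\<close>, and the weights \<open>1 / n\<close>
  can be removed.\<close>

lemma psi_lower:
  obtains c where "c > 0"
    "\<forall>\<^sub>F x in at_top. c * real x \<le> (\<Sum>n | n \<in> {1..x} \<and> [n = 1] (mod q). mangoldt n)"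
proof -
  obtain K where K: "\<And>x. x \<ge> 1 \<Longrightarrow> \<bar>real N * A x - ln (real x)\<bar> \<le> K" using A_asymp by blast
  obtain M :: nat where M: "real M > exp (2 * K + 1)" using reals_Archimedean2 by blast
  have M1: "M \<ge> 1" using M by (cases "M = 0") auto
  have lnM: "2 * K + 1 < ln (real M)"
  proof -
    have "ln (exp (2 * K + 1)) < ln (real M)" using M M1 by (subst ln_less_cancel_iff) auto
    thus ?thesis by simp
  qed
  show ?thesis
  proof (rule that[of "1 / (real N * real M)"])
    show "1 / (real N * real M) > 0" using N_pos M1 by simp
    show "\<forall>\<^sub>F x in at_top. 1 / (real N * real M) * real x \<le> (\<Sum>n | n \<in> {1..x} \<and> [n = 1] (mod q). mangoldt n)"
      using eventually_ge_at_top[of M]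
    proof eventually_elim
      case (elim x)
      define y where "y = x div M"
      have y: "1 \<le> y" "y \<le> x" using elim M1 by (auto simp: y_def less_eq_div_iff_mult_less_eq)
      have x1: "x \<ge> 1" using y by simp
      have "y * M \<le> x" by (simp add: y_def)
      hence "real y * real M \<le> real x" by (simp flip: of_nat_mult)
      hence "ln (real y * real M) \<le> ln (real x)" using y M1 x1 by (subst ln_le_cancel_iff) auto
      hence "ln (real y) + ln (real M) \<le> ln (real x)" using y M1 by (simp add: ln_mult)
      hence "1 \<le> real N * A x - real N * A y"
        using K[OF x1] K[OF y(1)] lnM by (simp add: abs_le_iff)
      also have "\<dots> = real N * (\<Sum>n | n \<in> {y<..x} \<and> [n = 1] (mod q). mangoldt n / real n)"
      proof -
        have "A x = A y + (\<Sum>n | n \<in> {y<..x} \<and> [n = 1] (mod q). mangoldt n / real n)"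
          unfolding A_def using y by (subst sum.union_disjoint[symmetric]) (auto intro!: sum.cong)
        thus ?thesis by (simp add: algebra_simps)
      qed
      also have "\<dots> \<le> real N * (\<Sum>n | n \<in> {y<..x} \<and> [n = 1] (mod q). mangoldt n * (real M / real x))"
      proof (intro mult_left_mono sum_mono)
        fix n assume "n \<in> {n. n \<in> {y<..x} \<and> [n = 1] (mod q)}"
        hence n: "y < n" by auto
        have "x < M * Suc y" using dividend_less_times_div[of M x] M1 by (simp add: y_def)
        also have "\<dots> \<le> M * n" using n by (intro mult_le_mono) auto
        finally have "real x \<le> real M * real n" by (simp flip: of_nat_mult)
        hence "1 / real n \<le> real M / real x" using n x1 by (simp add: field_simps)
        hence "mangoldt n * (1 / real n) \<le> mangoldt n * (real M / real x)"
          by (intro mult_left_mono mangoldt_nonneg)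
        thus "mangoldt n / real n \<le> mangoldt n * (real M / real x)" by simp
      qed auto
      also have "\<dots> \<le> real N * (\<Sum>n | n \<in> {1..x} \<and> [n = 1] (mod q). mangoldt n * (real M / real x))"
        by (intro mult_left_mono sum_mono2) (auto intro!: mult_nonneg_nonneg mangoldt_nonneg divide_nonneg_nonneg)
      also have "\<dots> = (\<Sum>n | n \<in> {1..x} \<and> [n = 1] (mod q). mangoldt n) * (real N * real M / real x)"
        by (simp add: sum_distrib_right sum_distrib_left mult_ac)
      finally show ?case using x1 N_pos M1 by (simp add: field_simps)
    qed
  qed
qed

end

theorem primes_cong_1_lower_bound:
  assumes "prime (q::nat)"
  obtains c :: real where "c > 0"
    "\<forall>\<^sub>F x in at_top. c * real x \<le> (\<Sum>p | p \<le> x \<and> prime p \<and> [p = 1] (mod q). ln (real p))"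
proof -
  obtain g where g: "residue_primroot q g" using prime_primitive_root_exists[OF prime_gt_1_nat assms] assms by blast
  interpret prime_modulus q g using assms g by unfold_locales
  obtain c where c: "c > 0"
    "\<forall>\<^sub>F x in at_top. c * real x \<le> (\<Sum>n | n \<in> {1..x} \<and> [n = 1] (mod q). mangoldt n)"
    by (rule psi_lower)
  \<comment> \<open>Proper prime powers have total weight of smaller order than \<open>x\<close>;
    half of the constant \<open>c\<close> is given up to absorb them.\<close>
  have "\<forall>\<^sub>F x::nat in at_top. sqrt (real x) * log 2 (real x) * ln (real x) \<le> c / 2 * real x"
    using c(1) by real_asymp
  hence "\<forall>\<^sub>F x in at_top. c / 2 * real x \<le> (\<Sum>p | p \<le> x \<and> prime p \<and> [p = 1] (mod q). ln (real p))"
    using c(2) eventually_ge_at_top[of 1]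
  proof eventually_elim
    case (elim x)
    have "(\<Sum>n | n \<in> {1..x} \<and> [n = 1] (mod q). mangoldt n) =
          (\<Sum>n | n \<in> {1..x} \<and> [n = 1] (mod q) \<and> prime n. mangoldt n) +
          (\<Sum>n | n \<in> {1..x} \<and> [n = 1] (mod q) \<and> \<not> prime n. mangoldt n :: real)"
      by (subst sum.union_disjoint[symmetric]) (auto intro!: sum.cong)
    also have "(\<Sum>n | n \<in> {1..x} \<and> [n = 1] (mod q) \<and> \<not> prime n. mangoldt n :: real) \<le>
               (\<Sum>n | n \<in> {1..x} \<and> \<not> prime n. mangoldt n)"
      by (intro sum_mono2) (auto intro: mangoldt_nonneg)
    also have "\<dots> \<le> c / 2 * real x" using sum_mangoldt_nonprime_le[of x] elim by linarith
    also have "(\<Sum>n | n \<in> {1..x} \<and> [n = 1] (mod q) \<and> prime n. mangoldt n) =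
               (\<Sum>p | p \<le> x \<and> prime p \<and> [p = 1] (mod q). ln (real p))"
      by (intro sum.cong) (auto simp: prime_ge_1_nat[unfolded One_nat_def])
    finally show ?case using elim by (simp add: field_simps)
  qed
  thus ?thesis using that[of "c / 2"] c(1) by simp
qed

section \<open>The larger sieve\<close>

text \<open>
  The proof counts, in two ways, the triples \<open>(x, b, c)\<close> for which \<open>x b + n\<close> and \<open>x c + n\<close> lie in the
  same coset of the \<open>q\<close>-th powers. The coset of \<open>y\<close> is encoded by \<open>y ^ m mod p\<close>.
\<close>

lemma card_residues_le:
  fixes p q n :: nat and R :: "nat set"
  assumes p: "prime p" and pq: "p = q * m + 1" and q: "q \<ge> 2" and n: "\<not> p dvd n"
    and R: "R \<subseteq> {..<p}"
    and powers: "\<And>r s. r \<in> R \<Longrightarrow> s \<in> R \<Longrightarrow> r \<noteq> s \<Longrightarrow> p dvd r * s + n \<or> [(r * s + n) ^ m = 1] (mod p)"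
  shows "(real (card R))\<^sup>2 \<le> 72 * real p"
proof (cases "card R \<ge> 12")
  \<comment> \<open>The source of 72: here \<open>12^2 = 72 * 2 \<le> 72 * p\<close>, while the
    counting argument for larger \<open>R\<close> yields the better \<open>8 * p\<close>.\<close>
  case False
  hence "(real (card R))\<^sup>2 \<le> 12\<^sup>2" by (intro power_mono) auto
  thus ?thesis using prime_ge_2_nat[OF p] by simp
next
  case True
  define \<rho> where "\<rho> = real (card R)"
  have \<rho>: "\<rho> \<ge> 12" using True by (simp add: \<rho>_def)
  have p1: "p > 1" using prime_gt_1_nat[OF p] .
  have m0: "m > 0" using pq p1 by (cases m) auto
  have finR: "finite R" using R finite_subset by blast
  define \<kappa> where "\<kappa> y = y ^ m mod p" for y :: nat
  \<comment> \<open>The roots of unity of order dividing \<open>q\<close>. As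
    \<open>p = q * m + 1\<close>, they contain \<open>\<kappa> y\<close> exactly if \<open>p\<close>
    does not divide \<open>y\<close>; so there are at most \<open>q\<close> coset labels.\<close>
  define Z where "Z = {z \<in> {..<p}. [z ^ q = 1] (mod p)}"
  have cardZ: "card Z \<le> q" unfolding Z_def using q by (intro roots_mod_prime_bound p) auto
  have finZ: "finite Z" by (simp add: Z_def)
  have kappa_Z: "\<kappa> y \<in> Z \<longleftrightarrow> \<not> p dvd y" for y
  proof
    assume "\<not> p dvd y"
    hence "[y ^ (p - 1) = 1] (mod p)" by (intro fermat_theorem p)
    thus "\<kappa> y \<in> Z" using p1 by (simp add: Z_def \<kappa>_def Cong.cong_def power_mod pq mult.commute flip: power_mult)
  next
    assume *: "\<kappa> y \<in> Z"
    show "\<not> p dvd y"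
    proof
      assume "p dvd y"
      hence "p dvd y ^ m" using m0 dvd_power_le[of p y 1 m] by simp
      hence "\<kappa> y = 0" by (simp add: \<kappa>_def)
      thus False using * p1 q by (simp add: Z_def Cong.cong_def power_0_left)
    qed
  qed
  define cnt where "cnt x z = card {b \<in> R. \<kappa> (x * b + n) = z}" for x z
  define T where "T = (\<Sum>x<p. \<Sum>z\<in>Z. (real (cnt x z))\<^sup>2)"
  have card_zeros: "card {b \<in> R. p dvd x * b + n} \<le> 1" for x
  proof (rule card_le_Suc0_iff_eq[THEN iffD2, folded One_nat_def], use finR in simp, intro ballI)
    fix b c assume b: "b \<in> {b \<in> R. p dvd x * b + n}" and c: "c \<in> {b \<in> R. p dvd x * b + n}"
    have "\<not> p dvd x" using b n by (auto simp: dvd_add_right_iff)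
    hence cop: "coprime x p" using p by (simp add: prime_imp_coprime coprime_commute)
    have "[x * b + n = x * c + n] (mod p)" using b c by (simp add: Cong.cong_def mod_eq_0_iff_dvd)
    hence "[x * b = x * c] (mod p)" by (simp add: cong_add_rcancel_nat)
    hence "[b = c] (mod p)" using cop by (simp add: cong_mult_lcancel_nat)
    moreover have "b < p" "c < p" using b c R by auto
    ultimately show "b = c" by (simp add: Cong.cong_def)
  qed
  have sum_cnt: "(\<Sum>z\<in>Z. real (cnt x z)) \<ge> \<rho> - 1" for x
  proof -
    have "(\<Sum>z\<in>Z. cnt x z) = card (\<Union>z\<in>Z. {b \<in> R. \<kappa> (x * b + n) = z})"
      unfolding cnt_def using finZ finR by (intro card_UN_disjoint[symmetric]) auto
    also have "(\<Union>z\<in>Z. {b \<in> R. \<kappa> (x * b + n) = z}) = R - {b \<in> R. p dvd x * b + n}"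
      using kappa_Z by auto
    also have "card \<dots> = card R - card {b \<in> R. p dvd x * b + n}"
      using finR by (intro card_Diff_subset) auto
    finally have "(\<Sum>z\<in>Z. cnt x z) = card R - card {b \<in> R. p dvd x * b + n}" .
    moreover note card_zeros[of x]
    ultimately have "card R - 1 \<le> (\<Sum>z\<in>Z. cnt x z)" by linarith
    hence "real (card R - 1) \<le> real (\<Sum>z\<in>Z. cnt x z)" by (simp only: of_nat_le_iff)
    thus ?thesis using True by (simp add: \<rho>_def)
  qed
  have lower1: "(\<rho> - 1)\<^sup>2 / real q \<le> (\<Sum>z\<in>Z. (real (cnt x z))\<^sup>2)" for x
  proof -
    have "(\<rho> - 1)\<^sup>2 \<le> (\<Sum>z\<in>Z. real (cnt x z) * 1)\<^sup>2" using \<rho> sum_cnt[of x] by (intro power_mono) auto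
    also have "\<dots> \<le> (\<Sum>z\<in>Z. (real (cnt x z))\<^sup>2) * (\<Sum>z\<in>Z. 1\<^sup>2)" by (rule Cauchy_Schwarz_ineq_sum)
    also have "\<dots> \<le> (\<Sum>z\<in>Z. (real (cnt x z))\<^sup>2) * real q"
      using cardZ by (intro mult_left_mono) (auto intro: sum_nonneg)
    finally show ?thesis using q by (simp add: field_simps)
  qed
  \<comment> \<open>For \<open>x\<close> in \<open>R\<close> every \<open>b\<close> except
    \<open>x\<close> itself and at most one zero falls into the trivial coset, where Cauchy-Schwarz
    would only give a share \<open>1 / q\<close>. Summed over \<open>R\<close> this excess is cubic
    in \<open>\<rho>\<close>, and it decides the argument.\<close>
  have lower2: "(\<rho> - 2)\<^sup>2 \<le> (\<Sum>z\<in>Z. (real (cnt x z))\<^sup>2)" if x: "x \<in> R" for x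
  proof -
    have "card R - 2 \<le> cnt x 1"
    proof -
      have 1: "1 \<in> Z" using p1 by (simp add: Z_def)
      have "R - {x} - {b \<in> R. p dvd x * b + n} \<subseteq> {b \<in> R. \<kappa> (x * b + n) = 1}"
        using powers[OF x] p1 by (auto simp: \<kappa>_def Cong.cong_def)
      hence "card (R - {x} - {b \<in> R. p dvd x * b + n}) \<le> cnt x 1"
        unfolding cnt_def using finR by (intro card_mono) auto
      moreover have "card (R - {x} - {b \<in> R. p dvd x * b + n}) \<ge> card (R - {x}) - card {b \<in> R. p dvd x * b + n}"
        using finR by (intro diff_card_le_card_Diff) auto
      moreover note card_zeros[of x]
      moreover have "card (R - {x}) = card R - 1" using x finR by simp
      ultimately show ?thesis by linarith
    qed
    hence "\<rho> - 2 \<le> real (cnt x 1)" using True by (simp add: \<rho>_def)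
    hence "(\<rho> - 2)\<^sup>2 \<le> (real (cnt x 1))\<^sup>2" using \<rho> by (intro power_mono) auto
    also have "\<dots> \<le> (\<Sum>z\<in>Z. (real (cnt x z))\<^sup>2)"
      using finZ p1 by (intro member_le_sum) (auto simp: Z_def)
    finally show ?thesis .
  qed
  have "T \<ge> (\<Sum>x<p. if x \<in> R then (\<rho> - 2)\<^sup>2 else (\<rho> - 1)\<^sup>2 / real q)"
    unfolding T_def using lower1 lower2 by (intro sum_mono) auto
  also have "(\<Sum>x<p. if x \<in> R then (\<rho> - 2)\<^sup>2 else (\<rho> - 1)\<^sup>2 / real q) = 
     \<rho> * (\<rho> - 2)\<^sup>2 + (real p - \<rho>) * ((\<rho> - 1)\<^sup>2 / real q)"
  proof -
    have "card R \<le> p" using card_mono[OF _ R] by simp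
    moreover have "card ({..<p} - R) = p - card R" using R finR by (simp add: card_Diff_subset)
    moreover have "{..<p} \<inter> R = R" "{..<p} \<inter> - R = {..<p} - R" using R by auto
    ultimately show ?thesis by (simp add: sum.If_cases \<rho>_def of_nat_diff)
  qed
  finally have lower: "\<rho> * (\<rho> - 2)\<^sup>2 + (real p - \<rho>) * ((\<rho> - 1)\<^sup>2 / real q) \<le> T" .
  define G where "G b c = {x \<in> {..<p}. \<kappa> (x * b + n) = \<kappa> (x * c + n) \<and> \<not> p dvd x * b + n}" for b c
  have G_le: "card (G b c) \<le> m" if bc: "b \<in> R" "c \<in> R" "b \<noteq> c" for b c
  proof -
    \<comment> \<open>The quotient of \<open>x * b + n\<close> by \<open>x * c + n\<close> modulo
      \<open>p\<close>, with the inverse written as a power by Fermat. It is injective on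
      \<open>G b c\<close> and takes values among the at most \<open>m\<close> roots of
      \<open>z ^ m = 1\<close>.\<close>
    define t where "t x = (x * b + n) * (x * c + n) ^ (p - 2) mod p" for x
    have nd: "\<not> p dvd x * b + n" "\<not> p dvd x * c + n" "\<kappa> (x * b + n) = \<kappa> (x * c + n)" "x < p" if "x \<in> G b c" for x
      using that kappa_Z[of "x * b + n"] kappa_Z[of "x * c + n"] by (auto simp: G_def)
    have t_mult: "[t x * (x * c + n) = x * b + n] (mod p)" if "x \<in> G b c" for x
    proof -
      have "[(x * c + n) ^ (p - 1) = 1] (mod p)" using nd[OF that] by (intro fermat_theorem p)
      moreover have "p - 1 = Suc (p - 2)" using p1 by simp
      ultimately have "[(x * b + n) * ((x * c + n) ^ (p - 2) * (x * c + n)) = (x * b + n) * 1] (mod p)"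
        by (intro cong_mult) (auto simp: mult.commute)
      thus ?thesis by (simp add: t_def Cong.cong_def mod_mult_left_eq mult.assoc)
    qed
    have "inj_on t (G b c)"
    proof
      fix x y assume x: "x \<in> G b c" and y: "y \<in> G b c" and t: "t x = t y"
      have "[(x * b + n) * (y * c + n) = t x * (x * c + n) * (y * c + n)] (mod p)"
        using t_mult[OF x] by (intro cong_mult) (auto simp: cong_sym)
      also have "t x * (x * c + n) * (y * c + n) = (t y * (y * c + n)) * (x * c + n)" by (simp add: t mult_ac)
      also have "[\<dots> = (y * b + n) * (x * c + n)] (mod p)" by (intro cong_mult t_mult y) auto
      finally have "[int ((x * b + n) * (y * c + n)) = int ((y * b + n) * (x * c + n))] (mod int p)"
        by (simp only: cong_int_iff)
      hence "int p dvd int ((x * b + n) * (y * c + n)) - int ((y * b + n) * (x * c + n))"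
        by (simp add: cong_iff_dvd_diff)
      \<comment> \<open>Cross-multiplying \<open>t x = t y\<close> leaves a product whose factors
        \<open>n\<close> and \<open>b - c\<close> are prime to \<open>p\<close>.\<close>
      also have "int ((x * b + n) * (y * c + n)) - int ((y * b + n) * (x * c + n)) =
                 int n * ((int b - int c) * (int x - int y))" by (simp add: algebra_simps)
      finally have "int p dvd int n \<or> int p dvd int b - int c \<or> int p dvd int x - int y"
        using p by (simp add: prime_dvd_mult_iff)
      moreover have "\<not> int p dvd int n" using n by simp
      moreover have "\<not> int p dvd int b - int c"
      proof
        assume "int p dvd int b - int c"
        hence "[b = c] (mod p)" by (simp add: cong_iff_dvd_diff flip: cong_int_iff)
        moreover have "b < p" "c < p" using bc R by auto
        ultimately show False using bc by (simp add: Cong.cong_def)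
      qed
      ultimately have "[x = y] (mod p)" by (simp add: cong_iff_dvd_diff flip: cong_int_iff)
      thus "x = y" using nd[OF x] nd[OF y] by (simp add: Cong.cong_def)
    qed
    moreover have "t ` G b c \<subseteq> {z \<in> {..<p}. [z ^ m = 1] (mod p)}"
    proof
      fix z assume "z \<in> t ` G b c"
      then obtain x where x: "x \<in> G b c" "z = t x" by auto
      have cop: "coprime ((x * c + n) ^ m) p"
        using nd[OF x(1)] p by (simp add: prime_imp_coprime coprime_commute)
      have "[(t x * (x * c + n)) ^ m = (x * b + n) ^ m] (mod p)" using t_mult[OF x(1)] by (rule cong_pow)
      also have "[(x * b + n) ^ m = (x * c + n) ^ m] (mod p)"
        using nd(3)[OF x(1)] by (simp add: \<kappa>_def Cong.cong_def)
      finally have "[(x * c + n) ^ m * (t x) ^ m = (x * c + n) ^ m * 1] (mod p)"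
        by (simp add: power_mult_distrib mult.commute)
      hence "[(t x) ^ m = 1] (mod p)" using cop cong_mult_lcancel_nat by blast
      thus "z \<in> {z \<in> {..<p}. [z ^ m = 1] (mod p)}" using p1 by (simp add: x(2)) (simp add: t_def)
    qed
    hence "card (t ` G b c) \<le> card {z \<in> {..<p}. [z ^ m = 1] (mod p)}" by (intro card_mono) auto
    ultimately show ?thesis
      using roots_mod_prime_bound[OF p m0, of 1] card_image[of t "G b c"] by linarith
  qed
  have "T = (\<Sum>x<p. real (card {(b,c) \<in> R \<times> R. x \<in> G b c}))"
    unfolding T_def
  proof (rule sum.cong[OF refl])
    fix x assume x: "x \<in> {..<p}"
    have "{(b,c) \<in> R \<times> R. x \<in> G b c} = (\<Union>z\<in>Z. {b \<in> R. \<kappa> (x * b + n) = z} \<times> {b \<in> R. \<kappa> (x * b + n) = z})"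
    proof (intro equalityI subsetI)
      fix u assume "u \<in> {(b,c) \<in> R \<times> R. x \<in> G b c}"
      then obtain b c where u: "u = (b, c)" "b \<in> R" "c \<in> R" "\<kappa> (x * c + n) = \<kappa> (x * b + n)" "\<not> p dvd x * b + n"
        by (auto simp: G_def)
      have "\<kappa> (x * b + n) \<in> Z" using u kappa_Z by blast
      thus "u \<in> (\<Union>z\<in>Z. {b \<in> R. \<kappa> (x * b + n) = z} \<times> {b \<in> R. \<kappa> (x * b + n) = z})"
        using u by (intro UN_I[of "\<kappa> (x * b + n)"]) simp_all
    next
      fix u assume "u \<in> (\<Union>z\<in>Z. {b \<in> R. \<kappa> (x * b + n) = z} \<times> {b \<in> R. \<kappa> (x * b + n) = z})"
      then obtain z b c where u: "u = (b, c)" "b \<in> R" "c \<in> R" "\<kappa> (x * b + n) = z" "\<kappa> (x * c + n) = z" "z \<in> Z"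
        by auto
      have "\<not> p dvd x * b + n" using u kappa_Z by blast
      thus "u \<in> {(b,c) \<in> R \<times> R. x \<in> G b c}" using u x unfolding G_def by simp
    qed
    also have "card \<dots> = (\<Sum>z\<in>Z. card ({b \<in> R. \<kappa> (x * b + n) = z} \<times> {b \<in> R. \<kappa> (x * b + n) = z}))"
      using finZ finR by (intro card_UN_disjoint) auto
    also have "\<dots> = (\<Sum>z\<in>Z. (cnt x z)\<^sup>2)" by (simp add: card_cartesian_product cnt_def power2_eq_square)
    finally show "(\<Sum>z\<in>Z. (real (cnt x z))\<^sup>2) = real (card {(b,c) \<in> R \<times> R. x \<in> G b c})" by simp
  qed
  also have "\<dots> = (\<Sum>x<p. \<Sum>(b,c)\<in>R \<times> R. if x \<in> G b c then 1 else 0)"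
    using finR by (intro sum.cong refl) (simp add: sum.If_cases case_prod_unfold Int_def mem_Times_iff conj_ac)
  also have "\<dots> = (\<Sum>(b,c)\<in>R \<times> R. \<Sum>x<p. if x \<in> G b c then 1 else 0)"
    by (subst sum.swap) (simp add: case_prod_unfold)
  also have "\<dots> = (\<Sum>(b,c)\<in>R \<times> R. real (card (G b c)))"
    by (intro sum.cong refl) (auto simp: sum.If_cases G_def Int_def conj_commute intro!: arg_cong[of _ _ card])
  also have "\<dots> = (\<Sum>b\<in>R. \<Sum>c\<in>R. real (card (G b c)))" by (simp add: sum.cartesian_product)
  also have "\<dots> \<le> (\<Sum>b\<in>R. real p + (\<rho> - 1) * (real p / real q))"
  proof (intro sum_mono)
    fix b assume b: "b \<in> R"
    have "(\<Sum>c\<in>R. real (card (G b c))) = real (card (G b b)) + (\<Sum>c\<in>R - {b}. real (card (G b c)))"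
      using b finR by (simp add: sum.remove)
    also have "\<dots> \<le> real p + (\<Sum>c\<in>R - {b}. real p / real q)"
    proof (intro add_mono sum_mono)
      have "card (G b b) \<le> card {..<p}" by (intro card_mono) (auto simp: G_def)
      thus "real (card (G b b)) \<le> real p" by simp
      fix c assume "c \<in> R - {b}"
      hence "card (G b c) \<le> m" using b by (intro G_le) auto
      moreover have "real m \<le> real p / real q" using pq q by (simp add: field_simps flip: of_nat_mult)
      ultimately show "real (card (G b c)) \<le> real p / real q" by linarith
    qed
    also have "\<dots> = real p + (\<rho> - 1) * (real p / real q)"
      using b finR True by (simp add: \<rho>_def of_nat_diff)
    finally show "(\<Sum>c\<in>R. real (card (G b c))) \<le> real p + (\<rho> - 1) * (real p / real q)" .
  qed
  also have "\<dots> = \<rho> * (real p + (\<rho> - 1) * (real p / real q))" by (simp add: \<rho>_def)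
  finally have "\<rho> * (\<rho> - 2)\<^sup>2 + (real p - \<rho>) * ((\<rho> - 1)\<^sup>2 / real q) \<le> \<rho> * (real p + (\<rho> - 1) * (real p / real q))"
    using lower by linarith
  \<comment> \<open>The terms of order \<open>p * \<rho>^2 / q\<close> cancel:
    \<open>\<rho> * (\<rho> - 1)\<close> above against \<open>(\<rho> - 1)^2\<close> below leaves
    only \<open>p * (\<rho> - 1) / q\<close>.\<close>
  hence "\<rho> * ((\<rho> - 2)\<^sup>2 - (\<rho> - 1)\<^sup>2 / real q) \<le> \<rho> * real p + real p * (\<rho> - 1) / real q"
    using q by (simp add: field_simps power2_eq_square)
  also have "real p * (\<rho> - 1) / real q \<le> \<rho> * real p"
  proof -
    have "real p * (\<rho> - 1) \<le> (\<rho> * real p) * real q"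
      using mult_mono[of "\<rho> - 1" \<rho> "1" "real q"] q \<rho> mult_left_mono[of "(\<rho> - 1) * 1" "\<rho> * real q" "real p"]
      by (simp add: mult_ac)
    thus ?thesis using q by (simp add: field_simps)
  qed
  finally have "\<rho> * ((\<rho> - 2)\<^sup>2 - (\<rho> - 1)\<^sup>2 / real q) \<le> \<rho> * (2 * real p)" by simp
  hence "(\<rho> - 2)\<^sup>2 - (\<rho> - 1)\<^sup>2 / real q \<le> 2 * real p" using \<rho> by simp
  moreover have "(\<rho> - 1)\<^sup>2 / real q \<le> (\<rho> - 1)\<^sup>2 / 2" using q by (intro divide_left_mono) auto
  moreover have "(\<rho> - 2)\<^sup>2 - (\<rho> - 1)\<^sup>2 / 2 \<ge> \<rho>\<^sup>2 / 4"
  proof -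
    \<comment> \<open>The wanted inequality is \<open>\<rho>^2 - 12 * \<rho> + 14 \<ge> 0\<close>
      after clearing denominators, whence the threshold 12.\<close>
    have "0 \<le> \<rho> * (\<rho> - 12) + 14" using \<rho> by (intro add_nonneg_nonneg mult_nonneg_nonneg) auto
    thus ?thesis by (simp add: power2_eq_square field_simps)
  qed
  ultimately have "\<rho>\<^sup>2 \<le> 8 * real p" by linarith
  thus ?thesis using p1 by (simp add: \<rho>_def)
qed

lemma sum_ln_prime_divisors_le:
  fixes d :: nat
  assumes "d > 0" "finite P" "\<And>p. p \<in> P \<Longrightarrow> prime p"
  shows "(\<Sum>p | p \<in> P \<and> p dvd d. ln (real p)) \<le> ln (real d)"
proof -
  have "(\<Prod>p | p \<in> P \<and> p dvd d. p) dvd d"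
  proof -
    have "(\<Prod>p\<in>A. p) dvd d" if "finite A" "\<forall>p\<in>A. prime p \<and> p dvd d" for A :: "nat set"
      using that
    proof (induction A rule: finite_induct)
      case (insert p A)
      hence "coprime p (\<Prod>p\<in>A. p)" by (intro prod_coprime_right) (metis insertCI primes_coprime)
      thus ?case using insert by (simp add: divides_mult)
    qed auto
    thus ?thesis using assms by auto
  qed
  hence "(\<Prod>p | p \<in> P \<and> p dvd d. p) \<le> d" using assms by (intro dvd_imp_le) auto
  moreover have "(\<Prod>p | p \<in> P \<and> p dvd d. p) > 0" using assms by (intro prod_pos) (auto intro: prime_gt_0_nat)
  ultimately have "ln (real (\<Prod>p | p \<in> P \<and> p dvd d. p)) \<le> ln (real d)"
    using assms(1) by (simp only: ln_le_cancel_iff of_nat_0_less_iff of_nat_le_iff)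
  thus ?thesis using assms(2,3) by (subst (asm) of_nat_prod, subst (asm) ln_prod) (auto intro: prime_gt_0_nat)
qed

text \<open>Counts pairs \<open>(a, b)\<close> with weight \<open>ln p\<close> for each
  \<open>p\<close> in \<open>P\<close> modulo which they agree. Cauchy-Schwarz over the at most
  \<open>C\<close> classes bounds this from below. From above, a pair \<open>a \<noteq> b\<close>
  weighs at most \<open>ln X\<close>, as the primes concerned divide a nonzero difference, and the
  diagonal carries the full weight.\<close>

lemma larger_sieve:
  fixes S P :: "nat set" and X C :: real
  assumes S: "finite S" "\<And>a. a \<in> S \<Longrightarrow> real a \<le> X"
    and P: "finite P" "\<And>p. p \<in> P \<Longrightarrow> prime p"
    and C: "C > 0" and X: "X \<ge> 1"
    and res: "\<And>p. p \<in> P \<Longrightarrow> real (card ((\<lambda>a. a mod p) ` S)) \<le> C"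
  shows "(real (card S))\<^sup>2 * (\<Sum>p\<in>P. ln (real p)) / C \<le> (real (card S))\<^sup>2 * ln X + real (card S) * (\<Sum>p\<in>P. ln (real p))"
proof -
  have "(real (card S))\<^sup>2 * (\<Sum>p\<in>P. ln (real p)) / C = (\<Sum>p\<in>P. ln (real p) * ((real (card S))\<^sup>2 / C))"
    by (simp add: sum_distrib_left[symmetric] sum_distrib_right[symmetric] sum_divide_distrib[symmetric])
  also have "\<dots> \<le> (\<Sum>p\<in>P. ln (real p) * (\<Sum>(a,b)\<in>S \<times> S. if a mod p = b mod p then 1 else 0))"
  proof (intro sum_mono mult_left_mono)
    fix p assume p: "p \<in> P"
    define R where "R = (\<lambda>a. a mod p) ` S"
    define c where "c r = card {a \<in> S. a mod p = r}" for r
    have "(\<Sum>r\<in>R. c r) = card (\<Union>r\<in>R. {a \<in> S. a mod p = r})"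
      unfolding c_def using S by (intro card_UN_disjoint[symmetric]) (auto simp: R_def)
    also have "(\<Union>r\<in>R. {a \<in> S. a mod p = r}) = S" by (auto simp: R_def)
    finally have "(real (card S))\<^sup>2 = (\<Sum>r\<in>R. real (c r) * 1)\<^sup>2" by (simp flip: of_nat_sum)
    also have "\<dots> \<le> (\<Sum>r\<in>R. (real (c r))\<^sup>2) * (\<Sum>r\<in>R. 1\<^sup>2)" by (rule Cauchy_Schwarz_ineq_sum)
    also have "\<dots> \<le> (\<Sum>r\<in>R. (real (c r))\<^sup>2) * C"
      using res[OF p] by (intro mult_left_mono) (auto simp: R_def intro: sum_nonneg)
    also have "(\<Sum>r\<in>R. (real (c r))\<^sup>2) = real (\<Sum>r\<in>R. card ({a \<in> S. a mod p = r} \<times> {a \<in> S. a mod p = r}))"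
      by (simp add: c_def card_cartesian_product power2_eq_square)
    also have "(\<Sum>r\<in>R. card ({a \<in> S. a mod p = r} \<times> {a \<in> S. a mod p = r})) =
        card (\<Union>r\<in>R. {a \<in> S. a mod p = r} \<times> {a \<in> S. a mod p = r})"
      using S by (intro card_UN_disjoint[symmetric]) (auto simp: R_def)
    also have "(\<Union>r\<in>R. {a \<in> S. a mod p = r} \<times> {a \<in> S. a mod p = r}) = {(a,b)\<in>S \<times> S. a mod p = b mod p}"
      by (auto simp: R_def)
    also have "real (card \<dots>) = (\<Sum>(a,b)\<in>S \<times> S. if a mod p = b mod p then 1 else 0)"
      using S by (simp add: sum.If_cases case_prod_unfold Int_def mem_Times_iff conj_assoc)
    finally show "(real (card S))\<^sup>2 / C \<le> (\<Sum>(a,b)\<in>S \<times> S. if a mod p = b mod p then 1 else 0)"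
      using C by (simp add: field_simps)
  qed (use P in \<open>auto dest!: prime_ge_1_nat[OF P(2)]\<close>)
  also have "\<dots> = (\<Sum>p\<in>P. \<Sum>(a,b)\<in>S \<times> S. if a mod p = b mod p then ln (real p) else 0)"
    by (intro sum.cong refl) (simp add: sum_distrib_left case_prod_unfold if_distrib cong: if_cong)
  also have "\<dots> = (\<Sum>(a,b)\<in>S \<times> S. \<Sum>p\<in>P. if a mod p = b mod p then ln (real p) else 0)"
    by (subst sum.swap) (simp add: case_prod_unfold)
  also have "\<dots> \<le> (\<Sum>(a,b)\<in>S \<times> S. ln X + (if a = b then \<Sum>p\<in>P. ln (real p) else 0))"
  proof (intro sum_mono, clarify)
    fix a b assume ab: "a \<in> S" "b \<in> S"
    have lnX: "ln X \<ge> 0" using X by simp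
    have *: "(\<Sum>p\<in>P. if a mod p = b mod p then ln (real p) else 0) \<le> ln X" if ab: "a \<in> S" "b \<in> S" "b < a" for a b
    proof -
      have "(\<Sum>p\<in>P. if a mod p = b mod p then ln (real p) else 0) = (\<Sum>p | p \<in> P \<and> p dvd a - b. ln (real p))"
        using that P by (simp add: sum.If_cases Int_def mod_eq_dvd_iff_nat)
      also have "\<dots> \<le> ln (real (a - b))" using that P by (intro sum_ln_prime_divisors_le) auto
      also have "\<dots> \<le> ln X" using that S(2)[of a] by (subst ln_le_cancel_iff) auto
      finally show ?thesis .
    qed
    show "(\<Sum>p\<in>P. if a mod p = b mod p then ln (real p) else 0) \<le> ln X + (if a = b then \<Sum>p\<in>P. ln (real p) else 0)"
    proof (cases a b rule: linorder_cases)
      case less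
      thus ?thesis using *[of b a] ab by (simp add: eq_commute)
    qed (use *[of a b] ab lnX in auto)
  qed
  also have "\<dots> = (real (card S))\<^sup>2 * ln X + real (card S) * (\<Sum>p\<in>P. ln (real p))"
  proof -
    have "(\<Sum>(a,b)\<in>S \<times> S. if a = b then \<Sum>p\<in>P. ln (real p) else 0) = (\<Sum>a\<in>S. \<Sum>b\<in>S. if a = b then \<Sum>p\<in>P. ln (real p) else 0)"
      by (rule sum.cartesian_product[symmetric])
    also have "\<dots> = real (card S) * (\<Sum>p\<in>P. ln (real p))" using S by simp
    finally show ?thesis by (simp add: case_prod_unfold sum.distrib card_cartesian_product power2_eq_square)
  qed
  finally show ?thesis .
qed

section \<open>Small elements of a Diophantine tuple\<close>

text \<open>Since \<open>q\<close> divides \<open>k\<close>, a \<open>k\<close>-th power prime to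
  \<open>p\<close> is a \<open>q\<close>-th power, so its \<open>m\<close>-th power with
  \<open>q * m = p - 1\<close> is 1 by Fermat. Distinct residues come from distinct elements, so the
  tuple condition applies to them.\<close>

lemma card_residues_property_D_le:
  assumes D: "property_D k n S" and q: "prime q" "q dvd k" and p: "prime p" "[p = 1] (mod q)" "\<not> int p dvd n"
    and S': "S' \<subseteq> S"
  shows "(real (card ((\<lambda>a. a mod p) ` S')))\<^sup>2 \<le> 72 * real p"
proof -
  have p1: "p > 1" using p prime_gt_1_nat by blast
  have "q dvd p - 1" using p(2) p1 by (simp add: cong_altdef_nat)
  then obtain m where m: "p - 1 = q * m" by auto
  define n' where "n' = nat (n mod int p)"
  have n': "[int n' = n] (mod int p)" using p1 by (simp add: n'_def Cong.cong_def)
  show ?thesis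
  proof (rule card_residues_le[OF p(1), of q m n'])
    show "p = q * m + 1" using m p1 by simp
    show "q \<ge> 2" using q prime_ge_2_nat by blast
    show "\<not> p dvd n'" using n' p(3) by (metis cong_dvd_iff int_dvd_int_iff)
    show "(\<lambda>a. a mod p) ` S' \<subseteq> {..<p}" using p1 by auto
  next
    fix r s assume rs: "r \<in> (\<lambda>a. a mod p) ` S'" "s \<in> (\<lambda>a. a mod p) ` S'" "r \<noteq> s"
    then obtain a b where ab: "a \<in> S" "b \<in> S" "a \<noteq> b" "r = a mod p" "s = b mod p" using S' by auto
    have "is_nth_power k (int a * int b + n)" using D ab(1-3) unfolding property_D_def by blast
    then obtain y where y: "int a * int b + n = y ^ k" by (auto simp: is_nth_power_def)
    define y' where "y' = nat (y mod int p)"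
    have y': "[int y' = y] (mod int p)" using p1 by (simp add: y'_def Cong.cong_def)
    have "[int r * int s + int n' = int a * int b + n] (mod int p)"
      using n' by (intro cong_add cong_mult) (auto simp: ab Cong.cong_def zmod_int)
    also have "int a * int b + n = y ^ k" by (rule y)
    also have "[y ^ k = int y' ^ k] (mod int p)" using y' by (intro cong_pow) (rule cong_sym)
    finally have "[int (r * s + n') = int (y' ^ k)] (mod int p)" by simp
    hence eq: "[r * s + n' = y' ^ k] (mod p)" by (simp only: cong_int_iff)
    show "p dvd r * s + n' \<or> [(r * s + n') ^ m = 1] (mod p)"
    proof (cases "p dvd y'")
      case True
      have "k > 0 \<or> k = 0" by auto
      thus ?thesis
      proof
        assume "k > 0"
        hence "p dvd y' ^ k" using True dvd_power_le[of p y' 1 k] by simp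
        thus ?thesis using eq by (simp add: cong_dvd_iff)
      next
        assume "k = 0"
        hence "[(r * s + n') ^ m = 1 ^ m] (mod p)" using eq by (intro cong_pow) simp
        thus ?thesis by simp
      qed
    next
      case False
      have "[(r * s + n') ^ m = (y' ^ k) ^ m] (mod p)" using eq by (rule cong_pow)
      also have "(y' ^ k) ^ m = (y' ^ (p - 1)) ^ (k div q)"
      proof -
        have "k * m = (p - 1) * (k div q)" using q m by (auto elim!: dvdE)
        thus ?thesis by (simp flip: power_mult)
      qed
      also have "[(y' ^ (p - 1)) ^ (k div q) = 1 ^ (k div q)] (mod p)"
        using False p by (intro cong_pow fermat_theorem)
      finally show ?thesis by simp
    qed
  qed
qed

lemma card_small_elements:
  assumes "k \<noteq> 1"
  shows "\<exists>C::real. \<forall>\<^sub>F n::int in filtercomap abs at_top. \<forall>S. property_D k n S \<longrightarrow>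
    real (card {a \<in> S. real a < \<bar>real_of_int n\<bar> ^ 3}) \<le> C * ln \<bar>real_of_int n\<bar>"
proof -
  obtain q where q: "prime q" "q dvd k" using prime_factor_nat[OF assms] by auto
  obtain c where c: "c > 0"
    "\<forall>\<^sub>F x in at_top. c * real x \<le> (\<Sum>p | p \<le> x \<and> prime p \<and> [p = 1] (mod q). ln (real p))"
    by (rule primes_cong_1_lower_bound[OF q(1)])
  obtain Y0 where Y0: "\<And>x. x \<ge> Y0 \<Longrightarrow> c * real x \<le> (\<Sum>p | p \<le> x \<and> prime p \<and> [p = 1] (mod q). ln (real p))"
    using c(2) unfolding eventually_at_top_linorder by blast
  \<comment> \<open>The part \<open>45 / c\<close> covers \<open>4 * 9\<close>, four times the
    residue constant, plus the weight of the primes dividing \<open>n\<close>; \<open>Y0\<close>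
    makes the bound on primes applicable, and 1 ensures \<open>K \<ge> 1\<close>.\<close>
  define K where "K = 45 / c + real Y0 + 1"
  have K: "K \<ge> 45 / c" "K \<ge> real Y0" "K \<ge> 1" using c(1) by (auto simp: K_def)
  have main: "real (card {a \<in> S. real a < \<bar>real_of_int n\<bar> ^ 3}) \<le> 8 * K\<^sup>2 * ln \<bar>real_of_int n\<bar>"
    if n3: "\<bar>n\<bar> \<ge> 3" and D: "property_D k n S" for n S
  proof -
    define l where "l = ln \<bar>real_of_int n\<bar>"
    have l1: "l \<ge> 1"
    proof -
      have "exp 1 \<le> (3::real)" by (rule exp_le)
      also have "\<dots> \<le> \<bar>real_of_int n\<bar>" using n3 by linarith
      finally have "ln (exp 1) \<le> l" unfolding l_def using n3 by (subst ln_le_cancel_iff) auto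
      thus ?thesis by simp
    qed
    define Y where "Y = nat \<lceil>(K * l)\<^sup>2\<rceil>"
    have Kl: "K * l \<ge> 1" "K * l \<ge> K" using K l1 mult_mono[of 1 K 1 l] mult_left_mono[of 1 l K] by auto
    hence Kl2: "(K * l)\<^sup>2 \<ge> 1" by simp
    have Y: "(K * l)\<^sup>2 \<le> real Y" "real Y \<le> 2 * (K * l)\<^sup>2" using Kl2 unfolding Y_def by linarith+
    have "K * l \<le> (K * l)\<^sup>2" using Kl mult_left_mono[of 1 "K * l" "K * l"] by (simp add: power2_eq_square)
    hence YY0: "Y \<ge> Y0" using Kl Y K by linarith
    have sY: "sqrt (real Y) \<ge> K * l" using Y(1) Kl by (intro real_le_rsqrt)
    define P where "P = {p. p \<le> Y \<and> prime p \<and> [p = 1] (mod q) \<and> \<not> int p dvd n}"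
    define \<Theta> where "\<Theta> = (\<Sum>p\<in>P. ln (real p))"
    have finP: "finite P" by (rule finite_subset[of _ "{..Y}"]) (auto simp: P_def)
    have theta_upper: "\<Theta> \<le> 8 * (K * l)\<^sup>2"
    proof -
      have "\<Theta> = (\<Sum>p\<in>P. mangoldt p)" unfolding \<Theta>_def by (intro sum.cong) (auto simp: P_def)
      also have "\<dots> \<le> psi Y" unfolding psi_def
        by (intro sum_mono2) (auto simp: P_def prime_ge_1_nat[unfolded One_nat_def] mangoldt_nonneg)
      also have "\<dots> \<le> 4 * real Y" by (rule psi_le)
      finally show ?thesis using Y(2) by linarith
    qed
    \<comment> \<open>The excluded primes all divide \<open>n\<close>, so together they weigh at
      most \<open>ln \<bar>n\<bar> = l\<close>.\<close>
    have theta_lower: "c * real Y - l \<le> \<Theta>"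
    proof -
      define F where "F = {p. p \<le> Y \<and> prime p \<and> [p = 1] (mod q)}"
      have finF: "finite F" by (rule finite_subset[of _ "{..Y}"]) (auto simp: F_def)
      have "c * real Y \<le> (\<Sum>p\<in>F. ln (real p))" using Y0[OF YY0] by (simp add: F_def)
      also have "\<dots> = \<Theta> + (\<Sum>p | p \<in> F \<and> p dvd nat \<bar>n\<bar>. ln (real p))"
        unfolding \<Theta>_def using finF finP
        by (subst sum.union_disjoint[symmetric]) (auto simp: F_def P_def int_dvd_int_iff[symmetric] simp del: int_dvd_int_iff intro!: sum.cong)
      also have "(\<Sum>p | p \<in> F \<and> p dvd nat \<bar>n\<bar>. ln (real p)) \<le> ln (real (nat \<bar>n\<bar>))"
        using n3 finF by (intro sum_ln_prime_divisors_le) (auto simp: F_def)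
      also have "\<dots> = l" by (simp add: l_def)
      finally show ?thesis by simp
    qed
    define S' where "S' = {a \<in> S. real a < \<bar>real_of_int n\<bar> ^ 3}"
    define m where "m = real (card S')"
    have fin: "finite S'" using D by (auto simp: S'_def property_D_def)
    have sYpos: "sqrt (real Y) \<ge> 1" using sY Kl by linarith
    have "m\<^sup>2 * \<Theta> / (9 * sqrt (real Y)) \<le> m\<^sup>2 * ln (\<bar>real_of_int n\<bar> ^ 3) + m * \<Theta>"
      unfolding m_def \<Theta>_def
    proof (rule larger_sieve[OF fin _ finP])
      show "real a \<le> \<bar>real_of_int n\<bar> ^ 3" if "a \<in> S'" for a using that by (simp add: S'_def)
      show "prime p" if "p \<in> P" for p using that by (simp add: P_def)
      show "0 < 9 * sqrt (real Y)" using sYpos by simp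
      show "1 \<le> \<bar>real_of_int n\<bar> ^ 3" using n3 by (intro one_le_power) linarith
      show "real (card ((\<lambda>a. a mod p) ` S')) \<le> 9 * sqrt (real Y)" if p: "p \<in> P" for p
      proof -
        have "(real (card ((\<lambda>a. a mod p) ` S')))\<^sup>2 \<le> 72 * real p"
          using p by (intro card_residues_property_D_le[OF D q]) (auto simp: P_def S'_def)
        also have "\<dots> \<le> (9 * sqrt (real Y))\<^sup>2" using p by (simp add: P_def power_mult_distrib)
        finally show ?thesis by (rule power2_le_imp_le) simp
      qed
    qed
    also have "ln (\<bar>real_of_int n\<bar> ^ 3) = 3 * l" using n3 by (simp add: l_def ln_realpow)
    finally have sieve: "m\<^sup>2 * (\<Theta> / (9 * sqrt (real Y))) \<le> m\<^sup>2 * (3 * l) + m * \<Theta>" by simp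
    \<comment> \<open>The sieve compares this quantity with
      \<open>ln (\<bar>n\<bar>^3) = 3 * l\<close>. The surplus \<open>l\<close> leaves
      \<open>m * l \<le> \<Theta>\<close>, and \<open>\<Theta>\<close> is of order
      \<open>l^2\<close>.\<close>
    have "4 * l \<le> \<Theta> / (9 * sqrt (real Y))"
    proof -
      have "4 * l * (9 * sqrt (real Y)) + l \<le> 45 * l * sqrt (real Y)"
      proof -
        have "l * 1 \<le> l * sqrt (real Y)" using sYpos l1 by (intro mult_left_mono) auto
        moreover have "l * sqrt (real Y) \<ge> 0" using l1 by auto
        ultimately show ?thesis by (simp only: mult.commute mult.left_commute mult.assoc)
      qed
      also have "\<dots> \<le> c * K * l * sqrt (real Y)"
      proof -
        have "45 \<le> c * K" using K(1) c(1) by (simp add: field_simps)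
        thus ?thesis using l1 by (intro mult_right_mono) auto
      qed
      also have "\<dots> = c * (K * l * sqrt (real Y))" by simp
      also have "\<dots> \<le> c * (sqrt (real Y) * sqrt (real Y))"
        using sY c(1) sYpos by (intro mult_left_mono mult_right_mono) auto
      also have "\<dots> = c * real Y" by simp
      finally have "4 * l * (9 * sqrt (real Y)) \<le> \<Theta>" using theta_lower by linarith
      thus ?thesis using sYpos by (simp add: field_simps)
    qed
    hence "m\<^sup>2 * (4 * l) \<le> m\<^sup>2 * (\<Theta> / (9 * sqrt (real Y)))" by (intro mult_left_mono) auto
    moreover have "m * \<Theta> \<le> m * (8 * (K * l)\<^sup>2)"
      by (intro mult_left_mono theta_upper) (simp add: m_def)
    ultimately have "m\<^sup>2 * (4 * l) \<le> m\<^sup>2 * (3 * l) + m * (8 * (K * l)\<^sup>2)"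
      using sieve by linarith
    hence "m * (m * l) \<le> m * (8 * (K * l)\<^sup>2)" by (simp add: power2_eq_square algebra_simps)
    hence "m = 0 \<or> m * l \<le> 8 * (K * l)\<^sup>2"
      using mult_le_cancel_left_pos[of m "m * l"] by (cases "m = 0") (auto simp: m_def)
    moreover have "8 * (K * l)\<^sup>2 = (8 * K\<^sup>2 * l) * l" by (simp add: power2_eq_square)
    ultimately have "m = 0 \<or> m * l \<le> (8 * K\<^sup>2 * l) * l" by simp
    hence "m \<le> 8 * K\<^sup>2 * l" using l1 by auto
    thus ?thesis by (simp add: m_def S'_def l_def)
  qed
  show ?thesis
    unfolding eventually_filtercomap_at_top_linorder
    by (rule exI[of _ "8 * K\<^sup>2"], rule exI[of _ 3]) (use main in blast)
qed

section \<open>Pade approximation and the Thue--Siegel principle\<close>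

lemma binomial_sum_Suc:
  fixes f :: "nat \<Rightarrow> real"
  shows "(\<Sum>i\<le>Suc r. real (Suc r choose i) * f i) = (\<Sum>i\<le>r. real (r choose i) * f i) + (\<Sum>i\<le>r. real (r choose i) * f (Suc i))"
proof -
  have "(\<Sum>i\<le>Suc r. real (Suc r choose i) * f i) = f 0 + (\<Sum>i\<le>r. real (Suc r choose Suc i) * f (Suc i))"
    by (subst sum.atMost_Suc_shift) simp
  also have "\<dots> = f 0 + (\<Sum>i\<le>r. real (r choose Suc i) * f (Suc i)) + (\<Sum>i\<le>r. real (r choose i) * f (Suc i))"
    by (simp add: algebra_simps sum.distrib)
  also have "f 0 + (\<Sum>i\<le>r. real (r choose Suc i) * f (Suc i)) = (\<Sum>i\<le>Suc r. real (r choose i) * f i)"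
    by (subst sum.atMost_Suc_shift) simp
  finally show ?thesis by simp
qed

text \<open>Partial fractions of \<open>r! / (s (s + 1) ... (s + r))\<close>. By Pascal's rule the
  sum for \<open>Suc r\<close> is the difference of the sums for \<open>r\<close> at
  \<open>s\<close> and \<open>s + 1\<close>.\<close>

lemma sum_binomial_partial_fraction:
  fixes s :: real
  assumes "\<And>i. i \<le> r \<Longrightarrow> s + real i \<noteq> 0"
  shows "(\<Sum>i\<le>r. real (r choose i) * ((-1) ^ i / (s + real i))) = fact r / pochhammer s (Suc r)"
  using assms
proof (induction r arbitrary: s)
  case (Suc r)
  have s0: "s \<noteq> 0" using Suc.prems[of 0] by simp
  have sr: "s + real (Suc r) \<noteq> 0" using Suc.prems[of "Suc r"] by simp
  have p0: "pochhammer (s + 1) r \<noteq> 0"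
    using Suc.prems[of "Suc i" for i] by (auto simp: pochhammer_eq_0_iff)  (smt (verit) Suc_leI Suc.prems less_imp_le_nat of_nat_Suc)
  have "(\<Sum>i\<le>Suc r. real (Suc r choose i) * ((-1) ^ i / (s + real i))) =
     (\<Sum>i\<le>r. real (r choose i) * ((-1) ^ i / (s + real i))) - (\<Sum>i\<le>r. real (r choose i) * ((-1) ^ i / (s + 1 + real i)))"
    unfolding binomial_sum_Suc by (simp add: sum_negf add_ac)
  also have "\<dots> = fact r / pochhammer s (Suc r) - fact r / pochhammer (s + 1) (Suc r)"
    using Suc.prems[of "Suc i" for i] Suc.prems by (subst (1 2) Suc.IH) (auto simp: add_ac)
  also have "pochhammer s (Suc r) = s * pochhammer (s + 1) r" by (rule pochhammer_rec)
  also have "pochhammer (s + 1) (Suc r) = pochhammer (s + 1) r * (s + real (Suc r))"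
    by (subst pochhammer_Suc) (simp add: add_ac)
  also have "fact r / (s * pochhammer (s + 1) r) - fact r / (pochhammer (s + 1) r * (s + real (Suc r))) =
      fact (Suc r) / (s * (pochhammer (s + 1) r * (s + real (Suc r))))"
    using s0 sr p0 by (simp add: divide_simps) (simp add: algebra_simps)
  also have "s * (pochhammer (s + 1) r * (s + real (Suc r))) = pochhammer s (Suc (Suc r))"
    by (subst pochhammer_rec, subst pochhammer_Suc) (simp add: add_ac)
  finally show ?case .
qed simp

context
  fixes k :: nat
  assumes k: "k \<ge> 2"
begin

text \<open>Expanding the binomials in the integrand of the remainder leaves powers of
  \<open>t\<close> with exponent \<open>i + j - r - 1 + 1/k\<close>; this is the exponent after
  integration, and the divisor in \<open>pade_coeff\<close>.\<close>

definition pade_exponent :: "nat \<Rightarrow> nat \<Rightarrow> nat \<Rightarrow> real" where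
  "pade_exponent r i j = real i + real j - real r + 1 / real k"

definition pade_coeff :: "nat \<Rightarrow> nat \<Rightarrow> nat \<Rightarrow> real" where
  "pade_coeff r i j = (-1) ^ r * (real (r choose i) * real (r choose j) * (-1) ^ (i + j) / pade_exponent r i j)"

definition PA :: "nat \<Rightarrow> real \<Rightarrow> real" where
  "PA r w = (\<Sum>i\<le>r. \<Sum>j\<le>r. pade_coeff r i j * w ^ (r - i))"

definition PB :: "nat \<Rightarrow> real \<Rightarrow> real" where
  "PB r w = (\<Sum>i\<le>r. \<Sum>j\<le>r. pade_coeff r i j * w ^ j)"

text \<open>
  The remainder is the integral of \<open>(w - t)\<^sup>r (t - 1)\<^sup>r\<close> times \<open>t\<close> to the power \<open>1/k - r - 1\<close> over \<open>[1, w]\<close>;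
  \<open>PA\<close> and \<open>PB\<close> arise by expanding both binomials. Below, \<open>PF\<close> is an antiderivative of the integrand \<open>PG\<close>.
\<close>

definition PK :: "nat \<Rightarrow> real \<Rightarrow> real" where
  "PK r w = w powr (1 / real k) * PB r w - PA r w"

lemma pade_exponent_eq: "pade_exponent r i j = (real k * (real i + real j - real r) + 1) / real k"
  using k by (simp add: pade_exponent_def field_simps)

text \<open>The numerator over \<open>k\<close> is an integer congruent to 1 modulo
  \<open>k\<close>, so it cannot vanish for \<open>k \<ge> 2\<close>.\<close>

lemma abs_pade_exponent_ge: "\<bar>pade_exponent r i j\<bar> \<ge> 1 / real k"
proof -
  define m where "m = int k * (int i + int j - int r) + 1"
  have "m \<noteq> 0"
  proof
    assume "m = 0"
    hence "int k * (int r - int i - int j) = 1" by (simp add: m_def algebra_simps)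
    hence "int k dvd 1" by (metis dvd_triv_left)
    thus False using k by simp
  qed
  hence "\<bar>real_of_int m\<bar> \<ge> 1" by linarith
  moreover have "pade_exponent r i j = real_of_int m / real k" by (simp add: pade_exponent_eq m_def)
  ultimately show ?thesis using k by (simp add: divide_right_mono)
qed

lemma pade_exponent_nonzero: "pade_exponent r i j \<noteq> 0"
  using abs_pade_exponent_ge[of r i j] k by auto

definition PF :: "nat \<Rightarrow> real \<Rightarrow> real \<Rightarrow> real" where
  "PF r w t = (\<Sum>i\<le>r. \<Sum>j\<le>r. pade_coeff r i j * w ^ (r - i) * t powr pade_exponent r i j)"

definition PG :: "nat \<Rightarrow> real \<Rightarrow> real \<Rightarrow> real" where
  "PG r w t = (w - t) ^ r * (t - 1) ^ r * t powr (1 / real k - real r - 1)"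

text \<open>Makes the remainder an increment of \<open>PF\<close>, so pointwise bounds on the
  derivative \<open>PG\<close> carry over to \<open>PK\<close> by monotonicity, without
  integrals.\<close>

lemma PK_eq: 
  assumes "w \<ge> 1"
  shows "PK r w = PF r w w - PF r w 1"
proof -
  have "w ^ (r - i) * w powr pade_exponent r i j = w powr (1 / real k) * w ^ j" if "i \<le> r" for i j
  proof -
    have "w ^ (r - i) = w powr (real r - real i)"
      using assms that by (simp add: powr_realpow[symmetric] of_nat_diff)
    moreover have "w ^ j = w powr real j" using assms by (simp add: powr_realpow)
    ultimately show ?thesis using assms by (simp add: powr_add[symmetric] pade_exponent_def add_ac)
  qed
  hence "PF r w w = w powr (1 / real k) * PB r w"
    unfolding PF_def PB_def sum_distrib_left by (intro sum.cong refl) (simp add: mult_ac)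
  moreover have "PF r w 1 = PA r w" by (simp add: PF_def PA_def)
  ultimately show ?thesis by (simp add: PK_def)
qed

lemma PF_deriv:
  assumes t: "t > 0"
  shows "(PF r w has_real_derivative PG r w t) (at t)"
proof -
  have "(PF r w has_real_derivative (\<Sum>i\<le>r. \<Sum>j\<le>r. pade_coeff r i j * w ^ (r - i) * (pade_exponent r i j * t powr (pade_exponent r i j - 1)))) (at t)"
    unfolding PF_def using t
    by (intro DERIV_sum DERIV_cmult has_real_derivative_powr)
  also have "(\<Sum>i\<le>r. \<Sum>j\<le>r. pade_coeff r i j * w ^ (r - i) * (pade_exponent r i j * t powr (pade_exponent r i j - 1))) =
     (\<Sum>i\<le>r. \<Sum>j\<le>r. (-1) ^ r * t powr (1 / real k - real r - 1) * ((real (r choose i) * (-t) ^ i * w ^ (r - i)) * (real (r choose j) * (-t) ^ j)))"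
  proof (intro sum.cong refl)
    fix i j
    have "t powr (pade_exponent r i j - 1) = t powr (1 / real k - real r - 1) * t ^ i * t ^ j"
    proof -
      have "pade_exponent r i j - 1 = (1 / real k - real r - 1) + real i + real j" by (simp add: pade_exponent_def)
      thus ?thesis using t by (simp only: powr_add powr_realpow)
    qed
    moreover have "pade_coeff r i j * pade_exponent r i j = (-1) ^ r * (real (r choose i) * real (r choose j) * (-1) ^ (i + j))"
      using pade_exponent_nonzero by (simp add: pade_coeff_def)
    moreover have "(-t) ^ i = (-1) ^ i * t ^ i" "(-t) ^ j = (-1) ^ j * t ^ j" by (rule power_minus)+
    ultimately show "pade_coeff r i j * w ^ (r - i) * (pade_exponent r i j * t powr (pade_exponent r i j - 1)) =
      (-1) ^ r * t powr (1 / real k - real r - 1) * ((real (r choose i) * (-t) ^ i * w ^ (r - i)) * (real (r choose j) * (-t) ^ j))"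
      by (simp add: power_add mult_ac)
  qed
  also have "\<dots> = (-1) ^ r * t powr (1 / real k - real r - 1) *
     ((\<Sum>i\<le>r. real (r choose i) * (-t) ^ i * w ^ (r - i)) * (\<Sum>j\<le>r. real (r choose j) * (-t) ^ j))"
    unfolding sum_product unfolding sum_distrib_left ..
  also have "(\<Sum>i\<le>r. real (r choose i) * (-t) ^ i * w ^ (r - i)) = (-t + w) ^ r" by (rule binomial_ring[symmetric])
  also have "(\<Sum>j\<le>r. real (r choose j) * (-t) ^ j) = (-t + 1) ^ r" by (subst binomial_ring) simp
  also have "(-1) ^ r * t powr (1 / real k - real r - 1) * ((-t + w) ^ r * (-t + 1) ^ r) = PG r w t"
  proof -
    have "(-t + 1) ^ r = (-1) ^ r * (t - 1) ^ r" by (simp flip: power_mult_distrib)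
    moreover have "(-1) ^ r * p * (a * ((-1) ^ r * b)) = a * b * p" for p a b :: real
      by (cases "even r") auto
    ultimately show ?thesis by (simp only: PG_def uminus_add_conv_diff)
  qed
  finally show ?thesis .
qed

lemma PG_le:
  assumes "1 \<le> t" "t \<le> w"
  shows "PG r w t \<le> (w - 1) ^ (2 * r)"
proof -
  have "1 / real k \<le> 1" using k by simp
  hence le1: "t powr (1 / real k - real r - 1) \<le> t powr 0" using assms by (intro powr_mono) auto
  have le2: "(w - t) ^ r * (t - 1) ^ r \<le> (w - 1) ^ r * (w - 1) ^ r"
    using assms by (intro mult_mono power_mono) auto
  have "PG r w t \<le> ((w - 1) ^ r * (w - 1) ^ r) * 1"
    unfolding PG_def by (rule mult_mono[OF le2]) (use assms le1 in auto)
  thus ?thesis by (simp add: mult_2 power_add)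
qed

lemma PG_Suc_le:
  assumes "1 \<le> t" "t \<le> w"
  shows "PG (Suc r) w t \<le> (w - 1)\<^sup>2 * PG r w t"
proof -
  have "t powr (1 / real k - real (Suc r) - 1) \<le> t powr (1 / real k - real r - 1)"
    using assms by (intro powr_mono) auto
  moreover have "(w - t) * (t - 1) \<le> (w - 1) * (w - 1)" using assms by (intro mult_mono) auto
  ultimately have "((w - t) * (t - 1)) * ((w - t) ^ r * (t - 1) ^ r * t powr (1 / real k - real (Suc r) - 1)) \<le>
     ((w - 1) * (w - 1)) * ((w - t) ^ r * (t - 1) ^ r * t powr (1 / real k - real r - 1))"
    using assms by (intro mult_mono) auto
  thus ?thesis by (simp add: PG_def power2_eq_square mult_ac)
qed

lemma PK_pos:
  assumes "w > 1"
  shows "PK r w > 0"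
proof -
  have "PF r w 1 < PF r w w"
  proof (rule DERIV_pos_imp_increasing_open[OF assms])
    fix t assume t: "1 < t" "t < w"
    have "PG r w t > 0" using t by (simp add: PG_def)
    thus "\<exists>y. (PF r w has_real_derivative y) (at t) \<and> y > 0" using PF_deriv[of t r w] t by auto
  next
    show "continuous_on {1..w} (PF r w)"
      by (intro continuous_at_imp_continuous_on ballI DERIV_isCont[OF PF_deriv]) auto
  qed
  thus ?thesis using assms by (simp add: PK_eq)
qed

lemma PK_le:
  assumes "w \<ge> 1"
  shows "PK r w \<le> (w - 1) ^ (2 * r + 1)"
proof -
  have "(\<lambda>t. (w - 1) ^ (2 * r) * t - PF r w t) 1 \<le> (\<lambda>t. (w - 1) ^ (2 * r) * t - PF r w t) w"
  proof (rule DERIV_nonneg_imp_nondecreasing[OF assms])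
    fix t assume t: "1 \<le> t" "t \<le> w"
    have "((\<lambda>t. (w - 1) ^ (2 * r) * t - PF r w t) has_real_derivative (w - 1) ^ (2 * r) * 1 - PG r w t) (at t)"
      using t by (intro DERIV_diff DERIV_cmult DERIV_ident PF_deriv) auto
    moreover have "(w - 1) ^ (2 * r) * 1 - PG r w t \<ge> 0" using PG_le[OF t] by simp
    ultimately show "\<exists>y. ((\<lambda>t. (w - 1) ^ (2 * r) * t - PF r w t) has_real_derivative y) (at t) \<and> 0 \<le> y" by blast
  qed
  thus ?thesis using assms by (simp add: PK_eq algebra_simps)
qed

lemma PK_Suc_le:
  assumes "w \<ge> 1"
  shows "PK (Suc r) w \<le> (w - 1)\<^sup>2 * PK r w"
proof -
  have "(\<lambda>t. (w - 1)\<^sup>2 * PF r w t - PF (Suc r) w t) 1 \<le> (\<lambda>t. (w - 1)\<^sup>2 * PF r w t - PF (Suc r) w t) w"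
  proof (rule DERIV_nonneg_imp_nondecreasing[OF assms])
    fix t assume t: "1 \<le> t" "t \<le> w"
    have "((\<lambda>t. (w - 1)\<^sup>2 * PF r w t - PF (Suc r) w t) has_real_derivative (w - 1)\<^sup>2 * PG r w t - PG (Suc r) w t) (at t)"
      using t by (intro DERIV_diff DERIV_cmult DERIV_ident PF_deriv) auto
    moreover have "(w - 1)\<^sup>2 * PG r w t - PG (Suc r) w t \<ge> 0" using PG_Suc_le[OF t] by simp
    ultimately show "\<exists>y. ((\<lambda>t. (w - 1)\<^sup>2 * PF r w t - PF (Suc r) w t) has_real_derivative y) (at t) \<and> 0 \<le> y" by blast
  qed
  thus ?thesis using assms by (simp add: PK_eq algebra_simps)
qed

section \<open>Positivity and growth of the coefficients of \<open>PB\<close>\<close>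

definition \<beta> :: "nat \<Rightarrow> nat \<Rightarrow> real" where
  "\<beta> r j = (\<Sum>i\<le>r. pade_coeff r i j)"

lemma PB_eq: "PB r w = (\<Sum>j\<le>r. \<beta> r j * w ^ j)"
  unfolding PB_def \<beta>_def sum_distrib_right by (rule sum.swap)

lemma beta_eq:
  "\<beta> r j = (-1) ^ r * (-1) ^ j * real (r choose j) * fact r / pochhammer (real j - real r + 1 / real k) (Suc r)"
proof -
  have "\<beta> r j = (\<Sum>i\<le>r. (-1) ^ r * (-1) ^ j * real (r choose j) * (real (r choose i) * ((-1) ^ i / (real j - real r + 1 / real k + real i))))"
    unfolding \<beta>_def pade_coeff_def pade_exponent_def by (intro sum.cong refl) (simp add: power_add algebra_simps)
  also have "\<dots> = (-1) ^ r * (-1) ^ j * real (r choose j) * (\<Sum>i\<le>r. real (r choose i) * ((-1) ^ i / (real j - real r + 1 / real k + real i)))"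
    by (simp only: sum_distrib_left)
  also have "(\<Sum>i\<le>r. real (r choose i) * ((-1) ^ i / (real j - real r + 1 / real k + real i))) =
     fact r / pochhammer (real j - real r + 1 / real k) (Suc r)"
  proof (rule sum_binomial_partial_fraction)
    show "real j - real r + 1 / real k + real i \<noteq> 0" for i
      using pade_exponent_nonzero[of r i j] by (simp add: pade_exponent_def algebra_simps)
  qed
  finally show ?thesis by simp
qed

text \<open>In the closed form, raising \<open>r\<close> moves the start of the Pochhammer product
  from \<open>s\<close> to \<open>s - 1\<close> and thus adds a single factor. The quotient of
  consecutive coefficients is explicit, stated here without division.\<close>

lemma beta_Suc:
  assumes "j \<le> r"
  shows "\<beta> (Suc r) j * (real r + 1 - real j - 1 / real k) * real (r choose j) = \<beta> r j * (real r + 1) * real (Suc r choose j)"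
proof -
  define s where "s = real j - real r + 1 / real k"
  have "1 / real k < 1" using k by simp
  hence s1: "s - 1 \<noteq> 0" "s < 1" using assms by (auto simp: s_def)
  have e1: "pochhammer (s - 1) (Suc (Suc r)) = (s - 1) * pochhammer s (Suc r)"
    using pochhammer_rec[of "s - 1" "Suc r"] by simp
  have e2: "real j - real (Suc r) + 1 / real k = s - 1" by (simp add: s_def)
  have 1: "\<beta> (Suc r) j = (-1) ^ Suc r * (-1) ^ j * real (Suc r choose j) * fact (Suc r) / ((s - 1) * pochhammer s (Suc r))"
    unfolding beta_eq[of "Suc r" j] e2 e1 ..
  have 2: "\<beta> r j = (-1) ^ r * (-1) ^ j * real (r choose j) * fact r / pochhammer s (Suc r)"
    using beta_eq[of r j] by (simp add: s_def)
  have 3: "real r + 1 - real j - 1 / real k = - (s - 1)" by (simp add: s_def)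
  have 4: "(-1) ^ Suc r * y / ((s - 1) * p) * - (s - 1) = (-1) ^ r * y / p" for y p :: real
    using s1 by (cases "p = 0") (auto simp: field_simps)
  have "\<beta> (Suc r) j * (real r + 1 - real j - 1 / real k) =
        (-1) ^ r * ((-1) ^ j * real (Suc r choose j) * fact (Suc r)) / pochhammer s (Suc r)"
    unfolding 1 3 4[symmetric] by (simp only: mult.assoc)
  thus ?thesis unfolding 2 by (simp add: mult_ac)
qed

text \<open>At \<open>r = j\<close> the signs cancel and the Pochhammer product starts at
  \<open>1/k > 0\<close>. Each later quotient from \<open>beta_Suc\<close> is at least 1, because
  \<open>0 < r + 1 - j - 1/k \<le> r + 1\<close>.\<close>

lemma beta_mono:
  assumes "j \<le> r"
  shows "\<beta> r j > 0" "\<beta> r j \<le> \<beta> (Suc r) j"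
proof -
  have step: "\<beta> r j \<le> \<beta> (Suc r) j" if jr: "j \<le> r" and pos: "\<beta> r j > 0" for r
  proof -
    define x where "x = real r + 1 - real j - 1 / real k"
    have k1: "0 < 1 / real k" "1 / real k < 1" using k by auto
    have "real j \<le> real r" using jr by simp
    hence x: "0 < x" "x \<le> real r + 1" using k1 unfolding x_def by linarith+
    have c: "0 < real (r choose j)" using jr by simp
    have "r choose j \<le> Suc r choose j" by (cases j) auto
    hence c2: "real (r choose j) \<le> real (Suc r choose j)" by simp
    have "\<beta> r j * (x * real (r choose j)) \<le> \<beta> r j * ((real r + 1) * real (Suc r choose j))"
      using pos x c c2 by (intro mult_left_mono mult_mono) auto
    also have "\<dots> = \<beta> (Suc r) j * (x * real (r choose j))"
      using beta_Suc[OF jr] by (simp add: x_def mult.assoc)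
    finally show ?thesis using x c by simp
  qed
  have pos: "\<beta> r j > 0"
    using assms
  proof (induction r rule: dec_induct)
    case base
    have "pochhammer (1 / real k) (Suc j) > 0" using k by (intro pochhammer_pos) auto
    thus ?case by (simp add: beta_eq flip: power_add mult_2)
  next
    case (step n)
    thus ?case using step(1)  by (meson \<open>\<And>r. j \<le> r \<Longrightarrow> 0 < \<beta> r j \<Longrightarrow> \<beta> r j \<le> \<beta> (Suc r) j\<close> less_le_trans)
  qed
  show "\<beta> r j > 0" "\<beta> r j \<le> \<beta> (Suc r) j" using pos step[OF assms pos] by auto
qed

lemma PB_pos: "w > 0 \<Longrightarrow> PB r w > 0"
  unfolding PB_eq by (intro sum_pos mult_pos_pos beta_mono) auto

lemma PB_mono:
  assumes "w > 0"
  shows "PB r w \<le> PB (Suc r) w"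
proof -
  have "PB r w \<le> (\<Sum>j\<le>r. \<beta> (Suc r) j * w ^ j)"
    unfolding PB_eq using assms by (intro sum_mono mult_right_mono beta_mono) auto
  also have "\<dots> \<le> PB (Suc r) w"
    unfolding PB_eq using assms beta_mono(1)[of "Suc r" "Suc r"] by simp
  finally show ?thesis .
qed

text \<open>The sum over \<open>i\<close> gives \<open>2 ^ r\<close>, the sum over \<open>j\<close>
  with \<open>w \<le> 2\<close> gives \<open>3 ^ r\<close>, and dividing by the exponents costs at
  most \<open>k\<close>.\<close>

lemma PB_le:
  assumes "0 \<le> w" "w \<le> 2"
  shows "PB r w \<le> real k * 6 ^ r"
proof -
  have "PB r w \<le> (\<Sum>i\<le>r. \<Sum>j\<le>r. (real k * real (r choose i)) * (real (r choose j) * 2 ^ j))"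
    unfolding PB_def
  proof (intro sum_mono)
    fix i j
    have "\<bar>pade_coeff r i j\<bar> = real (r choose i) * real (r choose j) * (1 / \<bar>pade_exponent r i j\<bar>)"
      by (simp add: pade_coeff_def abs_mult)
    also have "\<dots> \<le> real (r choose i) * real (r choose j) * real k"
    proof (intro mult_left_mono)
      show "1 / \<bar>pade_exponent r i j\<bar> \<le> real k"
        using abs_pade_exponent_ge[of r i j] k pade_exponent_nonzero[of r i j] by (simp add: field_simps)
    qed auto
    finally have "\<bar>pade_coeff r i j\<bar> * w ^ j \<le> (real (r choose i) * real (r choose j) * real k) * 2 ^ j"
      using assms by (intro mult_mono power_mono) auto
    moreover have "pade_coeff r i j * w ^ j \<le> \<bar>pade_coeff r i j\<bar> * w ^ j" using assms by (intro mult_right_mono) auto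
    ultimately show "pade_coeff r i j * w ^ j \<le> (real k * real (r choose i)) * (real (r choose j) * 2 ^ j)"
      by (simp add: mult_ac)
  qed
  also have "\<dots> = (\<Sum>i\<le>r. real k * real (r choose i)) * (\<Sum>j\<le>r. real (r choose j) * 2 ^ j)"
    by (rule sum_product[symmetric])
  also have "(\<Sum>i\<le>r. real k * real (r choose i)) = real k * 2 ^ r"
  proof -
    have "(\<Sum>i\<le>r. real (r choose i)) = 2 ^ r" using choose_row_sum[of r] by (metis of_nat_sum of_nat_power of_nat_numeral)
    thus ?thesis by (simp flip: sum_distrib_left)
  qed
  also have "(\<Sum>j\<le>r. real (r choose j) * 2 ^ j) = 3 ^ r"
    using binomial_ring[of "2::real" 1 r] by simp
  also have "real k * 2 ^ r * 3 ^ r = real k * 6 ^ r" by (simp flip: power_mult_distrib)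
  finally show ?thesis .
qed

text \<open>Equal ratios \<open>PA / PB\<close> would force equal ratios \<open>PK / PB\<close>. But
  from \<open>r\<close> to \<open>Suc r\<close> the positive remainder \<open>PK\<close> shrinks by
  a factor of at most \<open>(w - 1)^2 < 1\<close>, while \<open>PB\<close> does not decrease. This
  replaces the usual determinant computation.\<close>

lemma pade_independent:
  assumes "1 < w" "w < 2"
  shows "PA r w * PB (Suc r) w \<noteq> PA (Suc r) w * PB r w"
proof
  assume "PA r w * PB (Suc r) w = PA (Suc r) w * PB r w"
  hence "PK r w * PB (Suc r) w = PK (Suc r) w * PB r w" by (simp add: PK_def algebra_simps)
  also have "\<dots> \<le> ((w - 1)\<^sup>2 * PK r w) * PB (Suc r) w"
    using assms PK_Suc_le[of w r] PB_mono[of w r] PB_pos[of w r] PK_pos[of w r]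
    by (intro mult_mono) auto
  also have "\<dots> < 1 * PK r w * PB (Suc r) w"
    using assms PK_pos[of w r] PB_pos[of w "Suc r"]
    by (intro mult_strict_right_mono) (auto simp: power_less_one_iff abs_square_less_1)
  finally show False by simp
qed

text \<open>The coefficients have denominators \<open>k * (i + j - r) + 1\<close>, of absolute value
  at most \<open>k * r + 1\<close>. Their lcm grows only exponentially in \<open>r\<close>, which
  the small remainder can afford.\<close>

definition PD :: "nat \<Rightarrow> nat" where "PD r = Lcm {1..k * r + 1}"

lemma PD_pade_coeff_Ints:
  assumes "i \<le> r" "j \<le> r"
  shows "real (PD r) * pade_coeff r i j \<in> \<int>"
proof -
  define m where "m = int k * (int i + int j - int r) + 1"
  have m: "pade_exponent r i j = real_of_int m / real k" by (simp add: pade_exponent_eq m_def)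
  have m0: "m \<noteq> 0" using pade_exponent_nonzero[of r i j] k by (auto simp: m)
  have "\<bar>m\<bar> \<le> int (k * r + 1)"
  proof -
    have "\<bar>int i + int j - int r\<bar> \<le> int r" using assms by linarith
    hence "int k * \<bar>int i + int j - int r\<bar> \<le> int k * int r" by (intro mult_left_mono) auto
    hence "\<bar>int k * (int i + int j - int r)\<bar> \<le> int k * int r" by (simp add: abs_mult)
    thus ?thesis unfolding m_def by simp
  qed
  hence "nat \<bar>m\<bar> \<in> {1..k * r + 1}" using m0 by (auto simp: nat_le_iff)
  hence "nat \<bar>m\<bar> dvd PD r" unfolding PD_def by (rule dvd_Lcm)
  hence "m dvd int (PD r)" by (metis abs_dvd_iff int_dvd_int_iff nat_abs_dvd_iff int_nat_eq nat_0_le abs_ge_zero)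
  then obtain l where l: "int (PD r) = m * l" by auto
  have "real (PD r) = real_of_int m * real_of_int l" using l by (metis of_int_mult of_int_of_nat_eq)
  hence "real (PD r) * pade_coeff r i j = real_of_int ((-1) ^ r * (int (r choose i) * int (r choose j) * (-1) ^ (i + j)) * int k * l)"
    using m0 k by (simp add: pade_coeff_def m)
  thus ?thesis by (metis Ints_of_int)
qed

lemma PD_le: "real (PD r) \<le> exp (4 * (real k * real r + 1))"
proof -
  have "PD r > 0" unfolding PD_def by (subst bot_nat_0.not_eq_extremum[symmetric], subst Lcm_0_iff) auto
  moreover have "ln (real (PD r)) \<le> 4 * real (k * r + 1)"
    unfolding PD_def by (rule order.trans[OF Lcm_atLeastAtMost_le psi_le])
  ultimately have "real (PD r) \<le> exp (4 * real (k * r + 1))" by (metis exp_le_cancel_iff exp_ln of_nat_0_less_iff)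
  thus ?thesis by (simp add: algebra_simps)
qed

lemma pade_Ints:
  fixes P Q :: nat
  assumes "Q > 0"
  shows "real (PD r) * real Q ^ r * PA r (real P / real Q) \<in> \<int>"
        "real (PD r) * real Q ^ r * PB r (real P / real Q) \<in> \<int>"
proof -
  have "real (PD r) * real Q ^ r * PA r (real P / real Q) =
    (\<Sum>i\<le>r. \<Sum>j\<le>r. (real (PD r) * pade_coeff r i j) * real (P ^ (r - i) * Q ^ i))"
    unfolding PA_def sum_distrib_left
  proof (intro sum.cong refl)
    fix i j assume i: "i \<in> {..r}"
    have "real Q ^ r = real Q ^ (r - i) * real Q ^ i" using i by (simp flip: power_add)
    thus "real (PD r) * real Q ^ r * (pade_coeff r i j * (real P / real Q) ^ (r - i)) =
          real (PD r) * pade_coeff r i j * real (P ^ (r - i) * Q ^ i)"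
      using assms by (simp add: power_divide)
  qed
  also have "\<dots> \<in> \<int>" by (intro Ints_sum Ints_mult PD_pade_coeff_Ints Ints_of_nat) auto
  finally show "real (PD r) * real Q ^ r * PA r (real P / real Q) \<in> \<int>" .
  have "real (PD r) * real Q ^ r * PB r (real P / real Q) =
    (\<Sum>i\<le>r. \<Sum>j\<le>r. (real (PD r) * pade_coeff r i j) * real (P ^ j * Q ^ (r - j)))"
    unfolding PB_def sum_distrib_left
  proof (intro sum.cong refl)
    fix i j assume j: "j \<in> {..r}"
    have "real Q ^ r = real Q ^ j * real Q ^ (r - j)" using j by (simp flip: power_add)
    thus "real (PD r) * real Q ^ r * (pade_coeff r i j * (real P / real Q) ^ j) =
          real (PD r) * pade_coeff r i j * real (P ^ j * Q ^ (r - j))"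
      using assms by (simp add: power_divide)
  qed
  also have "\<dots> \<in> \<int>" by (intro Ints_sum Ints_mult PD_pade_coeff_Ints Ints_of_nat) auto
  finally show "real (PD r) * real Q ^ r * PB r (real P / real Q) \<in> \<int>" .
qed

text \<open>
  The bounded quantity dominates \<open>D Q\<^sup>\<rho> (u y PA - v x PB)\<close> at \<open>w = P / Q\<close>, an integer that vanishes for at
  most one of two consecutive indices.
\<close>

lemma thue_siegel_principle:
  fixes P Q x y u v :: nat and \<theta> w' :: real
  assumes pos: "Q > 0" "x > 0" "y > 0" "u > 0" "v > 0" "\<theta> > 0"
    and w: "Q < P" "P < 2 * Q" and w': "1 \<le> w'" "w' \<le> 2"
    and xy: "(real x / real y) ^ k = \<theta> * (real P / real Q)"
    and uv: "(real u / real v) ^ k = \<theta> * w'"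
  obtains \<rho> where "\<rho> \<in> {r, Suc r}"
    "1 \<le> real v * real x * real (PD \<rho>) * real Q ^ \<rho> *
          ((w' - 1) * (real k * 6 ^ \<rho>) + 2 * (real P / real Q - 1) ^ (2 * \<rho> + 1))"
proof -
  define w where "w = real P / real Q"
  have w12: "1 < w" "w < 2" using pos w by (auto simp: w_def field_simps simp flip: of_nat_mult)
  have "real u * real y * PA r w \<noteq> real v * real x * PB r w \<or>
        real u * real y * PA (Suc r) w \<noteq> real v * real x * PB (Suc r) w"
  proof (rule ccontr)
    assume "\<not> ?thesis"
    hence 1: "real u * real y * PA r w = real v * real x * PB r w"
      and 2: "real u * real y * PA (Suc r) w = real v * real x * PB (Suc r) w" by auto
    have "(real u * real y) * (PA r w * PB (Suc r) w) = (real u * real y * PA r w) * PB (Suc r) w" by simp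
    also have "\<dots> = (real u * real y * PA (Suc r) w) * PB r w" unfolding 1 2 by simp
    finally have "(real u * real y) * (PA r w * PB (Suc r) w) = (real u * real y) * (PA (Suc r) w * PB r w)" by simp
    hence "PA r w * PB (Suc r) w = PA (Suc r) w * PB r w" using pos by simp
    thus False using pade_independent[OF w12] by blast
  qed
  then obtain \<rho> where \<rho>: "\<rho> \<in> {r, Suc r}" "real u * real y * PA \<rho> w \<noteq> real v * real x * PB \<rho> w" by auto
  define D where "D = real (PD \<rho>) * real Q ^ \<rho>"
  have PDpos: "PD \<rho> > 0" unfolding PD_def by (subst bot_nat_0.not_eq_extremum[symmetric], subst Lcm_0_iff) auto
  have Dpos: "D > 0" using PDpos pos by (simp add: D_def)
  \<comment> \<open>An integer by \<open>pade_Ints\<close> and nonzero by the choice of \<rho>, so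
    at least 1 in absolute value.\<close>
  define E where "E = real (u * y) * (D * PA \<rho> w) - real (v * x) * (D * PB \<rho> w)"
  have "E \<in> \<int>" unfolding E_def D_def w_def
    by (intro Ints_diff Ints_mult[OF Ints_of_nat] pade_Ints pos)
  moreover have "E \<noteq> 0"
  proof -
    have "E = D * (real u * real y * PA \<rho> w - real v * real x * PB \<rho> w)" by (simp add: E_def algebra_simps)
    thus ?thesis using \<rho>(2) Dpos by simp
  qed
  ultimately have E1: "\<bar>E\<bar> \<ge> 1" by (metis Ints_nonzero_abs_ge1)
  \<comment> \<open>The quotient of \<open>u / v\<close> by \<open>x / y\<close>, hence the
    \<open>k\<close>-th root of \<open>w' / w\<close>: the unknown \<open>\<theta>\<close> drops
    out. With \<open>z * s = s'\<close> the form \<open>E\<close> splits into one part small with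
    \<open>w' - 1\<close> and one small with the Pade remainder.\<close>
  define z where "z = (real u * real y) / (real v * real x)"
  define s where "s = w powr (1 / real k)"
  define s' where "s' = w' powr (1 / real k)"
  have k0: "real k > 0" using k by simp
  have s1: "s \<ge> 1" unfolding s_def using w12 by (intro ge_one_powr_ge_zero) auto
  have s'1: "s' \<ge> 1" unfolding s'_def using w' by (intro ge_one_powr_ge_zero) auto
  have s'2: "s' \<le> w'"
  proof -
    have "w' powr (1 / real k) \<le> w' powr 1" using w' k by (intro powr_mono) auto
    thus ?thesis using w' by (simp add: s'_def)
  qed
  have "(z * s) ^ k = s' ^ k"
  proof -
    have "s ^ k = w" "s' ^ k = w'" unfolding s_def s'_def using w12 w' k
      by (simp_all add: powr_realpow[symmetric] powr_powr)
    moreover have "z ^ k = w' / w"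
    proof -
      have "z = (real u / real v) / (real x / real y)" by (simp add: z_def)
      hence "z ^ k = (real u / real v) ^ k / (real x / real y) ^ k" by (simp only: power_divide)
      also have "\<dots> = w' / w" unfolding uv xy using pos by (simp add: w_def)
      finally show ?thesis .
    qed
    ultimately show ?thesis using w12 by (simp add: power_mult_distrib)
  qed
  hence zs: "z * s = s'" 
    using k pos s1 s'1 by (intro power_eq_imp_eq_base[of "z * s" k s']) (auto simp: z_def)
  have "real u * real y = z * (real v * real x)" using pos by (simp add: z_def)
  hence "E = real v * real x * D * (z * PA \<rho> w - PB \<rho> w)" by (simp add: E_def algebra_simps)
  also have "z * PA \<rho> w - PB \<rho> w = (s' - 1) * PB \<rho> w - z * PK \<rho> w"
    unfolding PK_def s_def[symmetric] zs[symmetric] by (simp add: algebra_simps)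
  finally have E_eq: "E = real v * real x * D * ((s' - 1) * PB \<rho> w - z * PK \<rho> w)" .
  have z2: "0 < z" "z \<le> 2"
  proof -
    show "0 < z" using pos by (simp add: z_def)
    hence "z * 1 \<le> z * s" using s1 by (intro mult_left_mono) auto
    thus "z \<le> 2" using zs s'2 w' by simp
  qed
  have "\<bar>(s' - 1) * PB \<rho> w - z * PK \<rho> w\<bar> \<le> (s' - 1) * PB \<rho> w + z * PK \<rho> w"
    using s'1 PB_pos[of w \<rho>] PK_pos[of w \<rho>] z2 w12 by (simp add: abs_le_iff)
  also have "\<dots> \<le> (w' - 1) * (real k * 6 ^ \<rho>) + 2 * (w - 1) ^ (2 * \<rho> + 1)"
    using s'1 s'2 PB_pos[of w \<rho>] PK_pos[of w \<rho>] PB_le[of w \<rho>] PK_le[of w \<rho>] z2 w12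
    by (intro add_mono mult_mono) auto
  finally have "\<bar>E\<bar> \<le> real v * real x * D * ((w' - 1) * (real k * 6 ^ \<rho>) + 2 * (w - 1) ^ (2 * \<rho> + 1))"
    unfolding E_eq abs_mult using Dpos by (simp add: mult_left_mono)
  thus ?thesis using E1 \<rho>(1) by (intro that[of \<rho>]) (auto simp: D_def w_def mult_ac)
qed

end

section \<open>Large elements of a Diophantine tuple\<close>

text \<open>The integer root may be negative for even \<open>k\<close>; as the power is positive,
  its absolute value serves as well.\<close>

lemma property_D_root:
  assumes D: "property_D k n S" and ab: "a \<in> S" "b \<in> S" "a \<noteq> b" and pos: "real a * real b + real_of_int n > 0" and k: "k > 0"
  obtains x :: nat where "x > 0" "real x ^ k = real a * real b + real_of_int n"
proof -
  have "is_nth_power k (int a * int b + n)" using D ab unfolding property_D_def by blast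
  then obtain y where y: "int a * int b + n = y ^ k" by (auto simp: is_nth_power_def)
  have y': "real_of_int y ^ k = real a * real b + real_of_int n"
    using arg_cong[OF y, of real_of_int] by simp
  have "real (nat \<bar>y\<bar>) ^ k = \<bar>real_of_int y ^ k\<bar>" by (simp add: power_abs)
  also have "\<dots> = real a * real b + real_of_int n" using pos unfolding y' by simp
  finally have x: "real (nat \<bar>y\<bar>) ^ k = real a * real b + real_of_int n" .
  moreover have "nat \<bar>y\<bar> > 0" using y' pos k by (cases "y = 0") (auto simp: power_0_left)
  ultimately show ?thesis using that by blast
qed

text \<open>Both products of roots have \<open>k\<close>-th power at least
  \<open>a b c d / 4\<close>. As \<open>2 * k \<le> 3 * (k - 1)\<close>, the distance of the powers
  of distinct integers gives \<open>(a b c d / 4)^2 \<le> (N b d)^3\<close>. With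
  \<open>N^3 \<le> a\<close> there remains \<open>a c^2 \<le> 16 b d\<close>, and
  \<open>b < c\<close> finishes.\<close>

lemma gap_principle:
  assumes k: "k \<ge> 3" and D: "property_D k n S" and S: "a \<in> S" "b \<in> S" "c \<in> S" "d \<in> S"
    and abcd: "a < b" "b < c" "c < d" and n: "\<bar>real_of_int n\<bar> \<ge> 2" and a: "\<bar>real_of_int n\<bar> ^ 3 \<le> real a"
  shows "real a * real c \<le> 16 * real d"
proof -
  define N where "N = \<bar>real_of_int n\<bar>"
  have N: "N \<ge> 2" using n by (simp add: N_def)
  have "N * 4 \<le> N * (N * N)" using N mult_mono[of 2 N 2 N] by (intro mult_left_mono) auto
  hence aN: "4 * N \<le> real a" "N ^ 3 \<le> real a" using a by (auto simp: N_def power3_eq_cube mult_ac)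
  have r: "0 < real a" "real a < real b" "real b < real c" "real c < real d" using abcd aN N by auto
  have half: "real x * real y / 2 \<le> real x * real y + real_of_int n" if "real a \<le> real x" "real a \<le> real y" for x y
  proof -
    have "(2 * N) * 1 \<le> real x * real y" using that aN N by (intro mult_mono) auto
    thus ?thesis unfolding N_def by linarith
  qed
  have pos: "real x * real y + real_of_int n > 0" if "real a \<le> real x" "real a \<le> real y" for x y
  proof -
    have "real x * real y > 0" using that r by (intro mult_pos_pos) auto
    thus ?thesis using half[OF that] by linarith
  qed
  obtain xac where xac: "xac > 0" "real xac ^ k = real a * real c + real_of_int n"
    using property_D_root[OF D S(1) S(3)] pos[of a c] abcd k by auto
  obtain xbd where xbd: "xbd > 0" "real xbd ^ k = real b * real d + real_of_int n"
    using property_D_root[OF D S(2) S(4)] pos[of b d] abcd k by auto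
  obtain xad where xad: "xad > 0" "real xad ^ k = real a * real d + real_of_int n"
    using property_D_root[OF D S(1) S(4)] pos[of a d] abcd k by auto
  obtain xbc where xbc: "xbc > 0" "real xbc ^ k = real b * real c + real_of_int n"
    using property_D_root[OF D S(2) S(3)] pos[of b c] abcd k by auto
  define X Y where "X = xac * xbd" and "Y = xad * xbc"
  have X: "real X ^ k = (real a * real c + real_of_int n) * (real b * real d + real_of_int n)"
    by (simp add: X_def power_mult_distrib xac xbd)
  have Y: "real Y ^ k = (real a * real d + real_of_int n) * (real b * real c + real_of_int n)"
    by (simp add: Y_def power_mult_distrib xad xbc)
  have diff: "real X ^ k - real Y ^ k = real_of_int n * ((real b - real a) * (real d - real c))"
    unfolding X Y by (simp add: algebra_simps)
  have diff0: "real X ^ k - real Y ^ k \<noteq> 0" unfolding diff using N r by (auto simp: N_def)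
  hence XY: "X \<noteq> Y" by auto
  define m where "m = min X Y"
  have m0: "m > 0" using xac xbd xad xbc by (simp add: m_def X_def Y_def)
  \<comment> \<open>\<open>X\<close> and \<open>Y\<close> are distinct integers, so the larger is at
    least \<open>m + 1\<close>, and \<open>(m + 1) * m ^ (k - 1)\<close> already exceeds
    \<open>m ^ k\<close> by the claimed amount.\<close>
  have key: "real m ^ (k - 1) \<le> \<bar>real X ^ k - real Y ^ k\<bar>"
  proof -
    have *: "real m ^ (k - 1) \<le> real M ^ k - real m ^ k" if "m < M" for M
    proof -
      have "real m ^ k + real m ^ (k - 1) = (real m + 1) * real m ^ (k - 1)"
        using k by (simp add: algebra_simps power_eq_if)
      also have "\<dots> \<le> real M * real M ^ (k - 1)"
        using that by (intro mult_mono power_mono) auto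
      also have "\<dots> = real M ^ k" using k by (simp add: power_eq_if)
      finally show ?thesis by simp
    qed
    show ?thesis using XY *[of X] *[of Y] unfolding m_def by (cases "X < Y") (auto simp: min_def)
  qed
  define V where "V = real a * real b * real c * real d / 4"
  have Vm: "V \<le> real m ^ k"
  proof -
    have "V = (real a * real c / 2) * (real b * real d / 2)" by (simp add: V_def)
    also have "\<dots> \<le> real X ^ k" unfolding X using abcd half pos[of a c] by (intro mult_mono) auto
    finally have 1: "V \<le> real X ^ k" .
    have "V = (real a * real d / 2) * (real b * real c / 2)" by (simp add: V_def)
    also have "\<dots> \<le> real Y ^ k" unfolding Y using abcd half pos[of a d] by (intro mult_mono) auto
    finally show ?thesis using 1 by (simp add: m_def min_def)
  qed
  have "real m ^ (k - 1) \<le> N * ((real b - real a) * (real d - real c))"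
    using key r unfolding diff by (simp add: abs_mult N_def)
  also have "\<dots> \<le> N * (real b * real d)" using r N by (intro mult_left_mono mult_mono) auto
  finally have "(real m ^ (k - 1)) ^ 3 \<le> (N * (real b * real d)) ^ 3" by (intro power_mono) auto
  moreover have "V\<^sup>2 \<le> (real m ^ (k - 1)) ^ 3"
  proof -
    have "V\<^sup>2 \<le> (real m ^ k)\<^sup>2" using Vm r by (intro power_mono) (auto simp: V_def)
    also have "\<dots> = real m ^ (k * 2)" by (simp add: power_mult)
    also have "\<dots> \<le> real m ^ ((k - 1) * 3)" using m0 k by (intro power_increasing) auto
    finally show ?thesis by (simp add: power_mult)
  qed
  ultimately have "V\<^sup>2 \<le> (N * (real b * real d)) ^ 3" by linarith
  also have "\<dots> = N ^ 3 * (real b * real d) * (real b * real d)\<^sup>2" by (simp add: power_mult_distrib power2_eq_square power3_eq_cube)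
  also have "\<dots> \<le> real a * (real b * real d) * (real b * real d)\<^sup>2"
    using aN r by (intro mult_right_mono) auto
  finally have "(real b * real d)\<^sup>2 * (real a * (real a * (real c)\<^sup>2)) \<le> (real b * real d)\<^sup>2 * (real a * (16 * (real b * real d)))"
    by (simp add: V_def power2_eq_square field_simps)
  hence "real a * (real c)\<^sup>2 \<le> 16 * (real b * real d)" using r by (simp only: mult_le_cancel_left_pos zero_less_power mult_pos_pos)
  moreover have "real b * (real a * real c) \<le> real a * (real c)\<^sup>2"
    using r mult_left_mono[of "real b" "real c" "real a * real c"] by (simp add: power2_eq_square mult_ac)
  ultimately have "real b * (real a * real c) \<le> real b * (16 * real d)" by simp
  thus ?thesis using r by simp
qed

text \<open>Logarithmic form of the cubed final inequality, with \<open>- ld\<close> and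
  \<open>- (2 * \<rho> + 1) * lc\<close> for the two possible error terms. The factor 40 makes
  \<open>4 * lb\<close> at most a tenth of \<open>lc\<close>. The tightest case is the first claim
  with \<open>\<rho> = r + 1\<close>; it asks for \<open>r \<ge> 4\<close>, and
  \<open>9 = 2 * 4 + 1\<close> is the exponent demanded of \<open>d\<close>.\<close>

lemma log_size_contradiction:
  assumes lac: "0 < lb" and lbc: "40 * lb \<le> lc"
    and r: "r \<ge> 4" "(2 * r + 1) * lc \<le> ld" "ld \<le> (2 * r + 3) * lc"
    and \<rho>: "\<rho> = r \<or> \<rho> = r + 1"
  shows "4 * lb + lc + ld + 3 * (lb + \<rho> * (4 * lb + lc) - ld) < (0::real)"
    "4 * lb + lc + ld + 3 * (lb + \<rho> * (4 * lb + lc) - (2 * \<rho> + 1) * lc) < (0::real)"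
proof -
  have lc0: "lc > 0" using lac lbc by linarith
  have "\<rho> > 0" using r \<rho> by auto
  hence 1: "\<rho> * (4 * lb + lc) \<le> \<rho> * (11 / 10 * lc)" using lbc by (intro mult_left_mono) auto
  have rl: "r * lc \<ge> 4 * lc" using r lc0 by (intro mult_right_mono) auto
  have 2: "\<rho> * lc = r * lc \<or> \<rho> * lc = r * lc + lc" using \<rho> by (auto simp: algebra_simps)
  have 3: "(2 * r + 1) * lc = 2 * (r * lc) + lc" "(2 * r + 3) * lc = 2 * (r * lc) + 3 * lc"
    "(2 * \<rho> + 1) * lc = 2 * (\<rho> * lc) + lc" "\<rho> * (11 / 10 * lc) = 11 / 10 * (\<rho> * lc)"
    by (simp_all add: algebra_simps)
  show "4 * lb + lc + ld + 3 * (lb + \<rho> * (4 * lb + lc) - ld) < 0"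
    using 1 rl 2 r(2,3) lbc lac lc0 unfolding 3 by argo
  show "4 * lb + lc + ld + 3 * (lb + \<rho> * (4 * lb + lc) - (2 * \<rho> + 1) * lc) < 0"
    using 1 rl 2 r(2,3) lbc lac lc0 unfolding 3 by argo
qed

text \<open>Collects \<open>2 * k\<close>, \<open>6\<close> and the growth rate
  \<open>exp (8 * k)\<close> of \<open>PD\<close>, so that the constants of the Thue-Siegel bound
  are at most its \<rho>-th power, and at most \<open>b ^ \<rho>\<close> once
  \<open>\<bar>n\<bar>\<close> exceeds it.\<close>

definition pade_const :: "nat \<Rightarrow> real" where "pade_const k = 12 * real k * exp (8 * real k)"

lemma pade_constant_le:
  assumes "k \<ge> 2" "\<rho> \<ge> 1"
  shows "2 * real k * 6 ^ \<rho> * real (PD k \<rho>) \<le> pade_const k ^ \<rho>"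
proof -
  have "2 * real k \<le> (2 * real k) ^ \<rho>" using assms by (intro self_le_power) auto
  moreover have "real (PD k \<rho>) \<le> exp (8 * real k) ^ \<rho>"
  proof -
    have "real (PD k \<rho>) \<le> exp (4 * (real k * real \<rho> + 1))" by (rule PD_le) (use assms in auto)
    also have "1 \<le> real k * real \<rho>" using assms by (metis One_nat_def le_trans mult_le_mono nat_mult_1 of_nat_1 of_nat_le_iff of_nat_mult one_le_numeral)
    hence "exp (4 * (real k * real \<rho> + 1)) \<le> exp (real \<rho> * (8 * real k))" by (simp add: algebra_simps)
    finally show ?thesis by (simp add: exp_of_nat_mult)
  qed
  ultimately have "(2 * real k) * 6 ^ \<rho> * real (PD k \<rho>) \<le> (2 * real k) ^ \<rho> * 6 ^ \<rho> * exp (8 * real k) ^ \<rho>"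
    by (intro mult_mono) auto
  also have "\<dots> = (2 * real k * 6 * exp (8 * real k)) ^ \<rho>" by (simp only: power_mult_distrib)
  also have "2 * real k * 6 * exp (8 * real k) = pade_const k" by (simp add: pade_const_def)
  finally show ?thesis by simp
qed

text \<open>With \<open>\<theta> = s / t\<close>, the roots of \<open>s * c + n\<close> and
  \<open>t * c + n\<close> approximate the \<open>k\<close>-th root of \<open>\<theta>\<close> with
  \<open>P / Q - 1 \<le> 1 / c\<close>, those belonging to \<open>d\<close> with
  \<open>w' - 1 \<le> 1 / d\<close>. The first pair feeds the Pade construction; the second is too
  good for the lower bound of \<open>thue_siegel_principle\<close>.\<close>

lemma no_very_large_element:
  assumes k: "k \<ge> 3" and D: "property_D k n S" and S: "a \<in> S" "b \<in> S" "c \<in> S" "d \<in> S"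
    and ab: "a < b" and n: "\<bar>real_of_int n\<bar> \<ge> 2" "\<bar>real_of_int n\<bar> \<ge> pade_const k" and a: "\<bar>real_of_int n\<bar> ^ 3 \<le> real a"
    and bc: "real b ^ 40 \<le> real c" and cd: "real c ^ 9 \<le> real d"
  shows False
proof -
  define N where "N = \<bar>real_of_int n\<bar>"
  have N: "N \<ge> 2" "N \<ge> pade_const k" using n by (auto simp: N_def)
  have "N * 4 \<le> N * (N * N)" using N mult_mono[of 2 N 2 N] by (intro mult_left_mono) auto
  hence aN: "4 * N \<le> real a" using a by (auto simp: N_def power3_eq_cube mult_ac)
  have ab': "0 < real a" "real a < real b" using ab aN N by auto
  have b2: "real b \<ge> 2" "real b \<ge> N" using ab' aN N by auto
  have "real b ^ 2 \<le> real b ^ 40" using b2 by (intro power_increasing) auto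
  moreover have "real b * 2 \<le> real b * real b" using b2 by (intro mult_left_mono) auto
  ultimately have bc': "real b < real c" using bc b2(1) unfolding power2_eq_square by linarith
  have "real c ^ 2 \<le> real c ^ 9" using b2 bc' by (intro power_increasing) auto
  moreover have "real c * 2 \<le> real c * real c" using b2 bc' by (intro mult_left_mono) auto
  ultimately have cd': "real c < real d" using cd b2(1) bc' unfolding power2_eq_square by linarith
  define lb lc ld where "lb = ln (real b)" and "lc = ln (real c)" and "ld = ln (real d)"
  have lb0: "lb > 0" using b2 by (simp add: lb_def)
  have lbc: "40 * lb \<le> lc"
  proof -
    have "ln (real b ^ 40) \<le> ln (real c)" using bc b2 bc' by (subst ln_le_cancel_iff) auto
    thus ?thesis using b2 by (simp add: lb_def lc_def ln_realpow)
  qed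
  have lcd: "9 * lc \<le> ld"
  proof -
    have "ln (real c ^ 9) \<le> ln (real d)" using cd b2 bc' cd' by (subst ln_le_cancel_iff) auto
    thus ?thesis using b2 bc' by (simp add: ld_def lc_def ln_realpow)
  qed
  have lc0: "lc > 0" using lb0 lbc by linarith
  \<comment> \<open>The order with \<open>(2 * r + 1) * lc \<le> ld < (2 * r + 3) * lc\<close>: it
    brings the Pade error \<open>c\<close> to the power \<open>- (2 * r + 1)\<close> close to the
    other error \<open>1 / d\<close>.\<close>
  define r where "r = nat \<lfloor>(ld / lc - 1) / 2\<rfloor>"
  have "ld / lc \<ge> 9" using lcd lc0 by (simp add: field_simps)
  hence fl: "4 \<le> \<lfloor>(ld / lc - 1) / 2\<rfloor>" by (simp add: le_floor_iff)
  hence "real r = real_of_int \<lfloor>(ld / lc - 1) / 2\<rfloor>" by (simp add: r_def)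
  hence r: "real r \<ge> 4" "real r \<le> (ld / lc - 1) / 2" "(ld / lc - 1) / 2 < real r + 1"
    using fl by linarith+
  have r2: "(2 * real r + 1) * lc \<le> ld" "ld \<le> (2 * real r + 3) * lc"
    using r(2,3) lc0 by (auto simp: field_simps)
  have half: "real x * real y / 2 \<le> real x * real y + real_of_int n" "real x * real y + real_of_int n \<le> 2 * (real x * real y)"
    if "real a \<le> real x" "real a \<le> real y" for x y
  proof -
    have "(2 * N) * 1 \<le> real x * real y" using that aN N by (intro mult_mono) auto
    thus "real x * real y / 2 \<le> real x * real y + real_of_int n" "real x * real y + real_of_int n \<le> 2 * (real x * real y)"
      unfolding N_def by linarith+
  qed
  have pos: "real x * real y + real_of_int n > 0" if "real a \<le> real x" "real a \<le> real y" for x y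
  proof -
    have "real x * real y > 0" using that ab' by (intro mult_pos_pos) auto
    thus ?thesis using half[OF that] by linarith
  qed
  have neq: "a \<noteq> c" "b \<noteq> c" "a \<noteq> d" "b \<noteq> d" using ab' bc' cd' by auto
  define p where "p x y = nat (int x * int y + n)" for x y
  have p: "real (p x y) = real x * real y + real_of_int n" if "real a \<le> real x" "real a \<le> real y" for x y
  proof -
    have "real_of_int (int x * int y + n) > 0" using pos[OF that] by simp
    hence "int x * int y + n > 0" by linarith
    hence "real (p x y) = real_of_int (int x * int y + n)" unfolding p_def by simp
    thus ?thesis by simp
  qed
  \<comment> \<open>The pair \<open>s, t\<close> is \<open>a, b\<close> in the order that makes
    \<open>n * (t - s)\<close> positive. Both ratios \<open>P / Q\<close> and \<open>w'\<close> then
    exceed 1, where the Pade estimates hold.\<close>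
  have contra: False
    if st: "(s = a \<and> t = b) \<or> (s = b \<and> t = a)" and ns: "real_of_int n * (real t - real s) = N * (real b - real a)" for s t
  proof -
    have sts: "s \<in> S" "t \<in> S" "real a \<le> real s" "real a \<le> real t" "real s \<le> real b" "real t \<le> real b" "real s * real t = real a * real b"
      "s \<noteq> c" "t \<noteq> c" "s \<noteq> d" "t \<noteq> d"
      using st S ab' neq by auto
    have acd: "real a \<le> real c" "real a \<le> real d" using ab' bc' cd' by auto
    obtain x where x: "x > 0" "real x ^ k = real s * real c + real_of_int n"
      using property_D_root[OF D sts(1) S(3)] pos[of s c] sts acd k by auto
    obtain y where y: "y > 0" "real y ^ k = real t * real c + real_of_int n"
      using property_D_root[OF D sts(2) S(3)] pos[of t c] sts acd k by auto
    obtain u where u: "u > 0" "real u ^ k = real s * real d + real_of_int n"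
      using property_D_root[OF D sts(1) S(4)] pos[of s d] sts acd k by auto
    obtain v where v: "v > 0" "real v ^ k = real t * real d + real_of_int n"
      using property_D_root[OF D sts(2) S(4)] pos[of t d] sts acd k by auto
    define P Q where "P = t * p s c" and "Q = s * p t c"
    have P: "real P = real t * (real s * real c + real_of_int n)" and Q: "real Q = real s * (real t * real c + real_of_int n)"
      unfolding P_def Q_def of_nat_mult by (simp_all only: p[OF sts(3) acd(1)] p[OF sts(4) acd(1)])
    define w' where "w' = (real t * (real s * real d + real_of_int n)) / (real s * (real t * real d + real_of_int n))"
    define Q' where "Q' = real s * (real t * real d + real_of_int n)"
    have Qd: "real Q \<ge> real a * real b * real c / 2" "Q' \<ge> real a * real b * real d / 2"
      using mult_left_mono[OF half(1)[OF sts(4) acd(1)], of "real s"] mult_left_mono[OF half(1)[OF sts(4) acd(2)], of "real s"]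
      unfolding Q Q'_def sts(7)[symmetric] by (simp_all add: mult.assoc)
    have Q0: "real Q > 0" "Q' > 0"
    proof -
      have "0 < real a * real b * real c / 2" "0 < real a * real b * real d / 2" using ab' bc' cd' by simp_all
      thus "real Q > 0" "Q' > 0" using Qd by linarith+
    qed
    have PQ: "real P - real Q = N * (real b - real a)" unfolding P Q ns[symmetric] by (simp add: algebra_simps)
    have w_eq: "real P / real Q - 1 = N * (real b - real a) / real Q"
      using Q0 PQ by (simp add: field_simps)
    have w'_eq: "w' - 1 = N * (real b - real a) / Q'"
      using Q0 unfolding ns[symmetric] w'_def Q'_def[symmetric] by (simp add: field_simps) (simp add: Q'_def algebra_simps)
    \<comment> \<open>As \<open>N \<le> a / 2\<close>, the numerator is at most
      \<open>a * b / 2\<close>; the denominators \<open>Q\<close> and \<open>Q'\<close> are at least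
      \<open>a * b / 2\<close> times \<open>c\<close> or \<open>d\<close>.\<close>
    have small: "N * (real b - real a) / q \<le> 1 / e" if "q \<ge> real a * real b * e / 2" "e > 0" for q e
    proof -
      have "0 < real a * real b * e / 2" using ab' that by simp
      hence q0: "q > 0" using that(1) by linarith
      have "N * (real b - real a) * e \<le> (real a / 2 * real b) * e"
        using ab' aN that N by (intro mult_right_mono mult_mono) auto
      also have "\<dots> \<le> q" using that by simp
      finally show ?thesis using q0 that by (simp add: field_simps)
    qed
    have w1: "real P / real Q - 1 \<le> 1 / real c" "0 < real P / real Q - 1"
      unfolding w_eq using small[OF Qd(1)] Q0 ab' bc' N by auto
    have w'1: "w' - 1 \<le> 1 / real d" "0 < w' - 1"
      unfolding w'_eq using small[OF Qd(2)] Q0 ab' bc' cd' N by auto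
    have c1: "1 / real c < 1" "1 / real d < 1" using b2 bc' cd' by auto
    have k2: "k \<ge> 2" using k by simp
    obtain \<rho> where \<rho>: "\<rho> \<in> {r, Suc r}"
      "1 \<le> real v * real x * real (PD k \<rho>) * real Q ^ \<rho> *
          ((w' - 1) * (real k * 6 ^ \<rho>) + 2 * (real P / real Q - 1) ^ (2 * \<rho> + 1))"
    proof (rule thue_siegel_principle[OF k2, of Q x y u v "real s / real t" P w' r])
      show "Q > 0" using Q0 by simp
      show "0 < real s / real t" using sts ab' by simp
      show "Q < P" using w1(2) Q0 by (simp add: field_simps)
      have "real P / real Q < 2" using w1(1) c1(1) by linarith
      hence "real P < real (2 * Q)" using Q0 by (simp add: field_simps)
      thus "P < 2 * Q" by (simp only: of_nat_less_iff)
      show "1 \<le> w'" "w' \<le> 2" using w'1 c1 by auto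
      show "(real x / real y) ^ k = real s / real t * (real P / real Q)"
        using sts ab' Q0 by (simp add: power_divide x y P Q)
      show "(real u / real v) ^ k = real s / real t * w'"
        using sts ab' Q0 by (simp add: power_divide u v w'_def)
    qed (use x y u v in auto)
    have \<rho>4: "\<rho> \<ge> 1" using \<rho>(1) r(1) by auto
    define U where "U = (real b ^ 4 * real c) ^ \<rho>"
    define M where "M = max (1 / real d) ((1 / real c) ^ (2 * \<rho> + 1))"
    have M0: "M > 0" using bc' cd' by (auto simp: M_def less_max_iff_disj)
    have "1 \<le> real v * real x * real (PD k \<rho>) * real Q ^ \<rho> * (2 * real k * 6 ^ \<rho> * M)"
    proof -
      have "(w' - 1) * (real k * 6 ^ \<rho>) \<le> M * (real k * 6 ^ \<rho>)"
        using w'1 by (intro mult_right_mono) (auto simp: M_def)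
      moreover have "2 * (real P / real Q - 1) ^ (2 * \<rho> + 1) \<le> (real k * 6 ^ \<rho>) * M"
      proof (intro mult_mono)
        have "2 * 1 \<le> real k * 6 ^ \<rho>" using k by (intro mult_mono) auto
        thus "2 \<le> real k * 6 ^ \<rho>" by simp
        have "(real P / real Q - 1) ^ (2 * \<rho> + 1) \<le> (1 / real c) ^ (2 * \<rho> + 1)"
          using w1 by (intro power_mono) auto
        thus "(real P / real Q - 1) ^ (2 * \<rho> + 1) \<le> M" by (simp add: M_def)
      qed (use w1 in auto)
      ultimately have "(w' - 1) * (real k * 6 ^ \<rho>) + 2 * (real P / real Q - 1) ^ (2 * \<rho> + 1) \<le> 2 * real k * 6 ^ \<rho> * M"
        by (simp add: algebra_simps)
      thus ?thesis using \<rho>(2) by (elim order.trans) (intro mult_left_mono, auto)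
    qed
    also have "\<dots> = real v * real x * real Q ^ \<rho> * (2 * real k * 6 ^ \<rho> * real (PD k \<rho>)) * M" by simp
    also have "\<dots> \<le> real v * real x * (real b ^ 3 * real c) ^ \<rho> * (real b ^ \<rho>) * M"
    proof -
      have "real Q \<le> real s * (2 * (real t * real c))"
        unfolding Q using sts acd half(2)[of t c] by (intro mult_left_mono) auto
      also have "\<dots> = 2 * (real a * real b * real c)" using sts(7) by simp
      also have "\<dots> \<le> real b * (real b * real b * real c)"
        using ab' b2 bc' by (intro mult_mono) auto
      finally have Q3: "real Q \<le> real b ^ 3 * real c" by (simp add: power3_eq_cube mult_ac)
      have "pade_const k \<ge> 0" by (simp add: pade_const_def)
      hence "2 * real k * 6 ^ \<rho> * real (PD k \<rho>) \<le> real b ^ \<rho>"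
        using N b2 by (intro order.trans[OF pade_constant_le[OF k2 \<rho>4]] power_mono) auto
      thus ?thesis using Q3 M0 by (intro mult_mono power_mono) auto
    qed
    also have "\<dots> = real v * real x * U * M"
    proof -
      have "(real b ^ 3 * real c) ^ \<rho> * real b ^ \<rho> = (real b ^ 3 * real c * real b) ^ \<rho>"
        by (simp only: power_mult_distrib)
      also have "real b ^ 3 * real c * real b = real b ^ 4 * real c" by (simp add: numeral_eq_Suc)
      finally show ?thesis by (simp only: U_def mult.assoc)
    qed
    finally have main: "1 \<le> real v * real x * U * M" .
    \<comment> \<open>\<open>k \<ge> 3\<close> bounds the cube of a root by its \<open>k\<close>-th
      power. The inequality \<open>main\<close> is then cubed, so that only powers of
      \<open>b\<close>, \<open>c\<close>, \<open>d\<close> remain and logarithms can be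
      compared.\<close>
    have cube: "real z ^ 3 \<le> real b ^ 2 * real e"
      if "z > 0" "real z ^ k = real f * real e + real_of_int n" "real a \<le> real f" "real f \<le> real b" "real a \<le> real e" for z e f
    proof -
      have "real z ^ 3 \<le> real z ^ k" using that k by (intro power_increasing) auto
      also have "\<dots> \<le> 2 * (real f * real e)" using half(2) that by simp
      also have "\<dots> \<le> real b * (real b * real e)" using that b2 by (intro mult_mono) auto
      finally show ?thesis by (simp add: power2_eq_square mult_ac)
    qed
    have vx: "(real v * real x) ^ 3 \<le> (real b ^ 2 * real d) * (real b ^ 2 * real c)"
      unfolding power_mult_distrib
      using cube[OF v(1) v(2)] cube[OF x(1) x(2)] sts acd by (intro mult_mono) auto
    have "1 ^ 3 \<le> (real v * real x * U * M) ^ 3" using main by (intro power_mono) auto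
    also have "\<dots> = (real v * real x) ^ 3 * (U * M) ^ 3" by (simp add: power_mult_distrib)
    also have "\<dots> \<le> (real b ^ 2 * real d) * (real b ^ 2 * real c) * (U * M) ^ 3"
      using vx M0 by (intro mult_right_mono) (auto simp: U_def)
    finally have "ln 1 \<le> ln ((real b ^ 2 * real d) * (real b ^ 2 * real c) * (U * M) ^ 3)"
      by (intro ln_mono) auto
    also have "\<dots> = 4 * lb + lc + ld + 3 * (real \<rho> * (4 * lb + lc) + ln M)"
    proof -
      have pos: "real b > 0" "real c > 0" "real d > 0" "U > 0" using b2 bc' cd' by (auto simp: U_def)
      have "ln U = real \<rho> * (4 * lb + lc)" using pos by (simp add: U_def ln_realpow ln_mult_pos lb_def lc_def)
      moreover have "ln ((real b ^ 2 * real d) * (real b ^ 2 * real c) * (U * M) ^ 3) =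
         (2 * lb + ld) + (2 * lb + lc) + 3 * (ln U + ln M)"
        using pos M0 by (simp add: ln_realpow ln_mult_pos lb_def lc_def ld_def)
      ultimately show ?thesis by simp
    qed
    finally have ge0: "0 \<le> 4 * lb + lc + ld + 3 * (real \<rho> * (4 * lb + lc) + ln M)" by simp
    have \<rho>r: "real \<rho> = real r \<or> real \<rho> = real r + 1" using \<rho>(1) by auto
    have lnM: "ln M = - ld \<or> ln M = - ((2 * real \<rho> + 1) * lc)"
    proof -
      have "ln (1 / real d) = - ld" using b2 bc' cd' by (simp add: ld_def ln_div)
      moreover have "ln ((1 / real c) ^ (2 * \<rho> + 1)) = - ((2 * real \<rho> + 1) * lc)"
        using b2 bc' by (simp add: lc_def ln_realpow ln_div algebra_simps)
      ultimately show ?thesis unfolding M_def max_def by (simp only: split: if_splits) auto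
    qed
    show False
      using lnM ge0 log_size_contradiction[OF lb0 lbc r(1) r2 \<rho>r] lb0 by auto
  qed
  show False
  proof (cases "n > 0")
    case True
    thus False using contra[of a b] by (simp add: N_def)
  next
    case False
    thus False using contra[of b a] by (simp add: N_def algebra_simps)
  qed
qed

lemma card_large_elements:
  assumes k: "k \<ge> 3" and D: "property_D k n S" and n: "\<bar>real_of_int n\<bar> \<ge> 7" "\<bar>real_of_int n\<bar> \<ge> pade_const k"
  shows "card {a \<in> S. \<bar>real_of_int n\<bar> ^ 3 \<le> real a} \<le> 99"
proof (rule ccontr)
  assume *: "\<not> ?thesis"
  define B where "B = {a \<in> S. \<bar>real_of_int n\<bar> ^ 3 \<le> real a}"
  have fin: "finite B" using D by (simp add: B_def property_D_def)
  define e where "e i = sorted_list_of_set B ! i" for i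
  have len: "length (sorted_list_of_set B) \<ge> 100" using * by (simp add: B_def)
  have eB: "e i \<in> B" if "i < 100" for i
    using that len fin nth_mem[of i "sorted_list_of_set B"] by (simp add: e_def)
  have less: "e i < e j" if "i < j" "j < 100" for i j
    using that len unfolding e_def by (intro sorted_wrt_nth_less[OF strict_sorted_list_of_set]) auto
  \<comment> \<open>Since \<open>7^3 = 343 \<ge> 256 = 16^2\<close>, every element absorbs the
    square of the constant 16 in the gap principle.\<close>
  have "(7::real) ^ 3 \<le> \<bar>real_of_int n\<bar> ^ 3" using n by (intro power_mono) auto
  hence big: "real (e i) \<ge> 256" if "i < 100" for i using eB[OF that] by (simp add: B_def)
  have gap: "real (e i) * real (e (i + 2)) \<le> 16 * real (e (i + 3))" if "i + 3 < 100" for i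
    by (rule gap_principle[OF k D, of "e i" "e (i + 1)"])
       (use that eB[of i] eB[of "i + 1"] eB[of "i + 2"] eB[of "i + 3"] less n in \<open>auto simp: B_def\<close>)
  \<comment> \<open>Each step multiplies by \<open>e (i + t)^2\<close>: one factor is kept as a
    further \<open>e i\<close>, the other pays for \<open>16^2\<close>. Squaring the gap inequality
    makes the gain a whole exponent.\<close>
  have grow: "real (e i) ^ (2 + t) \<le> real (e (i + 2 + t)) ^ 2" if "i + 2 + t < 100" for i t
    using that
  proof (induction t)
    case 0
    thus ?case using less[of i "i + 2"] by (auto intro: power_mono)
  next
    case (Suc t)
    have *: "real (e i) \<le> real (e (i + t))" using less[of i "i + t"] Suc.prems by (cases "t = 0") auto
    have "256 * real (e i) \<le> real (e (i + t)) * real (e (i + t))"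
      using * big[of "i + t"] Suc.prems by (intro mult_mono) auto
    hence "256 * (real (e i) ^ (2 + Suc t)) \<le> (real (e (i + t)))\<^sup>2 * (real (e (i + 2 + t)))\<^sup>2"
      using Suc mult_mono[of "256 * real (e i)" "(real (e (i + t)))\<^sup>2" "real (e i) ^ (2 + t)" "(real (e (i + 2 + t)))\<^sup>2"]
      by (simp add: power2_eq_square mult_ac)
    also have "\<dots> = (real (e (i + t)) * real (e (i + t + 2)))\<^sup>2" by (simp add: power_mult_distrib add_ac)
    also have "\<dots> \<le> (16 * real (e (i + t + 3)))\<^sup>2" using Suc.prems by (intro power_mono gap) auto
    finally show ?case by (simp add: power_mult_distrib numeral_eq_Suc)
  qed
  have grow': "real (e i) ^ h \<le> real (e (i + 2 * h))" if "i + 2 * h < 100" "h \<ge> 1" for i h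
  proof -
    have eq: "2 + (2 * h - 2) = 2 * h" "i + 2 + (2 * h - 2) = i + 2 * h" using that by auto
    have "real (e i) ^ (2 + (2 * h - 2)) \<le> real (e (i + 2 + (2 * h - 2))) ^ 2"
      using that by (intro grow) auto
    hence "(real (e i) ^ h)\<^sup>2 \<le> real (e (i + 2 * h)) ^ 2"
      unfolding eq by (simp only: mult.commute[of 2 h] power_mult)
    thus ?thesis by (rule power2_le_imp_le) simp
  qed
  show False
  proof (rule no_very_large_element[OF k D, of "e 0" "e 1" "e 81" "e 99"])
    show "real (e 1) ^ 40 \<le> real (e 81)" using grow'[of 1 40] by simp
    show "real (e 81) ^ 9 \<le> real (e 99)" using grow'[of 81 9] by simp
  qed (use eB[of 0] eB[of 1] eB[of 81] eB[of 99] less[of 0 1] n in \<open>auto simp: B_def\<close>)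
qed

theorem theorem1p1:
  fixes k :: nat
  assumes "k \<ge> 3"
  shows "(\<forall>L::real. L \<ge> 3 \<longrightarrow>
            (\<exists>C::real. \<forall>\<^sub>F n::int in filtercomap abs at_top.
               ereal_of_enat (M_above k n L) \<le> ereal C))
       \<and> (\<exists>C::real. \<forall>\<^sub>F n::int in filtercomap abs at_top.
             ereal_of_enat (M k n) \<le> ereal (C * ln (real_of_int \<bar>n\<bar>)))"
proof (intro conjI allI impI)
  have large: "\<forall>\<^sub>F n::int in filtercomap abs at_top. \<bar>real_of_int n\<bar> \<ge> 7 \<and> \<bar>real_of_int n\<bar> \<ge> pade_const k"
    unfolding eventually_filtercomap_at_top_linorder
  proof (intro exI[of _ "max 7 \<lceil>pade_const k\<rceil>"] allI impI)
    fix n :: int assume "max 7 \<lceil>pade_const k\<rceil> \<le> \<bar>n\<bar>"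
    hence "7 \<le> \<bar>n\<bar>" "\<lceil>pade_const k\<rceil> \<le> \<bar>n\<bar>" by auto
    thus "\<bar>real_of_int n\<bar> \<ge> 7 \<and> \<bar>real_of_int n\<bar> \<ge> pade_const k" by (simp add: ceiling_le_iff)
  qed
  {
    fix L :: real assume L: "L \<ge> 3"
    show "\<exists>C::real. \<forall>\<^sub>F n::int in filtercomap abs at_top. ereal_of_enat (M_above k n L) \<le> ereal C"
    proof (rule exI[of _ 99], use large in eventually_elim)
      case (elim n)
      have "M_above k n L \<le> enat 99"
        unfolding M_above_def
      proof (intro SUP_least)
        fix S assume "S \<in> {S. property_D k n S}"
        hence D: "property_D k n S" by simp
        have "\<bar>real_of_int n\<bar> ^ 3 = \<bar>real_of_int n\<bar> powr 3" using elim by (simp add: powr_numeral)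
        also have "\<dots> \<le> \<bar>real_of_int n\<bar> powr L" using L elim by (intro powr_mono) auto
        finally have le: "\<bar>real_of_int n\<bar> ^ 3 \<le> real_of_int \<bar>n\<bar> powr L" by simp
        have "card {a \<in> S. real_of_int \<bar>n\<bar> powr L \<le> real a} \<le> card {a \<in> S. \<bar>real_of_int n\<bar> ^ 3 \<le> real a}"
          using D le by (intro card_mono) (auto simp: property_D_def)
        also have "\<dots> \<le> 99" using card_large_elements[OF assms D] elim by simp
        finally show "enat (card {a \<in> S. real_of_int \<bar>n\<bar> powr L \<le> real a}) \<le> enat 99" by simp
      qed
      hence "ereal_of_enat (M_above k n L) \<le> ereal_of_enat (enat 99)" by (simp only: ereal_of_enat_le_iff)
      thus ?case by simp
    qed
  }
  obtain C where C: "\<forall>\<^sub>F n::int in filtercomap abs at_top. \<forall>S. property_D k n S \<longrightarrow>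
    real (card {a \<in> S. real a < \<bar>real_of_int n\<bar> ^ 3}) \<le> C * ln \<bar>real_of_int n\<bar>"
    using card_small_elements[of k] assms by auto
  show "\<exists>C::real. \<forall>\<^sub>F n::int in filtercomap abs at_top. ereal_of_enat (M k n) \<le> ereal (C * ln (real_of_int \<bar>n\<bar>))"
  \<comment> \<open>At most 99 large elements, and 99 is at most
    \<open>99 * ln \<bar>n\<bar>\<close> because \<open>\<bar>n\<bar> \<ge> 3\<close>.\<close>
  proof (rule exI[of _ "C + 99"], use large C in eventually_elim)
    case (elim n)
    define R where "R = (C + 99) * ln \<bar>real_of_int n\<bar>"
    have ln1: "ln \<bar>real_of_int n\<bar> \<ge> 1"
    proof -
      have "exp 1 \<le> (3::real)" by (rule exp_le)
      hence "ln (exp 1) \<le> ln \<bar>real_of_int n\<bar>" using elim by (subst ln_le_cancel_iff) auto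
      thus ?thesis by simp
    qed
    have card: "real (card S) \<le> R" if D: "property_D k n S" for S
    proof -
      have "S = {a \<in> S. real a < \<bar>real_of_int n\<bar> ^ 3} \<union> {a \<in> S. \<bar>real_of_int n\<bar> ^ 3 \<le> real a}" by auto
      hence "card S \<le> card {a \<in> S. real a < \<bar>real_of_int n\<bar> ^ 3} + card {a \<in> S. \<bar>real_of_int n\<bar> ^ 3 \<le> real a}"
        by (metis card_Un_le)
      also have "\<dots> \<le> card {a \<in> S. real a < \<bar>real_of_int n\<bar> ^ 3} + 99"
        using card_large_elements[OF assms D] elim by simp
      finally have "real (card S) \<le> C * ln \<bar>real_of_int n\<bar> + 99" using elim D by fastforce
      thus ?thesis using ln1 by (simp add: R_def algebra_simps)
    qed
    \<comment> \<open>The empty tuple shows \<open>R \<ge> 0\<close>, so rounding \<open>R\<close>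
      down to a natural number does not raise the bound.\<close>
    have "real (card ({}::nat set)) \<le> R" by (rule card) (simp add: property_D_def)
    hence R0: "R \<ge> 0" by simp
    have "M k n \<le> enat (nat \<lfloor>R\<rfloor>)"
      unfolding M_def
    proof (intro SUP_least)
      fix S assume "S \<in> {S. property_D k n S}"
      hence "real (card S) \<le> R" using card by simp
      thus "enat (card S) \<le> enat (nat \<lfloor>R\<rfloor>)" by (simp add: le_nat_floor)
    qed
    hence "ereal_of_enat (M k n) \<le> ereal_of_enat (enat (nat \<lfloor>R\<rfloor>))" by (simp only: ereal_of_enat_le_iff)
    also have "\<dots> \<le> ereal R" using R0 by simp
    finally show ?case by (simp add: R_def)
  qed
qed

end
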